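(* Let $p>0$, $E>0$ and assume $u(\cdot,0)\in H^p(\mathbb{R}^n)$ with $\|u(\cdot,0)\|_{H^p}\le E$. Let $g=Au(\cdot,0)$, let $g^\delta\in L^2(\mathbb{R}^n)$ satisfy $\|g-g^\delta\|_{L^2}\le\delta$, and let $$u_\beta^\delta=\underset{u\in L^2(\mathbb{R}^n)}{\mathrm{argmin}}\ \|Au-g^\delta\|_{L^2}^2+\|(I-C_\beta)u\|_{L^2}^2 .$$ Put $q=p/(2\tau)$, $\rho=C(p)E$, and $\Theta_q(t)=\sqrt{t}\,f_q(t)$ for $t\in(0,1)$. Then for the a-priori selection rule $\beta(\delta)=\left(\Theta_q^{-1}(\delta/\rho)\right)^{1/(2s)}$ we have $$\|u(\cdot,0)-u_{\beta(\delta)}^\delta\|_{L^2}\le K\rho f_q\left(\delta^2/\rho^2\right)(1+o(1))\quad\text{as }\delta\to0,$$ where $K$ is a constant independent of $E$ and $\delta$.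
   Context: Let $n\in\mathbb{N}$, $T>0$, $\tau\in(0,1]$, and let $\gamma:(0,T)\to(0,\infty)$ be integrable. The Fourier transform is $\hat f(\xi)=\mathcal{F}(f)(\xi)=\int_{\mathbb{R}^n} f(x)e^{-2\pi i x\cdot\xi}\,dx$. Put $\psi(\xi)=\exp\left(-|2\pi\xi|^{2\tau}\int_0^T\gamma(\lambda)\,d\lambda\right)$ and let $A:L^2(\mathbb{R}^n)\to L^2(\mathbb{R}^n)$ be $Af=\mathcal{F}^{-1}(\psi\hat f)$; $\bar A=A/\sqrt e$. The function $u(\cdot,0)\in L^2(\mathbb{R}^n)$ is the exact initial temperature, and $g=Au(\cdot,0)=u(\cdot,T)$ the exact final temperature. Kernel: $\phi\in L^1(\mathbb{R}^n)$ is smooth, real-valued, $\int_{\mathbb{R}^n}\phi=1$, $|\hat\phi(\xi)|<1$ for $\xi\ne0$, $\hat\phi$ is radially decreasing (decreasing along every ray from the origin), and for some $s>0$, $|1-\hat\phi(\xi)|\sim|\xi|^s$ as $\xi\to0$, where $a\sim b$ means that $a/b$ stays between two positive constants in the limit considered. For $\beta>0$, $\phi_\beta(x)=\beta^{-n}\phi(x/\beta)$ and $C_\beta f=\phi_\beta\star f$ on $L^2(\mathbb{R}^n)$; $I$ is the identity. $\|f\|_{H^p}^2=\int_{\mathbb{R}^n}(1+|\xi|^2)^p|\hat f(\xi)|^2\,d\xi$. For $q>0$, $f_q(\lambda)=(-\ln\lambda)^{-q}$, $\lambda\in(0,1)$; $f_q(\bar A^*\bar A)$ is given by functional calculus, i.e.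 it is the Fourier multiplier with symbol $f_q(\psi(\xi)^2/e)=\left(1+2|2\pi\xi|^{2\tau}\int_0^T\gamma(\lambda)\,d\lambda\right)^{-q}$. $C(p)>0$ denotes a constant depending on $p$ (not on $E$) such that every $v\in H^p(\mathbb{R}^n)$ with $\|v\|_{H^p}\le E$ can be written $v=f_q(\bar A^*\bar A)w$ with $q=p/(2\tau)$ and $\|w\|_{L^2}\le C(p)E$. *)

theory Defs
  imports "HOL-Analysis.Analysis" "HOL-Library.Landau_Symbols"
begin

text \<open>
  Elements of L2 are represented by Borel functions; two of them are the same element if they
  agree almost everywhere. Scalars are complex.
\<close>

definition L2 :: "('a::euclidean_space \<Rightarrow> complex) set" where
  "L2 = {f \<in> borel_measurable lborel. integrable lborel (\<lambda>x. (cmod (f x))\<^sup>2)}"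

definition L2norm :: "('a::euclidean_space \<Rightarrow> complex) \<Rightarrow> real" where
  "L2norm f = sqrt (\<integral>x. (cmod (f x))\<^sup>2 \<partial>lborel)"

definition fourier :: "('a::euclidean_space \<Rightarrow> complex) \<Rightarrow> 'a \<Rightarrow> complex" where
  "fourier f \<xi> = (\<integral>x. f x * cis (- 2 * pi * (x \<bullet> \<xi>)) \<partial>lborel)"

text \<open>
  The Fourier transform on L2 is the L2-limit, as \<open>R\<close> tends to infinity, of the transforms of the
  truncations of \<open>f\<close> to balls of radius \<open>R\<close> (these truncations are integrable). The value is
  determined up to null sets only; so is that of the inverse transform.
\<close>

definition fourier_L2 :: "('a::euclidean_space \<Rightarrow> complex) \<Rightarrow> 'a \<Rightarrow> complex" where
  "fourier_L2 f = (SOME h. h \<in> L2 \<and>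
     ((\<lambda>R. L2norm (\<lambda>\<xi>. fourier (\<lambda>x. indicator (cball 0 R) x * f x) \<xi> - h \<xi>)) \<longlongrightarrow> 0) at_top)"

definition inv_fourier_L2 :: "('a::euclidean_space \<Rightarrow> complex) \<Rightarrow> 'a \<Rightarrow> complex" where
  "inv_fourier_L2 h = (SOME f. f \<in> L2 \<and> (AE \<xi> in lborel. fourier_L2 f \<xi> = h \<xi>))"

definition fourier_multiplier ::
    "('a::euclidean_space \<Rightarrow> real) \<Rightarrow> ('a \<Rightarrow> complex) \<Rightarrow> 'a \<Rightarrow> complex" where
  "fourier_multiplier m f = inv_fourier_L2 (\<lambda>\<xi>. complex_of_real (m \<xi>) * fourier_L2 f \<xi>)"

definition Sobolev :: "real \<Rightarrow> ('a::euclidean_space \<Rightarrow> complex) set" where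
  "Sobolev p = {f \<in> L2. integrable lborel (\<lambda>\<xi>. (1 + (norm \<xi>)\<^sup>2) powr p * (cmod (fourier_L2 f \<xi>))\<^sup>2)}"

definition Sobolev_norm :: "real \<Rightarrow> ('a::euclidean_space \<Rightarrow> complex) \<Rightarrow> real" where
  "Sobolev_norm p f =
     sqrt (\<integral>\<xi>. (1 + (norm \<xi>)\<^sup>2) powr p * (cmod (fourier_L2 f \<xi>))\<^sup>2 \<partial>lborel)"

definition heat_symbol :: "(real \<Rightarrow> real) \<Rightarrow> real \<Rightarrow> real \<Rightarrow> 'a::euclidean_space \<Rightarrow> real" where
  "heat_symbol \<gamma> T \<tau> \<xi> =
     exp (- ((norm ((2 * pi) *\<^sub>R \<xi>)) powr (2 * \<tau>) * (LINT l:{0<..<T}|lborel. \<gamma> l)))"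

definition heat_op ::
    "(real \<Rightarrow> real) \<Rightarrow> real \<Rightarrow> real \<Rightarrow> ('a::euclidean_space \<Rightarrow> complex) \<Rightarrow> 'a \<Rightarrow> complex" where
  "heat_op \<gamma> T \<tau> = fourier_multiplier (heat_symbol \<gamma> T \<tau>)"

definition f_log :: "real \<Rightarrow> real \<Rightarrow> real" where
  "f_log q l = (- ln l) powr (- q)"

text \<open>
  With \<open>A\<close> the operator \<open>heat_op\<close> and \<open>B = A / sqrt e\<close>, this is the function \<open>f_log q\<close> of \<open>B\<^sup>* B\<close>,
  which is the multiplier with the symbol below.
\<close>

definition source_op ::
    "(real \<Rightarrow> real) \<Rightarrow> real \<Rightarrow> real \<Rightarrow> real \<Rightarrow> ('a::euclidean_space \<Rightarrow> complex) \<Rightarrow> 'a \<Rightarrow> complex" where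
  "source_op \<gamma> T \<tau> q = fourier_multiplier (\<lambda>\<xi>. f_log q ((heat_symbol \<gamma> T \<tau> \<xi>)\<^sup>2 / exp 1))"

definition Theta :: "real \<Rightarrow> real \<Rightarrow> real" where
  "Theta q t = sqrt t * f_log q t"

text \<open>\<open>Theta q\<close> is used on the open unit interval only, where it is injective for positive \<open>q\<close>.\<close>

definition Theta_inv :: "real \<Rightarrow> real \<Rightarrow> real" where
  "Theta_inv q = the_inv_into {0<..<1} (Theta q)"

fun Ck :: "nat \<Rightarrow> ('a::euclidean_space \<Rightarrow> real) \<Rightarrow> bool" where
  "Ck 0 f \<longleftrightarrow> continuous_on UNIV f"
| "Ck (Suc k) f \<longleftrightarrow>
     f differentiable_on UNIV \<and> (\<forall>v. Ck k (\<lambda>x. frechet_derivative f (at x) v))"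

definition smooth :: "('a::euclidean_space \<Rightarrow> real) \<Rightarrow> bool" where
  "smooth f \<longleftrightarrow> (\<forall>k. Ck k f)"

text \<open>
  Being radially decreasing presupposes that the transform of \<open>\<phi>\<close> is real-valued.
  The two-sided asymptotic comparison at the origin is membership in the Landau class \<open>\<Theta>[at 0]\<close>.
\<close>

definition mollifier_kernel :: "real \<Rightarrow> ('a::euclidean_space \<Rightarrow> real) \<Rightarrow> bool" where
  "mollifier_kernel s \<phi> \<longleftrightarrow>
     integrable lborel \<phi> \<and> smooth \<phi> \<and> (\<integral>x. \<phi> x \<partial>lborel) = 1 \<and>
     (\<forall>\<xi>. \<xi> \<noteq> 0 \<longrightarrow> cmod (fourier (\<lambda>x. complex_of_real (\<phi> x)) \<xi>) < 1) \<and>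
     (\<forall>\<xi>. fourier (\<lambda>x. complex_of_real (\<phi> x)) \<xi> \<in> \<real>) \<and>
     (\<forall>\<xi>. antimono_on {0..} (\<lambda>r. Re (fourier (\<lambda>x. complex_of_real (\<phi> x)) (r *\<^sub>R \<xi>)))) \<and>
     (\<lambda>\<xi>. cmod (1 - fourier (\<lambda>x. complex_of_real (\<phi> x)) \<xi>)) \<in> \<Theta>[at 0](\<lambda>\<xi>. norm \<xi> powr s)"

definition dilate :: "real \<Rightarrow> ('a::euclidean_space \<Rightarrow> real) \<Rightarrow> 'a \<Rightarrow> real" where
  "dilate \<beta> \<phi> x = \<phi> (x /\<^sub>R \<beta>) / \<beta> ^ DIM('a)"

definition mollify ::
    "('a::euclidean_space \<Rightarrow> real) \<Rightarrow> real \<Rightarrow> ('a \<Rightarrow> complex) \<Rightarrow> 'a \<Rightarrow> complex" where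
  "mollify \<phi> \<beta> f x = (\<integral>y. complex_of_real (dilate \<beta> \<phi> (x - y)) * f y \<partial>lborel)"

definition regularized ::
    "(real \<Rightarrow> real) \<Rightarrow> real \<Rightarrow> real \<Rightarrow> ('a::euclidean_space \<Rightarrow> real) \<Rightarrow> real \<Rightarrow> ('a \<Rightarrow> complex) \<Rightarrow> 'a \<Rightarrow> complex" where
  "regularized \<gamma> T \<tau> \<phi> \<beta> h = arg_min_on
     (\<lambda>u. (L2norm (\<lambda>x. heat_op \<gamma> T \<tau> u x - h x))\<^sup>2 + (L2norm (\<lambda>x. u x - mollify \<phi> \<beta> u x))\<^sup>2) L2"

end

theory Submission
  imports Defs "HOL-Probability.Characteristic_Functions" "HOL-Real_Asymp.Real_Asymp"
begin

text \<open>
  Plancherel's theorem turns the problem into one about symbols. With \<open>\<psi>\<close> the heat symbol and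
  \<open>m \<xi> = 1 - \<phi>^(\<beta> \<xi>)\<close>, where \<open>\<phi>^\<close> is the transform of \<open>\<phi>\<close>, the minimizer has the transform
  \<open>\<psi> g^ / (\<psi>\<^sup>2 + m\<^sup>2)\<close>, and the error splits into a bias with symbol \<open>m\<^sup>2 / (\<psi>\<^sup>2 + m\<^sup>2)\<close> and a noise term
  with symbol \<open>\<psi> / (\<psi>\<^sup>2 + m\<^sup>2)\<close>. Write \<open>a = \<beta> powr (2 * s)\<close>. Since \<open>m\<close> dominates \<open>sqrt a\<close> for
  \<open>norm \<xi> \<ge> 1\<close> while \<open>\<psi>\<close> is bounded below for \<open>norm \<xi> < 1\<close>, the noise is \<open>O(\<delta> / sqrt a) = O(\<rho> f_log q a)\<close>.
  The bias is \<open>O(\<rho> f_log q a)\<close> as well: where \<open>\<psi>\<^sup>2 \<ge> sqrt a\<close> its symbol is at most a power of \<open>- ln a\<close> times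
  \<open>sqrt a\<close>, and elsewhere \<open>norm \<xi> powr (2 * \<tau>)\<close> is at least of order \<open>- ln a\<close>, so that the Sobolev
  weight yields the factor. Finally \<open>f_log q a\<close> and \<open>f_log q (\<delta>\<^sup>2 / \<rho>\<^sup>2)\<close> are comparable, because
  \<open>ln (\<delta>\<^sup>2 / \<rho>\<^sup>2) = ln a - 2 * q * ln (- ln a)\<close>. The constant absorbs the factor \<open>1 + o(1)\<close>.
\<close>

subsection \<open>The space of square integrable functions\<close>

text \<open>Elements of L2 are concrete functions, and \<open>fourier_L2\<close>, its inverse and
  the minimizer are picked by choice operators. Identities between transforms therefore hold only
  almost everywhere, and linearity of \<open>fourier_L2\<close> is expressed as isometry on
  differences. Nothing is known about \<open>regularized\<close> until some minimizer exists;
  surjectivity of the transform on L2 provides one.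

  The selection rule becomes transparent with a = exp (-z). Then \<beta> to the power s is exp
  (-z/2), and the equation defining a reads \<delta>/\<rho> = exp (-z/2) z^(-q). Hence the noise
  factor \<delta> exp (z/2) is exactly \<rho> z^(-q) = \<rho> \<open>f_log q a\<close>, the order of
  the bias.

  The split of frequencies at \<psi>^2 = sqrt a is not delicate. The square of m contributes a
  factor a, the denominator takes back sqrt a, and the remaining exp (-z/2) beats every power of z;
  any threshold a^t with 0 < t < 1 would serve. All smallness conditions concern z alone, hence
  \<delta>/\<rho>. That is why E enters the threshold for \<delta> but not the constant.\<close>

lemma L2_iff:
  "f \<in> L2 \<longleftrightarrow> f \<in> borel_measurable borel \<and> (\<integral>\<^sup>+x. ennreal ((cmod (f x))\<^sup>2) \<partial>lborel) < \<infinity>"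
proof -
  have "(\<integral>\<^sup>+x. ennreal (norm ((cmod (f x))\<^sup>2)) \<partial>lborel) = (\<integral>\<^sup>+x. ennreal ((cmod (f x))\<^sup>2) \<partial>lborel)"
    by simp
  then show ?thesis
    unfolding L2_def integrable_iff_bounded by auto
qed

lemma L2_measurable [measurable_dest]: "f \<in> L2 \<Longrightarrow> f \<in> borel_measurable borel"
  by (simp add: L2_iff)

lemma L2_integrable_square: "f \<in> L2 \<Longrightarrow> integrable lborel (\<lambda>x. (cmod (f x))\<^sup>2)"
  by (simp add: L2_def)

lemma L2norm_nonneg [simp]: "0 \<le> L2norm f"
  by (simp add: L2norm_def)

lemma L2norm_square: "(L2norm f)\<^sup>2 = (\<integral>x. (cmod (f x))\<^sup>2 \<partial>lborel)"
  by (simp add: L2norm_def)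

lemma nn_integral_eq_L2norm:
  "f \<in> L2 \<Longrightarrow> (\<integral>\<^sup>+x. ennreal ((cmod (f x))\<^sup>2) \<partial>lborel) = ennreal ((L2norm f)\<^sup>2)"
  unfolding L2norm_square by (rule nn_integral_eq_integral) (auto simp: L2_integrable_square)

lemma L2_nn_integral_boundI:
  assumes "f \<in> borel_measurable borel" "0 \<le> c"
    and "(\<integral>\<^sup>+x. ennreal ((cmod (f x))\<^sup>2) \<partial>lborel) \<le> ennreal (c\<^sup>2)"
  shows "f \<in> L2" "L2norm f \<le> c"
proof -
  show f: "f \<in> L2"
    using assms by (auto simp: L2_iff intro: le_less_trans)
  have "ennreal ((L2norm f)\<^sup>2) \<le> ennreal (c\<^sup>2)"
    using assms nn_integral_eq_L2norm[OF f] by simp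
  then show "L2norm f \<le> c"
    using assms(2) by (simp add: ennreal_le_iff power2_le_iff_abs_le)
qed

lemma L2_dominated:
  assumes [measurable]: "f \<in> borel_measurable borel" and g: "g \<in> L2" and B: "0 \<le> B"
    and le: "AE x in lborel. cmod (f x) \<le> B * cmod (g x)"
  shows "f \<in> L2" "L2norm f \<le> B * L2norm g"
proof -
  note [measurable] = L2_measurable[OF g]
  have "(\<integral>\<^sup>+x. ennreal ((cmod (f x))\<^sup>2) \<partial>lborel) \<le> (\<integral>\<^sup>+x. ennreal (B\<^sup>2) * ennreal ((cmod (g x))\<^sup>2) \<partial>lborel)"
  proof (rule nn_integral_mono_AE)
    show "AE x in lborel. ennreal ((cmod (f x))\<^sup>2) \<le> ennreal (B\<^sup>2) * ennreal ((cmod (g x))\<^sup>2)"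
      using le
    proof eventually_elim
      case (elim x)
      then have "(cmod (f x))\<^sup>2 \<le> (B * cmod (g x))\<^sup>2"
        by (intro power_mono) auto
      then show ?case
        by (simp add: power_mult_distrib ennreal_leI flip: ennreal_mult)
    qed
  qed
  also have "\<dots> = ennreal (B\<^sup>2) * ennreal ((L2norm g)\<^sup>2)"
    by (simp add: nn_integral_cmult nn_integral_eq_L2norm[OF g])
  also have "\<dots> = ennreal ((B * L2norm g)\<^sup>2)"
    by (simp add: ennreal_mult power_mult_distrib)
  finally show "f \<in> L2" "L2norm f \<le> B * L2norm g"
    using L2_nn_integral_boundI[of f "B * L2norm g"] B by auto
qed

lemma L2norm_cong_AE:
  assumes "f \<in> borel_measurable borel" "g \<in> borel_measurable borel" "AE x in lborel. f x = g x"
  shows "L2norm f = L2norm g"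
  unfolding L2norm_def using assms by (intro arg_cong[where f=sqrt] integral_cong_AE) auto

lemma AE_eq_0_if_L2norm_eq_0:
  assumes "f \<in> L2" "L2norm f = 0"
  shows "AE x in lborel. f x = 0"
  using integral_nonneg_eq_0_iff_AE[OF L2_integrable_square[OF assms(1)]] assms(2)
  by (simp add: L2norm_def)

lemma L2_zero [simp]: "(\<lambda>x. 0) \<in> L2"
  by (simp add: L2_def)

lemma L2norm_zero [simp]: "L2norm (\<lambda>x. 0) = 0"
  by (simp add: L2norm_def)

lemma L2_cnj:
  assumes "f \<in> L2"
  shows "(\<lambda>x. cnj (f x)) \<in> L2"
proof -
  have [measurable]: "cnj \<in> borel_measurable borel"
    by (intro borel_measurable_continuous_onI continuous_on_cnj continuous_on_id)
  note [measurable] = L2_measurable[OF assms]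
  show ?thesis by (rule L2_dominated(1)[OF _ assms, of _ 1]) auto
qed

lemma L2norm_cnj [simp]: "L2norm (\<lambda>x. cnj (f x)) = L2norm f"
  by (simp add: L2norm_def)

lemma L2norm_minus [simp]: "L2norm (\<lambda>x. - f x) = L2norm f"
  by (simp add: L2norm_def)

lemma L2norm_diff_commute: "L2norm (\<lambda>x. f x - g x) = L2norm (\<lambda>x. g x - f x)"
  by (simp add: L2norm_def norm_minus_commute)

lemma L2_mult_bounded:
  assumes f: "f \<in> L2" and m: "m \<in> borel_measurable borel" and B: "\<And>x. cmod (m x) \<le> B"
  shows "(\<lambda>x. m x * f x) \<in> L2" "L2norm (\<lambda>x. m x * f x) \<le> B * L2norm f"
proof -
  note [measurable] = m L2_measurable[OF f]
  have "0 \<le> B" using B[of undefined] norm_ge_zero order_trans by blast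
  then show "(\<lambda>x. m x * f x) \<in> L2" "L2norm (\<lambda>x. m x * f x) \<le> B * L2norm f"
    by (auto intro!: L2_dominated[OF _ f] AE_I2 simp: norm_mult B mult_right_mono)
qed

lemma L2_add:
  assumes "f \<in> L2" "g \<in> L2"
  shows "(\<lambda>x. f x + g x) \<in> L2"
proof -
  note [measurable] = L2_measurable[OF assms(1)] L2_measurable[OF assms(2)]
  have *: "(cmod (f x + g x))\<^sup>2 \<le> 2 * (cmod (f x))\<^sup>2 + 2 * (cmod (g x))\<^sup>2" for x
  proof -
    have "(cmod (f x + g x))\<^sup>2 \<le> (cmod (f x) + cmod (g x))\<^sup>2"
      by (intro power_mono norm_triangle_ineq) auto
    also have "\<dots> \<le> 2 * (cmod (f x))\<^sup>2 + 2 * (cmod (g x))\<^sup>2"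
      using sum_squares_bound[of "cmod (f x)" "cmod (g x)"] by (simp add: power2_sum)
    finally show ?thesis .
  qed
  have "integrable lborel (\<lambda>x. (cmod (f x + g x))\<^sup>2)"
    by (rule Bochner_Integration.integrable_bound[of _ "\<lambda>x. 2 * (cmod (f x))\<^sup>2 + 2 * (cmod (g x))\<^sup>2"])
      (use * assms in \<open>auto simp: L2_integrable_square\<close>)
  then show ?thesis by (auto simp: L2_def)
qed

lemma L2_uminus: "f \<in> L2 \<Longrightarrow> (\<lambda>x. - f x) \<in> L2"
  by (rule L2_dominated(1)[of _ f 1]) (auto simp: L2_measurable)

lemma L2_diff:
  assumes "f \<in> L2" "g \<in> L2"
  shows "(\<lambda>x. f x - g x) \<in> L2"
  using L2_add[OF assms(1) L2_uminus[OF assms(2)]] by simp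

lemma L2_mult_integrable:
  assumes "f \<in> L2" "g \<in> L2"
  shows "integrable lborel (\<lambda>x. f x * g x)"
    and "(\<integral>x. cmod (f x) * cmod (g x) \<partial>lborel) \<le> L2norm f * L2norm g"
    and "cmod (\<integral>x. f x * g x \<partial>lborel) \<le> L2norm f * L2norm g"
proof -
  note [measurable] = L2_measurable[OF assms(1)] L2_measurable[OF assms(2)]
  let ?I = "\<integral>\<^sup>+x. ennreal (cmod (f x)) * ennreal (cmod (g x)) \<partial>lborel"
  have "?I\<^sup>2 \<le> (\<integral>\<^sup>+x. (ennreal (cmod (f x)))\<^sup>2 \<partial>lborel) * (\<integral>\<^sup>+x. (ennreal (cmod (g x)))\<^sup>2 \<partial>lborel)"
    by (rule Cauchy_Schwarz_nn_integral) auto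
  also have "\<dots> = ennreal ((L2norm f * L2norm g)\<^sup>2)"
    by (simp add: ennreal_power nn_integral_eq_L2norm assms power_mult_distrib ennreal_mult)
  finally have *: "?I\<^sup>2 \<le> (ennreal (L2norm f * L2norm g))\<^sup>2"
    by (simp add: ennreal_power)
  then have le: "?I \<le> ennreal (L2norm f * L2norm g)"
  proof (cases ?I rule: ennreal_cases)
    case (real r)
    with * show ?thesis
      by (simp add: ennreal_power ennreal_le_iff power2_le_iff_abs_le)
  qed (simp add: ennreal_power top_unique)
  have eq: "?I = (\<integral>\<^sup>+x. ennreal (norm (f x * g x)) \<partial>lborel)"
    by (simp add: norm_mult ennreal_mult)
  show int: "integrable lborel (\<lambda>x. f x * g x)"
    using le eq by (auto simp: integrable_iff_bounded intro: le_less_trans)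
  have "ennreal (\<integral>x. norm (f x * g x) \<partial>lborel) = ?I"
    unfolding eq by (rule nn_integral_eq_integral[symmetric]) (use int in auto)
  then have "ennreal (\<integral>x. cmod (f x) * cmod (g x) \<partial>lborel) \<le> ennreal (L2norm f * L2norm g)"
    using le by (simp add: norm_mult)
  then show le': "(\<integral>x. cmod (f x) * cmod (g x) \<partial>lborel) \<le> L2norm f * L2norm g"
    by (subst (asm) ennreal_le_iff) auto
  show "cmod (\<integral>x. f x * g x \<partial>lborel) \<le> L2norm f * L2norm g"
    using integral_norm_bound[of lborel "\<lambda>x. f x * g x"] le' by (simp add: norm_mult)
qed

lemma L2norm_triangle:
  assumes "f \<in> L2" "g \<in> L2"
  shows "L2norm (\<lambda>x. f x + g x) \<le> L2norm f + L2norm g"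
proof -
  note [measurable] = L2_measurable[OF assms(1)] L2_measurable[OF assms(2)]
  have int: "integrable lborel (\<lambda>x. cmod (f x) * cmod (g x))"
    using integrable_norm[OF L2_mult_integrable(1)[OF assms]] by (simp add: norm_mult)
  have "(L2norm (\<lambda>x. f x + g x))\<^sup>2 \<le> (\<integral>x. (cmod (f x))\<^sup>2 + (cmod (g x))\<^sup>2 + 2 * (cmod (f x) * cmod (g x)) \<partial>lborel)"
    unfolding L2norm_square
  proof (rule integral_mono)
    show "integrable lborel (\<lambda>x. (cmod (f x + g x))\<^sup>2)"
      by (rule L2_integrable_square[OF L2_add[OF assms]])
    show "integrable lborel (\<lambda>x. (cmod (f x))\<^sup>2 + (cmod (g x))\<^sup>2 + 2 * (cmod (f x) * cmod (g x)))"
      using assms int by (auto simp: L2_integrable_square)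
    show "(cmod (f x + g x))\<^sup>2 \<le> (cmod (f x))\<^sup>2 + (cmod (g x))\<^sup>2 + 2 * (cmod (f x) * cmod (g x))" for x
      using power_mono[OF norm_triangle_ineq[of "f x" "g x"], of 2] by (simp add: power2_sum)
  qed
  also have "\<dots> = (L2norm f)\<^sup>2 + (L2norm g)\<^sup>2 + 2 * (\<integral>x. cmod (f x) * cmod (g x) \<partial>lborel)"
    using assms int by (simp add: L2norm_square L2_integrable_square)
  also have "\<dots> \<le> (L2norm f + L2norm g)\<^sup>2"
    using L2_mult_integrable(2)[OF assms] by (simp add: power2_sum)
  finally show ?thesis
    by (rule power2_le_imp_le) simp
qed

lemma L2norm_diff_le:
  assumes "f \<in> L2" "g \<in> L2"
  shows "L2norm (\<lambda>x. f x - g x) \<le> L2norm f + L2norm g"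
  using L2norm_triangle[OF assms(1) L2_uminus[OF assms(2)]] by simp

lemma L2norm_dist_triangle:
  assumes "f \<in> L2" "g \<in> L2" "h \<in> L2"
  shows "L2norm (\<lambda>x. f x - h x) \<le> L2norm (\<lambda>x. f x - g x) + L2norm (\<lambda>x. g x - h x)"
  using L2norm_triangle[OF L2_diff[OF assms(1,2)] L2_diff[OF assms(2,3)]] by simp

lemma L2norm_diff_ge:
  assumes "f \<in> L2" "g \<in> L2"
  shows "\<bar>L2norm f - L2norm g\<bar> \<le> L2norm (\<lambda>x. f x - g x)"
  using L2norm_triangle[OF L2_diff[OF assms] assms(2)] L2norm_triangle[OF L2_diff[OF assms(2,1)] assms(1)]
    L2norm_diff_commute[of f g] by auto

section \<open>Limits and completeness in L2\<close>

lemma L2norm_tendsto: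
  assumes "\<forall>\<^sub>F k in F. f k \<in> L2" "h \<in> L2" "((\<lambda>k. L2norm (\<lambda>x. f k x - h x)) \<longlongrightarrow> 0) F"
  shows "((\<lambda>k. L2norm (f k)) \<longlongrightarrow> L2norm h) F"
proof -
  have "\<forall>\<^sub>F k in F. norm (L2norm (f k) - L2norm h) \<le> L2norm (\<lambda>x. f k x - h x)"
    using assms(1) by eventually_elim (use L2norm_diff_ge assms(2) in auto)
  then have "((\<lambda>k. L2norm (f k) - L2norm h) \<longlongrightarrow> 0) F"
    by (rule Lim_null_comparison) (rule assms)
  then show ?thesis by (simp add: LIM_zero_iff)
qed

lemma L2_limit_unique:
  assumes "\<forall>\<^sub>F k in F. f k \<in> L2" "g \<in> L2" "h \<in> L2" "F \<noteq> bot"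
    and "((\<lambda>k. L2norm (\<lambda>x. f k x - g x)) \<longlongrightarrow> 0) F" "((\<lambda>k. L2norm (\<lambda>x. f k x - h x)) \<longlongrightarrow> 0) F"
  shows "AE x in lborel. g x = h x"
proof -
  have "((\<lambda>k. L2norm (\<lambda>x. f k x - g x) + L2norm (\<lambda>x. f k x - h x)) \<longlongrightarrow> 0 + 0) F"
    by (intro tendsto_add assms)
  moreover have "\<forall>\<^sub>F k in F. L2norm (\<lambda>x. g x - h x) \<le> L2norm (\<lambda>x. f k x - g x) + L2norm (\<lambda>x. f k x - h x)"
    using assms(1) by eventually_elim (metis L2norm_dist_triangle L2norm_diff_commute assms(2,3))
  ultimately have "L2norm (\<lambda>x. g x - h x) \<le> 0 + 0"
    by (rule tendsto_lowerbound) (rule assms)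
  then have "L2norm (\<lambda>x. g x - h x) = 0"
    by (simp add: order_antisym)
  then show ?thesis
    using AE_eq_0_if_L2norm_eq_0[OF L2_diff[OF assms(2,3)]] by simp
qed

text \<open>Fatou's lemma for the squared moduli. It is the device by which a pointwise limit is
  shown to lie in L2 at all, both for completeness and for extending Plancherel's identity.\<close>

lemma L2_Fatou:
  fixes f :: "nat \<Rightarrow> 'a::euclidean_space \<Rightarrow> complex"
  assumes f: "\<And>k. f k \<in> L2" and h: "h \<in> borel_measurable borel"
    and lim: "AE x in lborel. (\<lambda>k. f k x) \<longlonglongrightarrow> h x"
    and le: "\<forall>\<^sub>F k in sequentially. L2norm (f k) \<le> c" and c: "0 \<le> c"
  shows "h \<in> L2" "L2norm h \<le> c"
proof -
  note [measurable] = L2_measurable[OF f] h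
  have "(\<integral>\<^sup>+x. ennreal ((cmod (h x))\<^sup>2) \<partial>lborel) = (\<integral>\<^sup>+x. liminf (\<lambda>k. ennreal ((cmod (f k x))\<^sup>2)) \<partial>lborel)"
    using lim
  proof (intro nn_integral_cong_AE, eventually_elim)
    fix x assume "(\<lambda>k. f k x) \<longlonglongrightarrow> h x"
    then have "(\<lambda>k. ennreal ((cmod (f k x))\<^sup>2)) \<longlonglongrightarrow> ennreal ((cmod (h x))\<^sup>2)"
      by (intro tendsto_ennrealI tendsto_intros)
    then show "ennreal ((cmod (h x))\<^sup>2) = liminf (\<lambda>k. ennreal ((cmod (f k x))\<^sup>2))"
      by (intro lim_imp_Liminf[symmetric]) auto
  qed
  also have "\<dots> \<le> liminf (\<lambda>k. \<integral>\<^sup>+x. ennreal ((cmod (f k x))\<^sup>2) \<partial>lborel)"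
    by (rule nn_integral_liminf) auto
  also have "\<dots> \<le> liminf (\<lambda>k. ennreal (c\<^sup>2))"
  proof (rule Liminf_mono)
    show "\<forall>\<^sub>F k in sequentially. (\<integral>\<^sup>+x. ennreal ((cmod (f k x))\<^sup>2) \<partial>lborel) \<le> ennreal (c\<^sup>2)"
      using le by eventually_elim (auto simp: nn_integral_eq_L2norm[OF f] intro!: ennreal_leI power_mono)
  qed
  also have "\<dots> = ennreal (c\<^sup>2)"
    by (simp add: Liminf_const)
  finally show "h \<in> L2" "L2norm h \<le> c"
    using L2_nn_integral_boundI[OF h c] by auto
qed

lemma L2_dominated_convergence:
  fixes f :: "nat \<Rightarrow> 'a::euclidean_space \<Rightarrow> complex"
  assumes [measurable]: "\<And>k. f k \<in> borel_measurable borel" "h \<in> borel_measurable borel" and g: "g \<in> L2"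
    and lim: "AE x in lborel. (\<lambda>k. f k x) \<longlonglongrightarrow> h x"
    and le: "\<And>k. AE x in lborel. cmod (f k x - h x) \<le> cmod (g x)"
  shows "(\<lambda>k. L2norm (\<lambda>x. f k x - h x)) \<longlonglongrightarrow> 0"
proof -
  have "(\<lambda>k. \<integral>x. (cmod (f k x - h x))\<^sup>2 \<partial>lborel) \<longlonglongrightarrow> (\<integral>x. 0 \<partial>(lborel :: 'a measure))"
  proof (rule integral_dominated_convergence[where w="\<lambda>x. (cmod (g x))\<^sup>2"])
    show "integrable lborel (\<lambda>x. (cmod (g x))\<^sup>2)" by (rule L2_integrable_square[OF g])
    show "AE x in lborel. (\<lambda>k. (cmod (f k x - h x))\<^sup>2) \<longlonglongrightarrow> 0"
      using lim by eventually_elim (auto simp: LIM_zero_iff tendsto_norm_zero_iff intro!: tendsto_null_power)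
    show "AE x in lborel. norm ((cmod (f k x - h x))\<^sup>2) \<le> (cmod (g x))\<^sup>2" for k
      using le[of k] by eventually_elim (auto intro!: power_mono)
  qed auto
  then show ?thesis
    unfolding L2norm_def by (auto intro: tendsto_real_sqrt[where x=0, simplified])
qed

text \<open>The Riesz-Fischer argument: a rapidly Cauchy subsequence converges almost everywhere,
  and Fatou's lemma upgrades the pointwise limit to a limit in norm of the whole sequence.\<close>

lemma L2_complete:
  fixes f :: "nat \<Rightarrow> 'a::euclidean_space \<Rightarrow> complex"
  assumes f: "\<And>k. f k \<in> L2"
    and Cauchy: "\<And>e. 0 < e \<Longrightarrow> \<exists>N. \<forall>j\<ge>N. \<forall>k\<ge>N. L2norm (\<lambda>x. f j x - f k x) < e"
  shows "\<exists>h\<in>L2. (\<lambda>k. L2norm (\<lambda>x. f k x - h x)) \<longlonglongrightarrow> 0"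
proof -
  note [measurable] = L2_measurable[OF f]
  have "\<exists>N. \<forall>j\<ge>N. \<forall>k\<ge>N. L2norm (\<lambda>x. f j x - f k x) < (1/2)^i" for i :: nat
    using Cauchy by simp
  then obtain N where N: "\<And>i j k. j \<ge> N i \<Longrightarrow> k \<ge> N i \<Longrightarrow> L2norm (\<lambda>x. f j x - f k x) < (1/2)^i"
    by metis
  \<comment> \<open>The partial sums dominate every \<open>N i\<close>, and the extra
    \<open>i\<close> makes \<open>r\<close> strictly increasing, so \<open>r\<close> indexes a
    subsequence along which consecutive differences are below \<open>(1/2)^i\<close>.\<close>
  define r where "r i = (\<Sum>l\<le>i. N l) + i" for i
  have rN: "r i \<ge> N i" for i
    unfolding r_def using member_le_sum[of i "{..i}" N] by simp
  have rSuc: "r i < r (Suc i)" for i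
    by (simp add: r_def)
  have rSuc': "r (Suc i) \<ge> N i" for i
    using rN[of i] rSuc[of i] by linarith
  define d where "d i x = f (r (Suc i)) x - f (r i) x" for i x
  have d: "d i \<in> L2" for i
    unfolding d_def by (intro L2_diff f)
  note [measurable] = L2_measurable[OF d]
  have dle: "L2norm (d i) \<le> (1/2)^i" for i
    unfolding d_def using N[OF rSuc' rN] less_imp_le by blast
  \<comment> \<open>The weights \<open>2 ^ i\<close> are small against the squared norms \<open>4 ^ - i\<close> but force geometric decay pointwise.\<close>
  have "(\<integral>\<^sup>+x. (\<Sum>i. ennreal (2^i * (cmod (d i x))\<^sup>2)) \<partial>lborel) = (\<Sum>i. \<integral>\<^sup>+x. ennreal (2^i * (cmod (d i x))\<^sup>2) \<partial>lborel)"
    by (rule nn_integral_suminf) auto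
  also have "\<dots> \<le> (\<Sum>i. ennreal ((1/2)^i))"
  proof (rule suminf_le)
    fix i
    have "(\<integral>\<^sup>+x. ennreal (2^i * (cmod (d i x))\<^sup>2) \<partial>lborel) = ennreal (2^i) * ennreal ((L2norm (d i))\<^sup>2)"
      using d by (simp add: ennreal_mult nn_integral_cmult nn_integral_eq_L2norm)
    also have "\<dots> \<le> ennreal (2^i) * ennreal (((1/2)^i)\<^sup>2)"
      by (intro mult_left_mono ennreal_leI power_mono dle) auto
    also have "\<dots> = ennreal ((1/2)^i)"
      by (simp add: power2_eq_square field_simps flip: ennreal_mult)
    finally show "(\<integral>\<^sup>+x. ennreal (2^i * (cmod (d i x))\<^sup>2) \<partial>lborel) \<le> ennreal ((1/2)^i)" .
  qed auto
  also have "\<dots> = ennreal (\<Sum>i. (1/2)^i)"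
    by (rule suminf_ennreal_eq) (auto intro!: summable_sums summable_geometric)
  also have "\<dots> < \<infinity>" by simp
  finally have "AE x in lborel. (\<Sum>i. ennreal (2^i * (cmod (d i x))\<^sup>2)) \<noteq> \<infinity>"
    by (intro nn_integral_PInf_AE) auto
  then have conv: "AE x in lborel. convergent (\<lambda>i. f (r i) x)"
  proof eventually_elim
    case (elim x)
    then have "summable (\<lambda>i. 2^i * (cmod (d i x))\<^sup>2)"
      by (intro summable_suminf_not_top) auto
    then have "(\<lambda>i. 2^i * (cmod (d i x))\<^sup>2) \<longlonglongrightarrow> 0"
      by (rule summable_LIMSEQ_zero)
    then obtain K where K: "\<And>i. norm (2^i * (cmod (d i x))\<^sup>2) \<le> K"
      using convergent_imp_Bseq[of "\<lambda>i. 2^i * (cmod (d i x))\<^sup>2"] by (auto simp: convergent_def Bseq_def)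
    have "summable (\<lambda>i. d i x)"
    proof (rule summable_comparison_test[OF exI, of 0 "\<lambda>i. d i x" "\<lambda>i. sqrt K * (sqrt (1/2))^i"], intro allI impI)
      show "summable (\<lambda>i. sqrt K * (sqrt (1/2))^i)"
        by (intro summable_mult summable_geometric) (auto simp: real_sqrt_lt_1_iff)
      fix i
      have "(cmod (d i x))\<^sup>2 \<le> K * (1/2)^i"
        using K[of i] by (simp add: field_simps)
      then have "cmod (d i x) \<le> sqrt (K * (1/2)^i)"
        by (simp add: real_le_rsqrt)
      then show "norm (d i x) \<le> sqrt K * (sqrt (1/2))^i"
        by (simp add: real_sqrt_mult real_sqrt_power real_sqrt_divide)
    qed
    then have "convergent (\<lambda>n. (\<Sum>i<n. d i x) + f (r 0) x)"
      by (intro convergent_add convergent_const) (simp add: summable_iff_convergent)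
    then show ?case
      using sum_lessThan_telescope[of "\<lambda>i. f (r i) x"] by (simp add: d_def)
  qed
  define h where "h x = lim (\<lambda>i. f (r i) x)" for x
  have [measurable]: "h \<in> borel_measurable borel"
    unfolding h_def by measurable
  have lim: "AE x in lborel. (\<lambda>i. f (r i) x) \<longlonglongrightarrow> h x"
    using conv unfolding h_def by eventually_elim (simp add: convergent_LIMSEQ_iff)
  \<comment> \<open>Fatou's lemma along the subsequence with \<open>k\<close> fixed turns the Cauchy
    estimate into an estimate of the distance to the limit.\<close>
  have *: "(\<lambda>x. f k x - h x) \<in> L2 \<and> L2norm (\<lambda>x. f k x - h x) \<le> e"
    if e: "0 < e" and M: "\<And>j. j \<ge> M \<Longrightarrow> L2norm (\<lambda>x. f k x - f j x) \<le> e" for k e M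
  proof -
    have "\<forall>\<^sub>F i in sequentially. L2norm (\<lambda>x. f k x - f (r i) x) \<le> e"
      unfolding eventually_sequentially
    proof (intro exI[of _ M] allI impI M)
      fix i assume "M \<le> i"
      moreover have "i \<le> r i" by (simp add: r_def)
      ultimately show "M \<le> r i" by linarith
    qed
    moreover have "AE x in lborel. (\<lambda>i. f k x - f (r i) x) \<longlonglongrightarrow> f k x - h x"
      using lim by eventually_elim (intro tendsto_intros)
    ultimately show ?thesis
      using L2_Fatou[of "\<lambda>i x. f k x - f (r i) x" "\<lambda>x. f k x - h x" e] e L2_diff[OF f f] by auto
  qed
  have small: "\<exists>M. \<forall>k\<ge>M. (\<lambda>x. f k x - h x) \<in> L2 \<and> L2norm (\<lambda>x. f k x - h x) \<le> e" if e: "0 < e" for e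
  proof -
    obtain M where M: "\<forall>j\<ge>M. \<forall>k\<ge>M. L2norm (\<lambda>x. f j x - f k x) < e"
      using Cauchy[OF e] by blast
    show ?thesis
    proof (intro exI[of _ M] allI impI)
      fix k assume "M \<le> k"
      then show "(\<lambda>x. f k x - h x) \<in> L2 \<and> L2norm (\<lambda>x. f k x - h x) \<le> e"
        by (intro *[OF e, of M]) (use M in \<open>auto intro: less_imp_le\<close>)
    qed
  qed
  obtain M where "(\<lambda>x. f M x - h x) \<in> L2"
    using small[of 1] by auto
  \<comment> \<open>\<open>h\<close> is recovered as \<open>f M\<close> minus the difference just
    shown to lie in L2.\<close>
  then have "h \<in> L2"
    using L2_diff[OF f[of M]] by fastforce
  moreover have "(\<lambda>k. L2norm (\<lambda>x. f k x - h x)) \<longlonglongrightarrow> 0"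
  proof (rule LIMSEQ_I)
    fix e :: real assume "0 < e"
    then obtain M where "\<And>k. k \<ge> M \<Longrightarrow> L2norm (\<lambda>x. f k x - h x) \<le> e / 2"
      using small[of "e / 2"] by auto
    then show "\<exists>no. \<forall>n\<ge>no. norm (L2norm (\<lambda>x. f n x - h x) - 0) < e"
      using \<open>0 < e\<close> by (intro exI[of _ M]) fastforce
  qed
  ultimately show ?thesis by blast
qed

subsection \<open>Affine substitutions\<close>

lemma lborel_nn_integral_affine:
  fixes f :: "'a::euclidean_space \<Rightarrow> ennreal"
  assumes [measurable]: "f \<in> borel_measurable borel" and "c \<noteq> 0"
  shows "(\<integral>\<^sup>+x. f x \<partial>lborel) = ennreal (\<bar>c\<bar> ^ DIM('a)) * (\<integral>\<^sup>+x. f (t + c *\<^sub>R x) \<partial>lborel)"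
  by (subst lborel_affine[OF \<open>c \<noteq> 0\<close>, of t]) (simp add: nn_integral_density nn_integral_distr nn_integral_cmult)

lemma lborel_integrable_affine:
  fixes f :: "'a::euclidean_space \<Rightarrow> 'b::{banach, second_countable_topology}"
  assumes "integrable lborel f" "c \<noteq> 0"
  shows "integrable lborel (\<lambda>x. f (t + c *\<^sub>R x))"
proof -
  have [measurable]: "f \<in> borel_measurable borel"
    using assms(1) by auto
  have "ennreal (\<bar>c\<bar> ^ DIM('a)) * (\<integral>\<^sup>+x. ennreal (norm (f (t + c *\<^sub>R x))) \<partial>lborel) < \<infinity>"
    using lborel_nn_integral_affine[of "\<lambda>x. ennreal (norm (f x))" c t] assms
    by (simp add: integrable_iff_bounded)
  then show ?thesis
    using assms(2) by (auto simp: integrable_iff_bounded ennreal_mult_less_top)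
qed

lemma lborel_integral_affine:
  fixes f :: "'a::euclidean_space \<Rightarrow> 'b::{banach, second_countable_topology}"
  assumes [measurable]: "f \<in> borel_measurable borel" and "c \<noteq> 0"
  shows "(\<integral>x. f x \<partial>lborel) = (\<bar>c\<bar> ^ DIM('a)) *\<^sub>R (\<integral>x. f (t + c *\<^sub>R x) \<partial>lborel)"
  by (subst lborel_affine[OF \<open>c \<noteq> 0\<close>, of t]) (simp add: integral_density integral_distr)

lemma lborel_integral_shift:
  fixes f :: "'a::euclidean_space \<Rightarrow> 'b::{banach, second_countable_topology}"
  assumes "f \<in> borel_measurable borel"
  shows "(\<integral>x. f (x - y) \<partial>lborel) = (\<integral>x. f x \<partial>lborel)"
  using lborel_integral_affine[OF assms, of 1 "- y"] by simp

lemma lborel_integrable_shift: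
  fixes f :: "'a::euclidean_space \<Rightarrow> 'b::{banach, second_countable_topology}"
  assumes "integrable lborel f"
  shows "integrable lborel (\<lambda>x. f (x - y))"
  using lborel_integrable_affine[OF assms, of 1 "- y"] by simp

lemma lborel_nn_integral_shift:
  fixes f :: "'a::euclidean_space \<Rightarrow> ennreal"
  assumes "f \<in> borel_measurable borel"
  shows "(\<integral>\<^sup>+x. f (x - y) \<partial>lborel) = (\<integral>\<^sup>+x. f x \<partial>lborel)"
  using lborel_nn_integral_affine[OF assms, of 1 "- y"] by simp

lemma lborel_integral_reflect:
  fixes f :: "'a::euclidean_space \<Rightarrow> 'b::{banach, second_countable_topology}"
  assumes "f \<in> borel_measurable borel"
  shows "(\<integral>x. f (y - x) \<partial>lborel) = (\<integral>x. f x \<partial>lborel)"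
  using lborel_integral_affine[OF assms, of "-1" y] by simp

lemma lborel_integrable_reflect:
  fixes f :: "'a::euclidean_space \<Rightarrow> 'b::{banach, second_countable_topology}"
  assumes "integrable lborel f"
  shows "integrable lborel (\<lambda>x. f (y - x))"
  using lborel_integrable_affine[OF assms, of "-1" y] by simp

lemma lborel_nn_integral_reflect:
  fixes f :: "'a::euclidean_space \<Rightarrow> ennreal"
  assumes "f \<in> borel_measurable borel"
  shows "(\<integral>\<^sup>+x. f (y - x) \<partial>lborel) = (\<integral>\<^sup>+x. f x \<partial>lborel)"
  using lborel_nn_integral_affine[OF assms, of "-1" y] by simp

subsection \<open>The Fourier transform of integrable functions\<close>

lemma borel_measurable_cis [measurable]: "cis \<in> borel_measurable borel"
  by (intro borel_measurable_continuous_onI continuous_intros)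

lemma fourier_integrand_integrable:
  assumes "integrable lborel f"
  shows "integrable lborel (\<lambda>x. f x * cis (- 2 * pi * (x \<bullet> \<xi>)))"
proof -
  have [measurable]: "f \<in> borel_measurable borel" using assms by auto
  show ?thesis
    by (rule Bochner_Integration.integrable_bound[OF assms]) (auto simp: norm_mult)
qed

lemma borel_measurable_fourier [measurable]:
  assumes [measurable]: "f \<in> borel_measurable borel"
  shows "fourier f \<in> borel_measurable borel"
  unfolding fourier_def by measurable

lemma norm_fourier_le: "cmod (fourier f \<xi>) \<le> (\<integral>x. cmod (f x) \<partial>lborel)"
  unfolding fourier_def using integral_norm_bound[of lborel "\<lambda>x. f x * cis (- 2 * pi * (x \<bullet> \<xi>))"]
  by (simp add: norm_mult)

lemma fourier_diff:
  assumes "integrable lborel f" "integrable lborel g"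
  shows "fourier (\<lambda>x. f x - g x) \<xi> = fourier f \<xi> - fourier g \<xi>"
  unfolding fourier_def left_diff_distrib
  by (intro Bochner_Integration.integral_diff fourier_integrand_integrable assms)

text \<open>Reflection compensates the sign that conjugation puts into the exponent. This makes the
  transform of an autocorrelation a squared modulus.\<close>

lemma fourier_cnj_reflect:
  assumes [measurable]: "f \<in> borel_measurable borel"
  shows "fourier (\<lambda>x. cnj (f (- x))) \<xi> = cnj (fourier f \<xi>)"
proof -
  have "fourier (\<lambda>x. cnj (f (- x))) \<xi> = cnj (\<integral>x. f (- x) * cis (- 2 * pi * (- x \<bullet> \<xi>)) \<partial>lborel)"
    unfolding fourier_def
    by (subst Bochner_Integration.integral_cnj[symmetric], intro Bochner_Integration.integral_cong) (auto simp: cis_cnj)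
  also have "(\<integral>x. f (- x) * cis (- 2 * pi * (- x \<bullet> \<xi>)) \<partial>lborel) = fourier f \<xi>"
    using lborel_integral_reflect[of "\<lambda>x. f x * cis (- 2 * pi * (x \<bullet> \<xi>))" 0] by (simp add: fourier_def)
  finally show ?thesis .
qed

lemma lborel_pair_integrable_mult:
  fixes f :: "'a::euclidean_space \<Rightarrow> complex" and g :: "'b::euclidean_space \<Rightarrow> complex"
  assumes "integrable lborel f" "integrable lborel g"
  shows "integrable (lborel \<Otimes>\<^sub>M lborel) (\<lambda>(x, y). f x * g y)"
proof (rule lborel_pair.Fubini_integrable)
  have [measurable]: "f \<in> borel_measurable borel" "g \<in> borel_measurable borel"
    using assms by auto
  show "(\<lambda>(x, y). f x * g y) \<in> borel_measurable (lborel \<Otimes>\<^sub>M lborel)"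
    by measurable
qed (use assms in \<open>auto simp: norm_mult\<close>)

text \<open>The exponential kernel is symmetric in \<open>x\<close> and \<open>\<xi>\<close> and has
  modulus 1, so Fubini's theorem exchanges the roles of \<open>f\<close> and \<open>g\<close>. It
  serves twice: with a Gaussian as \<open>g\<close> in place of an inversion theorem, and after
  extension to L2 as the self-duality behind surjectivity.\<close>

lemma fourier_multiplication_formula:
  fixes f g :: "'a::euclidean_space \<Rightarrow> complex"
  assumes "integrable lborel f" "integrable lborel g"
  shows "(\<integral>\<xi>. fourier f \<xi> * g \<xi> \<partial>lborel) = (\<integral>x. f x * fourier g x \<partial>lborel)"
proof -
  have [measurable]: "f \<in> borel_measurable borel" "g \<in> borel_measurable borel"
    using assms by auto
  let ?h = "\<lambda>x \<xi>. f x * g \<xi> * cis (- 2 * pi * (x \<bullet> \<xi>))"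
  have int: "integrable (lborel \<Otimes>\<^sub>M lborel) (case_prod ?h)"
    by (rule Bochner_Integration.integrable_bound[OF lborel_pair_integrable_mult[OF assms]])
      (auto simp: norm_mult split_beta')
  have "(\<integral>\<xi>. fourier f \<xi> * g \<xi> \<partial>lborel) = (\<integral>\<xi>. (\<integral>x. ?h x \<xi> \<partial>lborel) \<partial>lborel)"
    unfolding fourier_def
    by (intro Bochner_Integration.integral_cong refl, subst integral_mult_left_zero[symmetric])
      (simp add: mult_ac)
  also have "\<dots> = (\<integral>x. (\<integral>\<xi>. ?h x \<xi> \<partial>lborel) \<partial>lborel)"
    by (rule lborel_pair.Fubini_integral[OF int])
  also have "\<dots> = (\<integral>x. f x * fourier g x \<partial>lborel)"
    unfolding fourier_def
    by (intro Bochner_Integration.integral_cong refl, subst integral_mult_right_zero[symmetric])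
      (simp add: mult_ac inner_commute)
  finally show ?thesis .
qed

text \<open>Where the integrand fails to be integrable the value is 0. For \<open>g\<close> in L2
  additivity in \<open>g\<close> can thus be claimed only almost everywhere.\<close>

definition conv :: "('a::euclidean_space \<Rightarrow> complex) \<Rightarrow> ('a \<Rightarrow> complex) \<Rightarrow> 'a \<Rightarrow> complex" where
  "conv f g x = (\<integral>y. f (x - y) * g y \<partial>lborel)"

lemma borel_measurable_conv [measurable]:
  assumes [measurable]: "f \<in> borel_measurable borel" "g \<in> borel_measurable borel"
  shows "conv f g \<in> borel_measurable borel"
  unfolding conv_def by measurable

lemma
  fixes f g :: "'a::euclidean_space \<Rightarrow> complex"
  assumes f: "integrable lborel f" and g: "integrable lborel g"
  shows conv_integrable: "integrable lborel (conv f g)"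
    and fourier_conv: "fourier (conv f g) \<xi> = fourier f \<xi> * fourier g \<xi>"
proof -
  have [measurable]: "f \<in> borel_measurable borel" "g \<in> borel_measurable borel"
    using assms by auto
  have int: "integrable (lborel \<Otimes>\<^sub>M lborel) (\<lambda>(y, x). f (x - y) * g y)"
  proof (rule lborel_pair.Fubini_integrable)
    have "(\<integral>x. norm (f (x - y) * g y) \<partial>lborel) = (\<integral>x. norm (f x) \<partial>lborel) * norm (g y)" for y
      by (simp add: norm_mult lborel_integral_shift[of "\<lambda>x. cmod (f x)"])
    then show "integrable lborel (\<lambda>y. \<integral>x. norm (case (y, x) of (y, x) \<Rightarrow> f (x - y) * g y) \<partial>lborel)"
      using g by simp
    show "AE y in lborel. integrable lborel (\<lambda>x. case (y, x) of (y, x) \<Rightarrow> f (x - y) * g y)"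
      using f by (simp add: lborel_integrable_shift)
  qed measurable
  show "integrable lborel (conv f g)"
    unfolding conv_def using lborel_pair.integrable_snd[OF int] by simp
  let ?h = "\<lambda>y x. f (x - y) * g y * cis (- 2 * pi * (x \<bullet> \<xi>))"
  have int': "integrable (lborel \<Otimes>\<^sub>M lborel) (case_prod ?h)"
    by (rule Bochner_Integration.integrable_bound[OF int]) (auto simp: norm_mult split_beta')
  \<comment> \<open>Writing x as (x - y) + y splits the phase; translation invariance then removes y
    from the first factor.\<close>
  have shift: "(\<integral>x. ?h y x \<partial>lborel) = fourier f \<xi> * (g y * cis (- 2 * pi * (y \<bullet> \<xi>)))" for y
  proof -
    have "?h y x = (f (x - y) * cis (- 2 * pi * ((x - y) \<bullet> \<xi>))) * (g y * cis (- 2 * pi * (y \<bullet> \<xi>)))" for x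
      by (simp add: cis_mult inner_diff_left algebra_simps)
    then have "(\<integral>x. ?h y x \<partial>lborel) = (\<integral>x. f (x - y) * cis (- 2 * pi * ((x - y) \<bullet> \<xi>)) \<partial>lborel)
        * (g y * cis (- 2 * pi * (y \<bullet> \<xi>)))"
      by (simp only: integral_mult_left_zero)
    then show ?thesis
      unfolding fourier_def
      using lborel_integral_shift[of "\<lambda>x. f x * cis (- 2 * pi * (x \<bullet> \<xi>))" y] by simp
  qed
  have "fourier (conv f g) \<xi> = (\<integral>x. (\<integral>y. ?h y x \<partial>lborel) \<partial>lborel)"
    unfolding fourier_def conv_def by (simp flip: integral_mult_left_zero)
  also have "\<dots> = (\<integral>y. (\<integral>x. ?h y x \<partial>lborel) \<partial>lborel)"
    by (rule lborel_pair.Fubini_integral[OF int'])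
  also have "\<dots> = fourier f \<xi> * fourier g \<xi>"
    unfolding shift by (simp add: fourier_def)
  finally show "fourier (conv f g) \<xi> = fourier f \<xi> * fourier g \<xi>" .
qed

subsection \<open>Gaussians\<close>

text \<open>\<open>lborel\<close> is the image of the product measure over \<open>Basis\<close>, so
  integrals of products of coordinate functions factor. This reduces Gaussians in several variables
  to the characteristic function of the real normal distribution.\<close>

lemma
  fixes f :: "'a::euclidean_space \<Rightarrow> real \<Rightarrow> complex"
  assumes f: "\<And>b. b \<in> Basis \<Longrightarrow> integrable lborel (f b)"
  shows lborel_integrable_prod: "integrable lborel (\<lambda>x::'a. \<Prod>b\<in>Basis. f b (x \<bullet> b))"
    and lborel_integral_prod: "(\<integral>x. (\<Prod>b\<in>Basis. f b (x \<bullet> b)) \<partial>(lborel :: 'a measure)) = (\<Prod>b\<in>Basis. \<integral>x. f b x \<partial>lborel)"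
proof -
  interpret product_sigma_finite "\<lambda>_::'a. lborel :: real measure"
    by standard
  have [measurable]: "\<And>b. b \<in> Basis \<Longrightarrow> f b \<in> borel_measurable borel"
    using f by fastforce
  have *: "(\<Prod>b\<in>Basis. f b ((\<Sum>c\<in>Basis. g c *\<^sub>R c) \<bullet> b)) = (\<Prod>b\<in>Basis. f b (g b))" for g :: "'a \<Rightarrow> real"
    by (intro prod.cong refl) simp
  have m: "(\<lambda>x::'a. \<Prod>b\<in>Basis. f b (x \<bullet> b)) \<in> borel_measurable borel"
    by measurable
  show "integrable lborel (\<lambda>x::'a. \<Prod>b\<in>Basis. f b (x \<bullet> b))"
    by (subst lborel_eq, subst integrable_distr_eq)
      (use m in \<open>auto simp: * intro!: product_integrable_prod f\<close>)
  show "(\<integral>x. (\<Prod>b\<in>Basis. f b (x \<bullet> b)) \<partial>(lborel :: 'a measure)) = (\<Prod>b\<in>Basis. \<integral>x. f b x \<partial>lborel)"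
    by (subst lborel_eq, subst integral_distr)
      (use m in \<open>auto simp: * intro!: product_integral_prod f\<close>)
qed

text \<open>The density of the standard normal distribution on the whole space.\<close>

definition gauss :: "'a::euclidean_space \<Rightarrow> real" where
  "gauss x = exp (- (norm x)\<^sup>2 / 2) / sqrt (2 * pi) ^ DIM('a)"

lemma norm_square_Basis: "(norm x)\<^sup>2 = (\<Sum>b\<in>Basis. (x \<bullet> b)\<^sup>2)"
  by (subst norm_eq_sqrt_inner, subst euclidean_inner) (simp add: power2_eq_square sum_nonneg)

lemma gauss_eq_prod: "gauss x = (\<Prod>b\<in>Basis. std_normal_density (x \<bullet> b))"
  unfolding gauss_def std_normal_density_def
  by (simp add: prod_dividef norm_square_Basis sum_divide_distrib exp_sum flip: sum_negf)

lemma borel_measurable_gauss [measurable]: "gauss \<in> borel_measurable borel"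
  unfolding gauss_def by measurable

lemma gauss_nonneg [simp]: "0 \<le> gauss x"
  by (simp add: gauss_def)

lemma cis_sum: "finite A \<Longrightarrow> cis (\<Sum>b\<in>A. f b) = (\<Prod>b\<in>A. cis (f b))"
  by (induction rule: finite_induct) (auto simp flip: cis_mult)

lemma
  fixes t :: "'a::euclidean_space"
  shows gauss_cis_integrable: "integrable lborel (\<lambda>x. complex_of_real (gauss x) * cis (x \<bullet> t))"
    and gauss_cis_integral:
      "(\<integral>x. complex_of_real (gauss x) * cis (x \<bullet> t) \<partial>lborel) = complex_of_real (exp (- (norm t)\<^sup>2 / 2))"
proof -
  define h where "h b x = complex_of_real (std_normal_density x) * cis (x * (t \<bullet> b))" for b x
  have eq: "complex_of_real (gauss x) * cis (x \<bullet> t) = (\<Prod>b\<in>Basis. h b (x \<bullet> b))" for x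
    unfolding gauss_eq_prod h_def by (subst euclidean_inner) (simp add: cis_sum prod.distrib)
  have [measurable]: "h b \<in> borel_measurable borel" for b
    unfolding h_def[abs_def] by measurable
  have int: "integrable lborel (h b)" for b
  proof (rule Bochner_Integration.integrable_bound)
    show "integrable lborel std_normal_density"
      by (rule integrable_normal_density) simp
  qed (auto simp: h_def norm_mult)
  have "complex_of_real (exp (- (t \<bullet> b)\<^sup>2 / 2)) = (\<integral>x. h b x \<partial>lborel)" for b
  proof -
    have "complex_of_real (exp (- (t \<bullet> b)\<^sup>2 / 2)) = char std_normal_distribution (t \<bullet> b)"
      by (simp add: char_std_normal_distribution)
    also have "\<dots> = (\<integral>x. std_normal_density x *\<^sub>R iexp ((t \<bullet> b) * x) \<partial>lborel)"
      unfolding char_def by (rule integral_density) auto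
    also have "\<dots> = (\<integral>x. h b x \<partial>lborel)"
      by (simp add: h_def cis_conv_exp scaleR_conv_of_real mult_ac)
    finally show ?thesis .
  qed
  moreover have "complex_of_real (exp (- (norm t)\<^sup>2 / 2)) = (\<Prod>b\<in>Basis. complex_of_real (exp (- (t \<bullet> b)\<^sup>2 / 2)))"
    by (simp add: norm_square_Basis exp_sum sum_divide_distrib flip: of_real_prod sum_negf)
  ultimately show "(\<integral>x. complex_of_real (gauss x) * cis (x \<bullet> t) \<partial>lborel) = complex_of_real (exp (- (norm t)\<^sup>2 / 2))"
    unfolding eq lborel_integral_prod[of h, OF int] by simp
  show "integrable lborel (\<lambda>x. complex_of_real (gauss x) * cis (x \<bullet> t))"
    unfolding eq using lborel_integrable_prod[of h, OF int] .
qed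

lemma gauss_integrable: "integrable lborel (gauss :: 'a::euclidean_space \<Rightarrow> real)"
proof -
  have "integrable lborel (\<lambda>x::'a. complex_of_real (gauss x))"
    using gauss_cis_integrable[of "0::'a"] by simp
  from integrable_norm[OF this] show ?thesis by simp
qed

lemma gauss_integral: "(\<integral>x. gauss x \<partial>(lborel :: 'a::euclidean_space measure)) = 1"
proof -
  have "complex_of_real (\<integral>x. gauss x \<partial>(lborel :: 'a measure)) = (\<integral>x. complex_of_real (gauss x) \<partial>(lborel :: 'a measure))"
    by simp
  also have "\<dots> = 1"
    using gauss_cis_integral[of "0::'a"] by simp
  finally show ?thesis by simp
qed

text \<open>The transform, in the normalization of \<open>fourier\<close>, of the dilated density
  gauss (z/e) / e^n. As \<open>e\<close> decreases to 0 the weights increase to 1, while the dilated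
  densities concentrate at the origin with total mass 1.\<close>

definition gauss_weight :: "real \<Rightarrow> 'a::euclidean_space \<Rightarrow> real" where
  "gauss_weight e \<xi> = exp (- (2 * pi * e * norm \<xi>)\<^sup>2 / 2)"

lemma gauss_weight_eq_gauss:
  fixes \<xi> :: "'a::euclidean_space"
  shows "gauss_weight e \<xi> = sqrt (2 * pi) ^ DIM('a) * gauss ((2 * pi * e) *\<^sub>R \<xi>)"
  by (simp add: gauss_weight_def gauss_def power_mult_distrib)

lemma gauss_weight_integrable:
  assumes "e > 0"
  shows "integrable lborel (\<lambda>\<xi>::'a::euclidean_space. complex_of_real (gauss_weight e \<xi>))"
  unfolding gauss_weight_eq_gauss
  using lborel_integrable_affine[OF gauss_integrable, of "2 * pi * e" "0::'a"] assms by simp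

lemma fourier_gauss_weight:
  fixes z :: "'a::euclidean_space"
  assumes e: "e > 0"
  shows "fourier (\<lambda>\<xi>. complex_of_real (gauss_weight e \<xi>)) z = complex_of_real (gauss (z /\<^sub>R e) / e ^ DIM('a))"
proof -
  let ?c = "2 * pi * e" and ?d = "DIM('a)"
  have "(\<integral>x. complex_of_real (gauss x) * cis (x \<bullet> (- z /\<^sub>R e)) \<partial>(lborel :: 'a measure))
     = (?c ^ ?d) *\<^sub>R (\<integral>x. complex_of_real (gauss (?c *\<^sub>R x)) * cis ((?c *\<^sub>R x) \<bullet> (- z /\<^sub>R e)) \<partial>lborel)"
    using lborel_integral_affine[of "\<lambda>x::'a. complex_of_real (gauss x) * cis (x \<bullet> (- z /\<^sub>R e))" ?c 0] e by simp
  moreover have "fourier (\<lambda>\<xi>. complex_of_real (gauss_weight e \<xi>)) z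
     = complex_of_real (sqrt (2 * pi) ^ ?d) * (\<integral>x. complex_of_real (gauss (?c *\<^sub>R x)) * cis ((?c *\<^sub>R x) \<bullet> (- z /\<^sub>R e)) \<partial>lborel)"
    unfolding fourier_def gauss_weight_eq_gauss using e
    by (subst integral_mult_right_zero[symmetric], intro Bochner_Integration.integral_cong)
      (simp_all add: field_simps)
  ultimately have "complex_of_real (?c ^ ?d) * fourier (\<lambda>\<xi>. complex_of_real (gauss_weight e \<xi>)) z
     = complex_of_real (sqrt (2 * pi) ^ ?d * exp (- (norm (z /\<^sub>R e))\<^sup>2 / 2))"
    using gauss_cis_integral[of "- z /\<^sub>R e"] by (simp add: scaleR_conv_of_real mult_ac)
  also have "\<dots> = complex_of_real ((2 * pi) ^ ?d) * complex_of_real (gauss (z /\<^sub>R e))"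
  \<comment> \<open>The normalization \<open>sqrt (2 * pi) ^ DIM('a)\<close> enters once from the
    weight and once from the density; the two together cancel the factor
    \<open>(2 * pi) ^ DIM('a)\<close> of the Jacobian.\<close>
  proof -
    define A where "A = sqrt (2 * pi) ^ ?d"
    have "(2 * pi) ^ ?d = A * A"
      unfolding A_def by (subst power_mult_distrib[symmetric]) simp
    moreover have "A * x = (A * A) * (x / A)" for x
      by (simp add: A_def)
    ultimately show ?thesis
      unfolding gauss_def of_real_mult[symmetric] A_def[symmetric] by metis
  qed
  finally have "complex_of_real ((2 * pi) ^ ?d) * (complex_of_real (e ^ ?d) * fourier (\<lambda>\<xi>. complex_of_real (gauss_weight e \<xi>)) z)
     = complex_of_real ((2 * pi) ^ ?d) * complex_of_real (gauss (z /\<^sub>R e))"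
    by (simp only: power_mult_distrib of_real_mult mult.assoc)
  then have "complex_of_real (e ^ ?d) * fourier (\<lambda>\<xi>. complex_of_real (gauss_weight e \<xi>)) z = complex_of_real (gauss (z /\<^sub>R e))"
    by (subst (asm) mult_cancel_left) simp
  then show ?thesis
    using e by (simp add: eq_divide_eq mult.commute)
qed

subsection \<open>Plancherel's theorem\<close>

lemma cball_indicator_L2: "(\<lambda>x::'a::euclidean_space. complex_of_real (B * indicator (cball 0 R) x)) \<in> L2"
  and cball_indicator_integrable: "integrable lborel (\<lambda>x::'a. complex_of_real (B * indicator (cball 0 R) x))"
proof -
  have i: "integrable lborel (indicat_real (cball (0::'a) R))"
    using emeasure_lborel_cball_finite[of "0::'a" R] by (intro integrable_real_indicator) auto
  have "(\<lambda>x. (cmod (complex_of_real (B * indicator (cball 0 R) x)))\<^sup>2) = (\<lambda>x::'a. B\<^sup>2 * indicator (cball 0 R) x)"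
    by (auto simp: indicator_def)
  then show "(\<lambda>x::'a. complex_of_real (B * indicator (cball 0 R) x)) \<in> L2"
    using i by (auto simp: L2_def intro!: measurable_If borel_measurable_times)
  show "integrable lborel (\<lambda>x::'a. complex_of_real (B * indicator (cball 0 R) x))"
    using i by (intro integrable_of_real integrable_mult_right) auto
qed

text \<open>
  The transform of the autocorrelation \<open>k\<close> of \<open>f\<close> is the squared modulus of that of \<open>f\<close>, and the value
  of \<open>k\<close> at the origin is the squared norm of \<open>f\<close>. Gaussian weights make Fourier inversion of \<open>k\<close> at the
  origin legitimate.
\<close>

lemma plancherel_continuous:
  fixes f :: "'a::euclidean_space \<Rightarrow> complex"
  assumes cont: "continuous_on UNIV f" and supp: "\<And>x. norm x > R \<Longrightarrow> f x = 0"
  shows "integrable lborel f" "f \<in> L2" "fourier f \<in> L2" "L2norm (fourier f) = L2norm f"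
proof -
  have [measurable]: "f \<in> borel_measurable borel"
    by (rule borel_measurable_continuous_onI[OF cont])
  have "bounded (f ` cball 0 R)"
    by (intro compact_imp_bounded compact_continuous_image continuous_on_subset[OF cont]) auto
  then obtain M0 where M0: "\<forall>x\<in>cball 0 R. cmod (f x) \<le> M0"
    unfolding bounded_iff by blast
  define M where "M = max M0 0"
  have M: "cmod (f x) \<le> M" for x
    using M0 supp[of x] by (cases "norm x \<le> R") (auto simp: M_def intro: max.coboundedI1)
  have Mnn: "0 \<le> M" by (simp add: M_def)
  have dom: "cmod (f x) \<le> cmod (complex_of_real (M * indicator (cball 0 R) x))" for x
    using M[of x] supp[of x] by (auto simp: indicator_def M_def)
  show int: "integrable lborel f"
    by (rule Bochner_Integration.integrable_bound[OF cball_indicator_integrable[of M R]]) (use dom in auto)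
  show L2: "f \<in> L2"
    by (rule L2_dominated(1)[OF _ cball_indicator_L2[of M R], of _ 1]) (use dom in auto)
  define f' where "f' x = cnj (f (- x))" for x
  have [measurable]: "f' \<in> borel_measurable borel"
    unfolding f'_def by (intro borel_measurable_continuous_onI continuous_intros continuous_on_compose2[OF cont]) auto
  have int': "integrable lborel f'"
    unfolding f'_def using lborel_integrable_reflect[OF int, of 0] by simp
  define k where "k = conv f f'"
  have [measurable]: "k \<in> borel_measurable borel"
    unfolding k_def by measurable
  have kint: "integrable lborel k"
    unfolding k_def by (rule conv_integrable[OF int int'])
  have fk: "fourier k \<xi> = complex_of_real ((cmod (fourier f \<xi>))\<^sup>2)" for \<xi>
    unfolding k_def fourier_conv[OF int int'] f'_def
    by (simp add: fourier_cnj_reflect complex_norm_square del: of_real_power)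
  have k0: "k 0 = complex_of_real ((L2norm f)\<^sup>2)"
  proof -
    have "k 0 = (\<integral>y. complex_of_real ((cmod (f (0 - y)))\<^sup>2) \<partial>lborel)"
      unfolding k_def conv_def f'_def by (simp add: complex_norm_square del: of_real_power)
    also have "\<dots> = (\<integral>y. complex_of_real ((cmod (f y))\<^sup>2) \<partial>lborel)"
      by (rule lborel_integral_reflect) measurable
    finally show ?thesis
      by (simp add: L2norm_square del: of_real_power)
  qed
  have kb: "cmod (k z) \<le> M * (\<integral>x. cmod (f' x) \<partial>lborel)" for z
  proof -
    have "cmod (k z) \<le> (\<integral>y. cmod (f (z - y) * f' y) \<partial>lborel)"
      unfolding k_def conv_def by (rule integral_norm_bound)
    also have "\<dots> \<le> (\<integral>y. M * cmod (f' y) \<partial>lborel)"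
      using int' M by (intro integral_mono_AE') (auto simp: norm_mult Mnn intro!: mult_right_mono)
    finally show ?thesis by simp
  qed
  have kc: "(\<lambda>n. k (z n)) \<longlonglongrightarrow> k 0" if z: "z \<longlonglongrightarrow> 0" for z :: "nat \<Rightarrow> 'a"
    unfolding k_def conv_def
  proof (rule integral_dominated_convergence[where w="\<lambda>y. M * cmod (f' y)"])
    have "(\<lambda>n. f (z n - y)) \<longlonglongrightarrow> f (0 - y)" for y
      using z by (intro continuous_on_tendsto_compose[OF cont] tendsto_intros) auto
    then show "AE y in lborel. (\<lambda>n. f (z n - y) * f' y) \<longlonglongrightarrow> f (0 - y) * f' y"
      by (intro AE_I2 tendsto_intros)
    show "AE y in lborel. norm (f (z n - y) * f' y) \<le> M * cmod (f' y)" for n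
      by (intro AE_I2) (auto simp: norm_mult M mult_right_mono)
  qed (use int' in auto)
  define e where "e n = 1 / real (Suc n)" for n
  have e: "e n > 0" for n by (simp add: e_def)
  have elim: "e \<longlonglongrightarrow> 0"
    unfolding e_def using LIMSEQ_inverse_real_of_nat by (simp add: inverse_eq_divide)
  let ?h = "\<lambda>n \<xi>. (cmod (fourier f \<xi>))\<^sup>2 * gauss_weight (e n) \<xi>"
  have w0: "0 \<le> gauss_weight (e n) \<xi>" for n and \<xi> :: 'a
    by (simp add: gauss_weight_def)
  have [measurable]: "gauss_weight (e n) \<in> borel_measurable (borel :: 'a measure)" for n
    unfolding gauss_weight_def[abs_def] by measurable
  have hint: "integrable lborel (?h n)" for n
  proof (rule Bochner_Integration.integrable_bound[OF integrable_mult_right[OF gauss_weight_integrable[OF e[of n]]]])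
    show "AE \<xi> in lborel. norm (?h n \<xi>) \<le> norm (complex_of_real ((\<integral>x. cmod (f x) \<partial>lborel)\<^sup>2) * complex_of_real (gauss_weight (e n) \<xi>))"
      by (intro AE_I2) (auto simp: norm_mult norm_power w0 intro!: mult_right_mono power_mono norm_fourier_le)
  qed auto
  \<comment> \<open>The multiplication formula moves the transform from \<open>k\<close> to the
    weight. Substituting e z for z leaves a fixed density, with the parameter only in the argument
    of \<open>k\<close>, so that dominated convergence applies.\<close>
  have eq: "complex_of_real (\<integral>\<xi>. ?h n \<xi> \<partial>lborel) = (\<integral>z. k (e n *\<^sub>R z) * complex_of_real (gauss z) \<partial>lborel)" for n
  proof -
    have "complex_of_real (\<integral>\<xi>. ?h n \<xi> \<partial>lborel) = (\<integral>\<xi>. fourier k \<xi> * complex_of_real (gauss_weight (e n) \<xi>) \<partial>lborel)"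
      unfolding fk by (simp flip: integral_complex_of_real)
    also have "\<dots> = (\<integral>z. k z * fourier (\<lambda>\<xi>. complex_of_real (gauss_weight (e n) \<xi>)) z \<partial>lborel)"
      by (rule fourier_multiplication_formula[OF kint gauss_weight_integrable[OF e]])
    also have "\<dots> = (\<integral>z. k z * complex_of_real (gauss (z /\<^sub>R e n) / e n ^ DIM('a)) \<partial>lborel)"
      by (simp add: fourier_gauss_weight e)
    also have "\<dots> = (e n ^ DIM('a)) *\<^sub>R (\<integral>z. k (e n *\<^sub>R z) * complex_of_real (gauss z / e n ^ DIM('a)) \<partial>lborel)"
      using lborel_integral_affine[of "\<lambda>z. k z * complex_of_real (gauss (z /\<^sub>R e n) / e n ^ DIM('a))" "e n" 0] e[of n]
      by simp
    also have "\<dots> = (\<integral>z. k (e n *\<^sub>R z) * complex_of_real (gauss z) \<partial>lborel)"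
      using e[of n] by (subst integral_scaleR_right[symmetric]) (simp add: scaleR_conv_of_real)
    finally show ?thesis .
  qed
  have "(\<lambda>n. \<integral>z. k (e n *\<^sub>R z) * complex_of_real (gauss z) \<partial>lborel) \<longlonglongrightarrow> (\<integral>z. k 0 * complex_of_real (gauss z) \<partial>(lborel :: 'a measure))"
  proof (rule integral_dominated_convergence[where w="\<lambda>z. (M * (\<integral>x. cmod (f' x) \<partial>lborel)) * gauss z"])
    show "integrable lborel (\<lambda>z::'a. (M * (\<integral>x. cmod (f' x) \<partial>lborel)) * gauss z)"
      by (intro integrable_mult_right gauss_integrable)
    have "(\<lambda>n. e n *\<^sub>R z) \<longlonglongrightarrow> 0" for z :: 'a
      using tendsto_scaleR[OF elim tendsto_const[of z]] by simp
    then show "AE z in lborel. (\<lambda>n. k (e n *\<^sub>R z) * complex_of_real (gauss z)) \<longlonglongrightarrow> k 0 * complex_of_real (gauss z)"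
      by (intro AE_I2 tendsto_intros kc)
    show "AE z in lborel. norm (k (e n *\<^sub>R z) * complex_of_real (gauss z)) \<le> (M * (\<integral>x. cmod (f' x) \<partial>lborel)) * gauss z" for n
      by (intro AE_I2) (auto simp: norm_mult intro!: mult_right_mono kb)
  qed auto
  moreover have "(\<integral>z. k 0 * complex_of_real (gauss z) \<partial>(lborel :: 'a measure)) = k 0"
    using gauss_integral[where 'a='a] by simp
  ultimately have "(\<lambda>n. complex_of_real (\<integral>\<xi>. ?h n \<xi> \<partial>lborel)) \<longlonglongrightarrow> complex_of_real ((L2norm f)\<^sup>2)"
    unfolding eq k0[symmetric] by (simp only:)
  then have lim: "(\<lambda>n. \<integral>\<xi>. ?h n \<xi> \<partial>lborel) \<longlonglongrightarrow> (L2norm f)\<^sup>2"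
    by (subst (asm) tendsto_of_real_iff)
  \<comment> \<open>Monotone convergence yields the square integrability of \<open>fourier f\<close>
    together with the value of its norm.\<close>
  have "(\<lambda>n. \<integral>\<^sup>+\<xi>. ennreal (?h n \<xi>) \<partial>lborel) \<longlonglongrightarrow> (\<integral>\<^sup>+\<xi>. ennreal ((cmod (fourier f \<xi>))\<^sup>2) \<partial>lborel)"
  proof (rule nn_integral_LIMSEQ)
    show "incseq (\<lambda>n \<xi>. ennreal (?h n \<xi>))"
    proof (intro incseq_SucI le_funI ennreal_leI mult_left_mono)
      fix n and \<xi> :: 'a
      have "e (Suc n) \<le> e n" by (simp add: e_def field_simps)
      then have "(2 * pi * e (Suc n) * norm \<xi>)\<^sup>2 \<le> (2 * pi * e n * norm \<xi>)\<^sup>2"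
        using e[of "Suc n"] by (intro power_mono mult_right_mono mult_left_mono) auto
      then show "gauss_weight (e n) \<xi> \<le> gauss_weight (e (Suc n)) \<xi>"
        by (simp add: gauss_weight_def)
    qed auto
    fix \<xi> :: 'a
    have "(\<lambda>n. gauss_weight (e n) \<xi>) \<longlonglongrightarrow> exp (- (2 * pi * 0 * norm \<xi>)\<^sup>2 / 2)"
      unfolding gauss_weight_def by (intro tendsto_intros elim) auto
    then have "(\<lambda>n. ?h n \<xi>) \<longlonglongrightarrow> (cmod (fourier f \<xi>))\<^sup>2 * 1"
      by (intro tendsto_mult tendsto_const) simp
    then show "(\<lambda>n. ennreal (?h n \<xi>)) \<longlonglongrightarrow> ennreal ((cmod (fourier f \<xi>))\<^sup>2)"
      by (intro tendsto_ennrealI) simp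
  qed auto
  moreover have "(\<integral>\<^sup>+\<xi>. ennreal (?h n \<xi>) \<partial>lborel) = ennreal (\<integral>\<xi>. ?h n \<xi> \<partial>lborel)" for n
    by (rule nn_integral_eq_integral[OF hint]) (auto simp: w0)
  ultimately have "(\<lambda>n. ennreal (\<integral>\<xi>. ?h n \<xi> \<partial>lborel)) \<longlonglongrightarrow> (\<integral>\<^sup>+\<xi>. ennreal ((cmod (fourier f \<xi>))\<^sup>2) \<partial>lborel)"
    by simp
  from LIMSEQ_unique[OF this tendsto_ennrealI[OF lim]]
  have *: "(\<integral>\<^sup>+\<xi>. ennreal ((cmod (fourier f \<xi>))\<^sup>2) \<partial>lborel) = ennreal ((L2norm f)\<^sup>2)" .
  show F: "fourier f \<in> L2"
    using L2_nn_integral_boundI(1)[of "fourier f" "L2norm f"] * by simp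
  have "ennreal ((L2norm (fourier f))\<^sup>2) = ennreal ((L2norm f)\<^sup>2)"
    using * nn_integral_eq_L2norm[OF F] by simp
  then show "L2norm (fourier f) = L2norm f"
    by simp
qed

section \<open>Plancherel's identity for all functions in L1 and L2\<close>

text \<open>The property that is carried through successive approximations: continuous with bounded
  support, bounded measurable with bounded support, and finally any function in L1 and L2.\<close>

definition fourier_isometric :: "('a::euclidean_space \<Rightarrow> complex) \<Rightarrow> bool" where
  "fourier_isometric f \<longleftrightarrow> integrable lborel f \<and> f \<in> L2 \<and> fourier f \<in> L2 \<and> L2norm (fourier f) = L2norm f"

text \<open>L1 convergence gives pointwise convergence of the transforms, which identifies their
  limit; isometry on differences together with Fatou's lemma gives convergence in L2. Differences
  are a separate assumption because equality of norms for two functions does not by itself pass to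
  their difference.\<close>

lemma fourier_isometric_limit:
  fixes f :: "nat \<Rightarrow> 'a::euclidean_space \<Rightarrow> complex"
  assumes iso: "\<And>k. fourier_isometric (f k)" "\<And>j k. fourier_isometric (\<lambda>x. f j x - f k x)"
    and h: "integrable lborel h" "h \<in> L2"
    and L1: "(\<lambda>k. \<integral>x. cmod (f k x - h x) \<partial>lborel) \<longlonglongrightarrow> 0"
    and L2: "(\<lambda>k. L2norm (\<lambda>x. f k x - h x)) \<longlonglongrightarrow> 0"
  shows "fourier_isometric h"
proof -
  have [measurable]: "h \<in> borel_measurable borel"
    using h by auto
  have f: "integrable lborel (f k)" "f k \<in> L2" "fourier (f k) \<in> L2" "L2norm (fourier (f k)) = L2norm (f k)" for k
    using iso(1)[of k] by (auto simp: fourier_isometric_def)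
  have [measurable]: "f k \<in> borel_measurable borel" for k
    using f(1)[of k] by auto
  have ptw: "(\<lambda>k. fourier (f k) \<xi>) \<longlonglongrightarrow> fourier h \<xi>" for \<xi>
  proof -
    have "norm (fourier (f k) \<xi> - fourier h \<xi>) \<le> (\<integral>x. cmod (f k x - h x) \<partial>lborel)" for k
      using norm_fourier_le[of "\<lambda>x. f k x - h x" \<xi>] fourier_diff[OF f(1)[of k] h(1)] by simp
    then have "(\<lambda>k. fourier (f k) \<xi> - fourier h \<xi>) \<longlonglongrightarrow> 0"
      by (intro Lim_null_comparison[OF always_eventually L1]) auto
    then show ?thesis by (simp add: LIM_zero_iff)
  qed
  have diff: "L2norm (\<lambda>\<xi>. fourier (f j) \<xi> - fourier (f k) \<xi>) = L2norm (\<lambda>x. f j x - f k x)" for j k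
  proof -
    have "fourier (\<lambda>x. f j x - f k x) = (\<lambda>\<xi>. fourier (f j) \<xi> - fourier (f k) \<xi>)"
      by (rule ext) (rule fourier_diff[OF f(1) f(1)])
    then show ?thesis
      using iso(2)[of j k] by (simp add: fourier_isometric_def)
  qed
  \<comment> \<open>The slack \<open>d\<close> bounds the distance of \<open>f j\<close> from
    \<open>h\<close> for large \<open>j\<close>; it also makes the bound handed to Fatou's lemma
    positive and is removed afterwards.\<close>
  have step: "(\<lambda>\<xi>. fourier h \<xi> - fourier (f k) \<xi>) \<in> L2 \<and>
      L2norm (\<lambda>\<xi>. fourier h \<xi> - fourier (f k) \<xi>) \<le> 2 * L2norm (\<lambda>x. f k x - h x) + d" if d: "d > 0" for k d
  proof -
    have "\<forall>\<^sub>F j in sequentially. L2norm (\<lambda>x. f j x - h x) < d"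
      using order_tendstoD(2)[OF L2 d] .
    then have "\<forall>\<^sub>F j in sequentially. L2norm (\<lambda>\<xi>. fourier (f j) \<xi> - fourier (f k) \<xi>) \<le> 2 * L2norm (\<lambda>x. f k x - h x) + d"
    proof eventually_elim
      case (elim j)
      have "L2norm (\<lambda>x. f j x - f k x) \<le> L2norm (\<lambda>x. f j x - h x) + L2norm (\<lambda>x. h x - f k x)"
        by (rule L2norm_dist_triangle[OF f(2) h(2) f(2)])
      then show ?case
        using elim L2norm_nonneg[of "\<lambda>x. f k x - h x"] unfolding diff L2norm_diff_commute[of h] by linarith
    qed
    moreover have "AE \<xi> in lborel. (\<lambda>j. fourier (f j) \<xi> - fourier (f k) \<xi>) \<longlonglongrightarrow> fourier h \<xi> - fourier (f k) \<xi>"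
      by (intro AE_I2 tendsto_intros ptw)
    ultimately show ?thesis
      using L2_Fatou[of "\<lambda>j \<xi>. fourier (f j) \<xi> - fourier (f k) \<xi>" "\<lambda>\<xi>. fourier h \<xi> - fourier (f k) \<xi>"
          "2 * L2norm (\<lambda>x. f k x - h x) + d"] d L2_diff[OF f(3) f(3)]
      by simp
  qed
  have Fh: "fourier h \<in> L2"
    using L2_add[OF conjunct1[OF step[of 1 0]] f(3)[of 0]] by simp
  have "L2norm (\<lambda>\<xi>. fourier (f k) \<xi> - fourier h \<xi>) \<le> 2 * L2norm (\<lambda>x. f k x - h x)" for k
    by (rule field_le_epsilon) (use step[of _ k] L2norm_diff_commute in metis)
  then have "(\<lambda>k. L2norm (\<lambda>\<xi>. fourier (f k) \<xi> - fourier h \<xi>)) \<longlonglongrightarrow> 0"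
    by (intro Lim_null_comparison[OF always_eventually tendsto_mult_right_zero[OF L2, of 2]]) auto
  then have "(\<lambda>k. L2norm (fourier (f k))) \<longlonglongrightarrow> L2norm (fourier h)"
    using f Fh by (intro L2norm_tendsto) auto
  moreover have "(\<lambda>k. L2norm (f k)) \<longlonglongrightarrow> L2norm h"
    using f h L2 by (intro L2norm_tendsto) auto
  ultimately have "L2norm (fourier h) = L2norm h"
    unfolding f(4) by (rule LIMSEQ_unique)
  then show ?thesis
    using h Fh by (simp add: fourier_isometric_def)
qed

text \<open>A single majorant in L1 and L2 yields both modes of convergence required above.\<close>

lemma fourier_isometric_dominated_limit:
  fixes f :: "nat \<Rightarrow> 'a::euclidean_space \<Rightarrow> complex"
  assumes iso: "\<And>k. fourier_isometric (f k)" "\<And>j k. fourier_isometric (\<lambda>x. f j x - f k x)"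
    and h: "integrable lborel h" "h \<in> L2"
    and g: "integrable lborel g" "g \<in> L2"
    and lim: "AE x in lborel. (\<lambda>k. f k x) \<longlonglongrightarrow> h x"
    and le: "\<And>k x. cmod (f k x - h x) \<le> cmod (g x)"
  shows "fourier_isometric h"
proof (rule fourier_isometric_limit[OF iso h])
  have [measurable]: "h \<in> borel_measurable borel"
    using h by auto
  have [measurable]: "f k \<in> borel_measurable borel" for k
    using iso(1)[of k] by (auto simp: fourier_isometric_def)
  show "(\<lambda>k. L2norm (\<lambda>x. f k x - h x)) \<longlonglongrightarrow> 0"
    using le by (intro L2_dominated_convergence[OF _ _ g(2) lim]) auto
  have "(\<lambda>k. \<integral>x. cmod (f k x - h x) \<partial>lborel) \<longlonglongrightarrow> (\<integral>x. 0 \<partial>(lborel :: 'a measure))"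
  proof (rule integral_dominated_convergence[where w="\<lambda>x. cmod (g x)"])
    show "AE x in lborel. (\<lambda>k. cmod (f k x - h x)) \<longlonglongrightarrow> 0"
      using lim by eventually_elim (simp add: LIM_zero_iff tendsto_norm_zero_iff)
  qed (use g le in auto)
  then show "(\<lambda>k. \<integral>x. cmod (f k x - h x) \<partial>lborel) \<longlonglongrightarrow> 0" by simp
qed

lemma fourier_isometric_bounded:
  fixes f :: "'a::euclidean_space \<Rightarrow> complex"
  assumes f [measurable]: "f \<in> borel_measurable borel"
    and M: "\<And>x. cmod (f x) \<le> M" and supp: "\<And>x. norm x > R \<Longrightarrow> f x = 0"
  shows "fourier_isometric f"
proof -
  have M0: "0 \<le> M" using order_trans[OF norm_ge_zero M] by blast
  \<comment> \<open>Lebesgue measurability is characterized by continuous approximants that converge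
    off a negligible set. They need be neither bounded nor compactly supported, which the next
    definitions repair.\<close>
  have "f \<in> borel_measurable (lebesgue_on UNIV)"
    using measurable_completion[of f lborel borel] by simp
  then have "f measurable_on UNIV"
    by (simp add: measurable_on_iff_borel_measurable)
  then obtain N g where N: "negligible N" and g: "\<And>n. continuous_on UNIV (g n)"
    and lim: "\<And>x. x \<notin> N \<Longrightarrow> (\<lambda>n. g n x) \<longlonglongrightarrow> f x"
    unfolding measurable_on_def by auto
  \<comment> \<open>\<open>cut\<close> is 1 on the ball of radius \<open>R\<close>, where
    \<open>f\<close> lives, and 0 beyond radius \<open>R + 1\<close>. The projection
    \<open>c\<close> onto the disc of radius \<open>M\<close> fixes the values of \<open>f\<close>.
    Both are continuous, so the modified approximants still converge to \<open>f\<close>.\<close>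
  define cut where "cut x = max 0 (min 1 (R + 1 - norm x))" for x :: 'a
  define c where "c = closest_point (cball (0::complex) M)"
  have c: "continuous_on UNIV c"
    unfolding c_def using M0 by (intro continuous_on_closest_point) auto
  have cb: "cmod (c z) \<le> M" for z
    using closest_point_in_set[of "cball (0::complex) M" z] M0 by (simp add: c_def)
  have cf: "c (f x) = f x" for x
    using M[of x] by (simp add: c_def closest_point_self)
  define h where "h n x = complex_of_real (cut x) * c (g n x)" for n x
  have hc: "continuous_on UNIV (h n)" for n
    unfolding h_def cut_def
    by (intro continuous_intros continuous_on_compose2[OF c] g continuous_on_compose2[OF g]) auto
  have hs: "h n x = 0" if "norm x > R + 1" for n x
    using that by (simp add: h_def cut_def)
  have iso: "fourier_isometric (h n)" for n
    unfolding fourier_isometric_def using plancherel_continuous[OF hc hs] by blast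
  have iso': "fourier_isometric (\<lambda>x. h m x - h n x)" for m n
    unfolding fourier_isometric_def
    using plancherel_continuous[of "\<lambda>x. h m x - h n x" "R + 1"] hc hs by (auto intro: continuous_intros)
  let ?G = "\<lambda>x::'a. complex_of_real (2 * M * indicator (cball 0 (R + 1)) x)"
  have dom: "cmod (h n x - f x) \<le> cmod (?G x)" for n x
  proof (cases "norm x \<le> R + 1")
    case True
    have "\<bar>cut x\<bar> * cmod (c (g n x)) \<le> 1 * M"
      by (rule mult_mono) (auto simp: cut_def cb)
    then have "cmod (h n x) \<le> M"
      by (simp add: h_def norm_mult)
    then show ?thesis
      using True norm_triangle_ineq4[of "h n x" "f x"] M[of x] M0 by (simp add: norm_mult)
  qed (use hs supp in auto)
  have domf: "cmod (f x) \<le> cmod (?G x)" for x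
    using M[of x] supp[of x] M0 by (cases "norm x \<le> R + 1") (auto simp: norm_mult)
  have "integrable lborel f"
    by (rule Bochner_Integration.integrable_bound[OF cball_indicator_integrable[of "2 * M" "R + 1"]])
      (use domf in auto)
  moreover have "f \<in> L2"
    by (rule L2_dominated(1)[OF f cball_indicator_L2[of "2 * M" "R + 1"], of 1]) (use domf in auto)
  moreover have "AE x in lborel. (\<lambda>k. h k x) \<longlonglongrightarrow> f x"
  proof -
    have "AE x in lebesgue. x \<notin> N"
      using N by (intro AE_not_in) (simp add: negligible_iff_null_sets)
    then have "AE x in lborel. x \<notin> N"
      by (simp add: AE_completion_iff)
    then show ?thesis
    proof eventually_elim
      case (elim x)
      have "(\<lambda>k. c (g k x)) \<longlonglongrightarrow> c (f x)"
        by (rule continuous_on_tendsto_compose[OF c lim[OF elim]]) auto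
      then have "(\<lambda>k. h k x) \<longlonglongrightarrow> complex_of_real (cut x) * f x"
        unfolding h_def cf by (intro tendsto_intros)
      moreover have "complex_of_real (cut x) * f x = f x"
        using supp[of x] by (cases "norm x \<le> R") (auto simp: cut_def)
      ultimately show ?case by simp
    qed
  qed
  ultimately show ?thesis
    by (intro fourier_isometric_dominated_limit[of h f ?G] iso iso' cball_indicator_L2 cball_indicator_integrable dom)
qed

text \<open>Cutting off large values and large arguments leaves bounded functions of bounded
  support, whose distance from \<open>f\<close> is dominated by \<open>f\<close> itself.\<close>

lemma fourier_isometric_L1_L2:
  fixes f :: "'a::euclidean_space \<Rightarrow> complex"
  assumes f: "integrable lborel f" "f \<in> L2"
  shows "fourier_isometric f"
proof -
  have [measurable]: "f \<in> borel_measurable borel"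
    using f by auto
  define h where "h k x = (if cmod (f x) \<le> real k \<and> norm x \<le> real k then f x else 0)" for k x
  have [measurable]: "h k \<in> borel_measurable borel" for k
    unfolding h_def by measurable
  have b: "cmod (h k x) \<le> real k" for k x
    by (simp add: h_def)
  show ?thesis
  proof (rule fourier_isometric_dominated_limit[where f=h and g=f])
    show "fourier_isometric (h k)" for k
      by (rule fourier_isometric_bounded[OF _ b, where R="real k"]) (auto simp: h_def)
    show "fourier_isometric (\<lambda>x. h j x - h k x)" for j k
    proof (rule fourier_isometric_bounded[where M="real j + real k" and R="max (real j) (real k)"])
      show "cmod (h j x - h k x) \<le> real j + real k" for x
        using norm_triangle_ineq4[of "h j x" "h k x"] b[of j x] b[of k x] by linarith
    qed (auto simp: h_def)
    show "AE x in lborel. (\<lambda>k. h k x) \<longlonglongrightarrow> f x"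
    proof (intro AE_I2 tendsto_eventually)
      fix x
      have "\<forall>\<^sub>F k in sequentially. cmod (f x) \<le> real k \<and> norm x \<le> real k"
        using filterlim_real_sequentially unfolding filterlim_at_top by (simp add: eventually_conj)
      then show "\<forall>\<^sub>F k in sequentially. h k x = f x"
        by eventually_elim (simp add: h_def)
    qed
    show "cmod (h k x - f x) \<le> cmod (f x)" for k x
      by (simp add: h_def)
  qed (use f in auto)
qed

subsection \<open>The Fourier transform on square integrable functions\<close>

lemma fourier_L2_of_L1_L2:
  assumes "integrable lborel f" "f \<in> L2"
  shows "fourier f \<in> L2" "L2norm (fourier f) = L2norm f"
  using fourier_isometric_L1_L2[OF assms] by (auto simp: fourier_isometric_def)

lemma L2norm_fourier_diff:
  assumes "integrable lborel f" "f \<in> L2" "integrable lborel g" "g \<in> L2"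
  shows "L2norm (\<lambda>\<xi>. fourier f \<xi> - fourier g \<xi>) = L2norm (\<lambda>x. f x - g x)"
proof -
  have "fourier (\<lambda>x. f x - g x) = (\<lambda>\<xi>. fourier f \<xi> - fourier g \<xi>)"
    by (rule ext) (rule fourier_diff[OF assms(1,3)])
  then show ?thesis
    using fourier_L2_of_L1_L2(2)[of "\<lambda>x. f x - g x"] assms by (simp add: L2_diff)
qed

text \<open>Names the truncation that occurs inside \<open>fourier_L2\<close>.\<close>

definition truncate :: "('a::euclidean_space \<Rightarrow> complex) \<Rightarrow> real \<Rightarrow> 'a \<Rightarrow> complex" where
  "truncate f R x = indicator (cball 0 R) x * f x"

lemma
  fixes f :: "'a::euclidean_space \<Rightarrow> complex"
  assumes f: "f \<in> L2"
  shows truncate_integrable: "integrable lborel (truncate f R)"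
    and truncate_L2: "truncate f R \<in> L2"
    and truncate_tendsto: "((\<lambda>R. L2norm (\<lambda>x. truncate f R x - f x)) \<longlongrightarrow> 0) at_top"
proof -
  note [measurable] = L2_measurable[OF f]
  have [measurable]: "truncate f R \<in> borel_measurable borel" for R
    unfolding truncate_def[abs_def] using f
    by (intro borel_measurable_times borel_measurable_indicator) (auto simp: L2_measurable)
  have "truncate f R = (\<lambda>x. complex_of_real (1 * indicator (cball 0 R) x) * f x)"
    by (auto simp: truncate_def indicator_def)
  then show "integrable lborel (truncate f R)"
    using L2_mult_integrable(1)[OF cball_indicator_L2 f] by metis
  show "truncate f R \<in> L2"
    by (rule L2_dominated(1)[OF _ f, of _ 1]) (auto simp: truncate_def indicator_def)
  show "((\<lambda>R. L2norm (\<lambda>x. truncate f R x - f x)) \<longlongrightarrow> 0) at_top"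
  proof (rule tendsto_at_topI_sequentially, rule L2_dominated_convergence[OF _ _ f])
    fix X :: "nat \<Rightarrow> real" assume X: "filterlim X at_top sequentially"
    show "AE x in lborel. (\<lambda>k. truncate f (X k) x) \<longlonglongrightarrow> f x"
    proof (intro AE_I2 tendsto_eventually)
      fix x :: 'a
      have "\<forall>\<^sub>F k in sequentially. norm x \<le> X k"
        using X by (simp add: filterlim_at_top)
      then show "\<forall>\<^sub>F k in sequentially. truncate f (X k) x = f x"
        by eventually_elim (simp add: truncate_def)
    qed
    show "AE x in lborel. cmod (truncate f (X k) x - f x) \<le> cmod (f x)" for k
      by (intro AE_I2) (simp add: truncate_def indicator_def)
  qed auto
qed

lemma fourier_L2_exists:
  assumes f: "f \<in> L2"
  shows "\<exists>h\<in>L2. ((\<lambda>R. L2norm (\<lambda>\<xi>. fourier (truncate f R) \<xi> - h \<xi>)) \<longlongrightarrow> 0) at_top"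
proof -
  note t = truncate_integrable[OF f] truncate_L2[OF f]
  have F: "fourier (truncate f R) \<in> L2" for R
    by (rule fourier_L2_of_L1_L2(1)[OF t])
  have d: "L2norm (\<lambda>\<xi>. fourier (truncate f R) \<xi> - fourier (truncate f S) \<xi>)
      \<le> L2norm (\<lambda>x. truncate f R x - f x) + L2norm (\<lambda>x. truncate f S x - f x)" for R S
    using L2norm_dist_triangle[OF t(2) f t(2), of R S]
    by (simp add: L2norm_fourier_diff[OF t t] L2norm_diff_commute[of f])
  have lim: "(\<lambda>n::nat. L2norm (\<lambda>x. truncate f (real n) x - f x)) \<longlonglongrightarrow> 0"
    by (rule filterlim_compose[OF truncate_tendsto[OF f] filterlim_real_sequentially])
  have "\<exists>h\<in>L2. (\<lambda>n. L2norm (\<lambda>\<xi>. fourier (truncate f (real n)) \<xi> - h \<xi>)) \<longlonglongrightarrow> 0"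
  proof (rule L2_complete[OF F])
    fix e :: real assume e: "0 < e"
    have "\<forall>\<^sub>F n in sequentially. L2norm (\<lambda>x. truncate f (real n) x - f x) < e / 2"
      using order_tendstoD(2)[OF lim, of "e / 2"] e by simp
    then obtain N where N: "\<And>n. n \<ge> N \<Longrightarrow> L2norm (\<lambda>x. truncate f (real n) x - f x) < e / 2"
      by (auto simp: eventually_sequentially)
    show "\<exists>N. \<forall>j\<ge>N. \<forall>k\<ge>N. L2norm (\<lambda>\<xi>. fourier (truncate f (real j)) \<xi> - fourier (truncate f (real k)) \<xi>) < e"
    proof (intro exI[of _ N] allI impI)
      fix j k assume "N \<le> j" "N \<le> k"
      then show "L2norm (\<lambda>\<xi>. fourier (truncate f (real j)) \<xi> - fourier (truncate f (real k)) \<xi>) < e"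
        using N[of j] N[of k] d[of "real j" "real k"] by linarith
    qed
  qed
  then obtain h where h: "h \<in> L2" and hl: "(\<lambda>n. L2norm (\<lambda>\<xi>. fourier (truncate f (real n)) \<xi> - h \<xi>)) \<longlonglongrightarrow> 0"
    by blast
  \<comment> \<open>Completeness gives a limit along integer radii only. Letting the integer radius
    tend to infinity with \<open>R\<close> fixed extends convergence to real radii, as
    \<open>fourier_L2\<close> demands.\<close>
  have "L2norm (\<lambda>\<xi>. fourier (truncate f R) \<xi> - h \<xi>) \<le> L2norm (\<lambda>x. truncate f R x - f x)" for R
  proof (rule tendsto_lowerbound)
    show "(\<lambda>n. L2norm (\<lambda>x. truncate f R x - f x) + L2norm (\<lambda>x. truncate f (real n) x - f x)
        + L2norm (\<lambda>\<xi>. fourier (truncate f (real n)) \<xi> - h \<xi>)) \<longlonglongrightarrow> L2norm (\<lambda>x. truncate f R x - f x)"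
      using tendsto_add[OF tendsto_add[OF tendsto_const lim] hl] by simp
    show "\<forall>\<^sub>F n in sequentially. L2norm (\<lambda>\<xi>. fourier (truncate f R) \<xi> - h \<xi>)
        \<le> L2norm (\<lambda>x. truncate f R x - f x) + L2norm (\<lambda>x. truncate f (real n) x - f x)
        + L2norm (\<lambda>\<xi>. fourier (truncate f (real n)) \<xi> - h \<xi>)"
    proof (intro always_eventually allI)
      fix n
      show "L2norm (\<lambda>\<xi>. fourier (truncate f R) \<xi> - h \<xi>)
        \<le> L2norm (\<lambda>x. truncate f R x - f x) + L2norm (\<lambda>x. truncate f (real n) x - f x)
        + L2norm (\<lambda>\<xi>. fourier (truncate f (real n)) \<xi> - h \<xi>)"
        using L2norm_dist_triangle[OF F[of R] F[of "real n"] h] d[of R "real n"] by linarith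
    qed
  qed auto
  then have "((\<lambda>R. L2norm (\<lambda>\<xi>. fourier (truncate f R) \<xi> - h \<xi>)) \<longlongrightarrow> 0) at_top"
    by (intro Lim_null_comparison[OF always_eventually truncate_tendsto[OF f]]) auto
  then show ?thesis using h by blast
qed

lemma
  assumes "f \<in> L2"
  shows fourier_L2_L2: "fourier_L2 f \<in> L2"
    and fourier_L2_tendsto: "((\<lambda>R. L2norm (\<lambda>\<xi>. fourier (truncate f R) \<xi> - fourier_L2 f \<xi>)) \<longlongrightarrow> 0) at_top"
proof -
  have ex: "\<exists>h. h \<in> L2 \<and> ((\<lambda>R. L2norm (\<lambda>\<xi>. fourier (\<lambda>x. indicator (cball 0 R) x * f x) \<xi> - h \<xi>)) \<longlongrightarrow> 0) at_top"
    using fourier_L2_exists[OF assms] by (auto simp: truncate_def[abs_def])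
  show "fourier_L2 f \<in> L2"
    using someI_ex[OF ex] by (simp only: fourier_L2_def)
  show "((\<lambda>R. L2norm (\<lambda>\<xi>. fourier (truncate f R) \<xi> - fourier_L2 f \<xi>)) \<longlongrightarrow> 0) at_top"
    using someI_ex[OF ex] by (simp only: fourier_L2_def truncate_def[abs_def])
qed

lemma fourier_truncate_L2: "f \<in> L2 \<Longrightarrow> fourier (truncate f R) \<in> L2"
  by (intro fourier_L2_of_L1_L2(1) truncate_integrable truncate_L2)

lemma L2_diff_tendsto:
  assumes "\<forall>\<^sub>F k in F. u k \<in> L2 \<and> v k \<in> L2" "f \<in> L2" "g \<in> L2"
    and "((\<lambda>k. L2norm (\<lambda>x. u k x - f x)) \<longlongrightarrow> 0) F" "((\<lambda>k. L2norm (\<lambda>x. v k x - g x)) \<longlongrightarrow> 0) F"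
  shows "((\<lambda>k. L2norm (\<lambda>x. (u k x - v k x) - (f x - g x))) \<longlongrightarrow> 0) F"
proof (rule Lim_null_comparison[OF _ tendsto_add_zero[OF assms(4,5)]])
  show "\<forall>\<^sub>F k in F. norm (L2norm (\<lambda>x. (u k x - v k x) - (f x - g x)))
      \<le> L2norm (\<lambda>x. u k x - f x) + L2norm (\<lambda>x. v k x - g x)"
    using assms(1)
  proof eventually_elim
    case (elim k)
    have "(\<lambda>x. (u k x - v k x) - (f x - g x)) = (\<lambda>x. (u k x - f x) - (v k x - g x))"
      by auto
    then show ?case
      using L2norm_diff_le[of "\<lambda>x. u k x - f x" "\<lambda>x. v k x - g x"] elim assms(2,3) by (simp add: L2_diff)
  qed
qed

text \<open>The chosen representatives satisfy no literal additivity, so the isometry on differences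
  is obtained from the truncations, where \<open>fourier\<close> is genuinely linear.\<close>

lemma L2norm_fourier_L2_diff:
  assumes f: "f \<in> L2" and g: "g \<in> L2"
  shows "L2norm (\<lambda>\<xi>. fourier_L2 f \<xi> - fourier_L2 g \<xi>) = L2norm (\<lambda>x. f x - g x)"
proof (rule tendsto_unique[of at_top])
  note t = truncate_integrable truncate_L2
  let ?d = "\<lambda>R. L2norm (\<lambda>x. truncate f R x - truncate g R x)"
  show "(?d \<longlongrightarrow> L2norm (\<lambda>x. f x - g x)) at_top"
    by (rule L2norm_tendsto[OF _ _ L2_diff_tendsto])
      (auto intro!: always_eventually L2_diff truncate_L2 truncate_tendsto f g)
  have "((\<lambda>R. L2norm (\<lambda>\<xi>. fourier (truncate f R) \<xi> - fourier (truncate g R) \<xi>))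
      \<longlongrightarrow> L2norm (\<lambda>\<xi>. fourier_L2 f \<xi> - fourier_L2 g \<xi>)) at_top"
    by (rule L2norm_tendsto[OF _ _ L2_diff_tendsto])
      (auto intro!: always_eventually L2_diff fourier_truncate_L2 fourier_L2_L2 fourier_L2_tendsto f g)
  then show "(?d \<longlongrightarrow> L2norm (\<lambda>\<xi>. fourier_L2 f \<xi> - fourier_L2 g \<xi>)) at_top"
    by (simp add: L2norm_fourier_diff t f g)
qed simp

lemma L2norm_fourier_L2:
  assumes f: "f \<in> L2"
  shows "L2norm (fourier_L2 f) = L2norm f"
proof (rule tendsto_unique[of at_top])
  show "((\<lambda>R. L2norm (truncate f R)) \<longlongrightarrow> L2norm f) at_top"
    by (rule L2norm_tendsto[OF _ f truncate_tendsto[OF f]]) (auto intro!: always_eventually truncate_L2 f)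
  have "((\<lambda>R. L2norm (fourier (truncate f R))) \<longlongrightarrow> L2norm (fourier_L2 f)) at_top"
    by (rule L2norm_tendsto[OF _ fourier_L2_L2[OF f] fourier_L2_tendsto[OF f]])
      (auto intro!: always_eventually fourier_truncate_L2 f)
  then show "((\<lambda>R. L2norm (truncate f R)) \<longlongrightarrow> L2norm (fourier_L2 f)) at_top"
    by (simp add: fourier_L2_of_L1_L2 truncate_integrable truncate_L2 f)
qed simp

text \<open>Both functions are L2 limits of the transforms of the same truncations.\<close>

lemma fourier_L2_eq_fourier:
  assumes f: "integrable lborel f" "f \<in> L2"
  shows "AE \<xi> in lborel. fourier_L2 f \<xi> = fourier f \<xi>"
proof (rule L2_limit_unique[of "\<lambda>R. fourier (truncate f R)" at_top])
  show "((\<lambda>R. L2norm (\<lambda>\<xi>. fourier (truncate f R) \<xi> - fourier f \<xi>)) \<longlongrightarrow> 0) at_top"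
    using truncate_tendsto[OF f(2)] by (simp add: L2norm_fourier_diff truncate_integrable truncate_L2 f)
qed (use f in \<open>auto intro!: always_eventually fourier_truncate_L2 fourier_L2_L2 fourier_L2_tendsto fourier_L2_of_L1_L2\<close>)

lemma L2_mult_tendsto:
  assumes L2: "\<forall>\<^sub>F k in F. u k \<in> L2 \<and> v k \<in> L2" and f: "f \<in> L2" and g: "g \<in> L2"
    and u: "((\<lambda>k. L2norm (\<lambda>x. u k x - f x)) \<longlongrightarrow> 0) F" and v: "((\<lambda>k. L2norm (\<lambda>x. v k x - g x)) \<longlongrightarrow> 0) F"
  shows "((\<lambda>k. \<integral>x. u k x * v k x \<partial>lborel) \<longlongrightarrow> (\<integral>x. f x * g x \<partial>lborel)) F"
proof -
  have nv: "((\<lambda>k. L2norm (v k)) \<longlongrightarrow> L2norm g) F"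
    by (rule L2norm_tendsto[OF _ g v]) (use L2 in eventually_elim, simp)
  have "((\<lambda>k. (\<integral>x. u k x * v k x \<partial>lborel) - (\<integral>x. f x * g x \<partial>lborel)) \<longlongrightarrow> 0) F"
  proof (rule Lim_null_comparison)
    show "((\<lambda>k. L2norm (\<lambda>x. u k x - f x) * L2norm (v k) + L2norm f * L2norm (\<lambda>x. v k x - g x)) \<longlongrightarrow> 0) F"
      using tendsto_add[OF tendsto_mult[OF u nv] tendsto_mult[OF tendsto_const v, of "L2norm f"]] by simp
    show "\<forall>\<^sub>F k in F. norm ((\<integral>x. u k x * v k x \<partial>lborel) - (\<integral>x. f x * g x \<partial>lborel))
        \<le> L2norm (\<lambda>x. u k x - f x) * L2norm (v k) + L2norm f * L2norm (\<lambda>x. v k x - g x)"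
      using L2
    proof eventually_elim
      case (elim k)
      then have d: "(\<lambda>x. u k x - f x) \<in> L2" "(\<lambda>x. v k x - g x) \<in> L2" and k: "u k \<in> L2" "v k \<in> L2"
        using f g by (auto simp: L2_diff)
      have "(\<integral>x. u k x * v k x \<partial>lborel) - (\<integral>x. f x * g x \<partial>lborel)
          = (\<integral>x. u k x * v k x - f x * g x \<partial>lborel)"
        by (intro Bochner_Integration.integral_diff[symmetric] L2_mult_integrable k f g)
      \<comment> \<open>The usual splitting for a limit of products; the Cauchy-Schwarz inequality
        bounds each part.\<close>
      also have "\<dots> = (\<integral>x. (u k x - f x) * v k x + f x * (v k x - g x) \<partial>lborel)"
        by (intro Bochner_Integration.integral_cong) (auto simp: algebra_simps)
      also have "\<dots> = (\<integral>x. (u k x - f x) * v k x \<partial>lborel) + (\<integral>x. f x * (v k x - g x) \<partial>lborel)"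
        by (intro Bochner_Integration.integral_add L2_mult_integrable d k f g)
      finally show ?case
        using L2_mult_integrable(3)[OF d(1) k(2)] L2_mult_integrable(3)[OF f d(2)]
        by (simp only:) (meson norm_triangle_ineq order_trans add_mono)
    qed
  qed
  then show ?thesis by (simp add: LIM_zero_iff)
qed

lemma fourier_L2_multiplication_formula:
  fixes f g :: "'a::euclidean_space \<Rightarrow> complex"
  assumes f: "f \<in> L2" and g: "g \<in> L2"
  shows "(\<integral>x. fourier_L2 f x * g x \<partial>lborel) = (\<integral>x. f x * fourier_L2 g x \<partial>lborel)"
proof (rule tendsto_unique[of at_top])
  show "((\<lambda>R. \<integral>x. truncate f R x * fourier (truncate g R) x \<partial>lborel) \<longlongrightarrow> (\<integral>x. f x * fourier_L2 g x \<partial>lborel)) at_top"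
    by (rule L2_mult_tendsto)
      (auto intro!: always_eventually truncate_L2 fourier_truncate_L2 fourier_L2_L2 truncate_tendsto fourier_L2_tendsto f g)
  have "((\<lambda>R. \<integral>x. fourier (truncate f R) x * truncate g R x \<partial>lborel) \<longlongrightarrow> (\<integral>x. fourier_L2 f x * g x \<partial>lborel)) at_top"
    by (rule L2_mult_tendsto)
      (auto intro!: always_eventually truncate_L2 fourier_truncate_L2 fourier_L2_L2 truncate_tendsto fourier_L2_tendsto f g)
  then show "((\<lambda>R. \<integral>x. truncate f R x * fourier (truncate g R) x \<partial>lborel) \<longlongrightarrow> (\<integral>x. fourier_L2 f x * g x \<partial>lborel)) at_top"
    by (simp add: fourier_multiplication_formula truncate_integrable f g)
qed simp

lemma L2norm_diff_square:
  assumes f: "f \<in> L2" and g: "g \<in> L2"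
  shows "(L2norm (\<lambda>x. f x - g x))\<^sup>2 = (L2norm f)\<^sup>2 + (L2norm g)\<^sup>2 - 2 * Re (\<integral>x. f x * cnj (g x) \<partial>lborel)"
proof -
  have i: "integrable lborel (\<lambda>x. f x * cnj (g x))"
    by (intro L2_mult_integrable L2_cnj f g)
  have "(L2norm (\<lambda>x. f x - g x))\<^sup>2 = (\<integral>x. (cmod (f x))\<^sup>2 + (cmod (g x))\<^sup>2 - 2 * Re (f x * cnj (g x)) \<partial>lborel)"
    unfolding L2norm_square cmod_power2
    by (intro Bochner_Integration.integral_cong) (auto simp: power2_eq_square algebra_simps)
  also have "\<dots> = (\<integral>x. (cmod (f x))\<^sup>2 + (cmod (g x))\<^sup>2 \<partial>lborel) - (\<integral>x. 2 * Re (f x * cnj (g x)) \<partial>lborel)"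
    by (intro Bochner_Integration.integral_diff Bochner_Integration.integrable_add L2_integrable_square
        integrable_mult_right integrable_Re i f g)
  also have "(\<integral>x. (cmod (f x))\<^sup>2 + (cmod (g x))\<^sup>2 \<partial>lborel) = (L2norm f)\<^sup>2 + (L2norm g)\<^sup>2"
    unfolding L2norm_square by (intro Bochner_Integration.integral_add L2_integrable_square f g)
  also have "(\<integral>x. 2 * Re (f x * cnj (g x)) \<partial>lborel) = 2 * Re (\<integral>x. f x * cnj (g x) \<partial>lborel)"
    unfolding integral_mult_right_zero integral_Re[OF i] ..
  finally show ?thesis .
qed

text \<open>The inverse of the unitary transform is its adjoint, which is given by conjugating twice.\<close>

lemma fourier_L2_surj:
  assumes h: "h \<in> L2"
  shows "\<exists>f\<in>L2. AE \<xi> in lborel. fourier_L2 f \<xi> = h \<xi>"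
proof -
  define h' where "h' = (\<lambda>x. cnj (h x))"
  define f where "f = (\<lambda>x. cnj (fourier_L2 h' x))"
  have h': "h' \<in> L2" and f: "f \<in> L2"
    unfolding h'_def f_def by (intro L2_cnj fourier_L2_L2 h)+
  have norms: "L2norm (fourier_L2 f) = L2norm h" "L2norm (fourier_L2 h') = L2norm h"
    by (simp_all add: L2norm_fourier_L2 f h') (simp_all add: f_def h'_def L2norm_fourier_L2 L2_cnj h)
  have "(\<integral>x. fourier_L2 f x * cnj (h x) \<partial>lborel) = (\<integral>x. f x * fourier_L2 h' x \<partial>lborel)"
    using fourier_L2_multiplication_formula[OF f h'] by (simp add: h'_def)
  also have "\<dots> = (\<integral>x. complex_of_real ((cmod (fourier_L2 h' x))\<^sup>2) \<partial>lborel)"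
    unfolding f_def complex_norm_square by (simp add: mult.commute)
  also have "\<dots> = complex_of_real ((L2norm h)\<^sup>2)"
    unfolding norms(2)[symmetric] L2norm_square by (rule integral_complex_of_real)
  \<comment> \<open>\<open>fourier_L2 f\<close> and \<open>h\<close> have the same norm, and their
    inner product equals its square: expanding the squared distance leaves 0.\<close>
  finally have "(L2norm (\<lambda>x. fourier_L2 f x - h x))\<^sup>2 = 0"
    using L2norm_diff_square[OF fourier_L2_L2[OF f] h] norms by simp
  then have "AE x in lborel. fourier_L2 f x - h x = 0"
    by (intro AE_eq_0_if_L2norm_eq_0 L2_diff fourier_L2_L2 f h) simp
  then show ?thesis
    using f by auto
qed

lemma inv_fourier_L2:
  assumes "h \<in> L2"
  shows "inv_fourier_L2 h \<in> L2" "AE \<xi> in lborel. fourier_L2 (inv_fourier_L2 h) \<xi> = h \<xi>"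
proof -
  have ex: "\<exists>f. f \<in> L2 \<and> (AE \<xi> in lborel. fourier_L2 f \<xi> = h \<xi>)"
    using fourier_L2_surj[OF assms] by blast
  show "inv_fourier_L2 h \<in> L2" "AE \<xi> in lborel. fourier_L2 (inv_fourier_L2 h) \<xi> = h \<xi>"
    using someI_ex[OF ex] by (simp_all only: inv_fourier_L2_def)
qed

lemma fourier_multiplier:
  assumes f: "f \<in> L2" and [measurable]: "m \<in> borel_measurable borel" and B: "\<And>\<xi>. \<bar>m \<xi>\<bar> \<le> B"
  shows "fourier_multiplier m f \<in> L2"
    and "AE \<xi> in lborel. fourier_L2 (fourier_multiplier m f) \<xi> = complex_of_real (m \<xi>) * fourier_L2 f \<xi>"
proof -
  have "(\<lambda>\<xi>. complex_of_real (m \<xi>) * fourier_L2 f \<xi>) \<in> L2"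
    by (rule L2_mult_bounded(1)[OF fourier_L2_L2[OF f], of _ B]) (use B in auto)
  from inv_fourier_L2[OF this] show "fourier_multiplier m f \<in> L2"
    and "AE \<xi> in lborel. fourier_L2 (fourier_multiplier m f) \<xi> = complex_of_real (m \<xi>) * fourier_L2 f \<xi>"
    unfolding fourier_multiplier_def by auto
qed

subsection \<open>Convolution with an integrable kernel\<close>

text \<open>Young's inequality for L1 and L2: split the modulus of \<open>f\<close> into two square
  roots, apply the Cauchy-Schwarz inequality in \<open>y\<close> and Tonelli's theorem. Keeping the
  modulus inside the integral also shows that the convolution integral exists for almost every
  \<open>x\<close>.\<close>

lemma conv_Young_nn_integral:
  fixes f g :: "'a::euclidean_space \<Rightarrow> complex"
  assumes f: "integrable lborel f" and g: "g \<in> L2"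
  shows "(\<integral>\<^sup>+x. (\<integral>\<^sup>+y. ennreal (cmod (f (x - y) * g y)) \<partial>lborel)\<^sup>2 \<partial>lborel)
     \<le> ennreal (((\<integral>x. cmod (f x) \<partial>lborel) * L2norm g)\<^sup>2)"
proof -
  have [measurable]: "f \<in> borel_measurable borel" "g \<in> borel_measurable borel"
    using f g by auto
  let ?I = "\<integral>x. cmod (f x) \<partial>lborel"
  have I: "(\<integral>\<^sup>+x. ennreal (cmod (f x)) \<partial>lborel) = ennreal ?I"
    by (rule nn_integral_eq_integral) (use f in auto)
  have "(\<integral>\<^sup>+y. ennreal (cmod (f (x - y) * g y)) \<partial>lborel)\<^sup>2
      \<le> ennreal ?I * (\<integral>\<^sup>+y. ennreal (cmod (f (x - y))) * ennreal ((cmod (g y))\<^sup>2) \<partial>lborel)" for x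
  proof -
    have eq: "ennreal (cmod (f (x - y) * g y)) = ennreal (sqrt (cmod (f (x - y)))) * ennreal (sqrt (cmod (f (x - y))) * cmod (g y))" for y
      by (simp add: norm_mult flip: ennreal_mult)
    have "(\<integral>\<^sup>+y. ennreal (cmod (f (x - y) * g y)) \<partial>lborel)\<^sup>2
      \<le> (\<integral>\<^sup>+y. (ennreal (sqrt (cmod (f (x - y)))))\<^sup>2 \<partial>lborel) * (\<integral>\<^sup>+y. (ennreal (sqrt (cmod (f (x - y))) * cmod (g y)))\<^sup>2 \<partial>lborel)"
      unfolding eq by (rule Cauchy_Schwarz_nn_integral) auto
    also have "(\<integral>\<^sup>+y. (ennreal (sqrt (cmod (f (x - y)))))\<^sup>2 \<partial>lborel) = ennreal ?I"
      by (simp add: ennreal_power lborel_nn_integral_reflect[of "\<lambda>y. ennreal (cmod (f y))"] I)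
    also have "(\<integral>\<^sup>+y. (ennreal (sqrt (cmod (f (x - y))) * cmod (g y)))\<^sup>2 \<partial>lborel)
        = (\<integral>\<^sup>+y. ennreal (cmod (f (x - y))) * ennreal ((cmod (g y))\<^sup>2) \<partial>lborel)"
      by (simp add: ennreal_power power_mult_distrib ennreal_mult)
    finally show ?thesis .
  qed
  then have "(\<integral>\<^sup>+x. (\<integral>\<^sup>+y. ennreal (cmod (f (x - y) * g y)) \<partial>lborel)\<^sup>2 \<partial>lborel)
      \<le> (\<integral>\<^sup>+x. ennreal ?I * (\<integral>\<^sup>+y. ennreal (cmod (f (x - y))) * ennreal ((cmod (g y))\<^sup>2) \<partial>lborel) \<partial>lborel)"
    by (rule nn_integral_mono)
  also have "\<dots> = ennreal ?I * (\<integral>\<^sup>+x. (\<integral>\<^sup>+y. ennreal (cmod (f (x - y))) * ennreal ((cmod (g y))\<^sup>2) \<partial>lborel) \<partial>lborel)"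
    by (rule nn_integral_cmult) measurable
  also have "(\<integral>\<^sup>+x. (\<integral>\<^sup>+y. ennreal (cmod (f (x - y))) * ennreal ((cmod (g y))\<^sup>2) \<partial>lborel) \<partial>lborel)
      = (\<integral>\<^sup>+y. (\<integral>\<^sup>+x. ennreal (cmod (f (x - y))) * ennreal ((cmod (g y))\<^sup>2) \<partial>lborel) \<partial>lborel)"
    by (rule lborel_pair.Fubini') measurable
  also have "\<dots> = (\<integral>\<^sup>+y. ennreal ?I * ennreal ((cmod (g y))\<^sup>2) \<partial>lborel)"
    by (simp add: nn_integral_multc lborel_nn_integral_shift[of "\<lambda>y. ennreal (cmod (f y))"] I)
  also have "\<dots> = ennreal ?I * ennreal ((L2norm g)\<^sup>2)"
    by (simp add: nn_integral_cmult nn_integral_eq_L2norm[OF g])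
  finally show ?thesis
    by (simp add: power2_eq_square ennreal_mult mult_ac)
qed

lemma
  fixes f g :: "'a::euclidean_space \<Rightarrow> complex"
  assumes f: "integrable lborel f" and g: "g \<in> L2"
  shows conv_L2: "conv f g \<in> L2"
    and L2norm_conv_le: "L2norm (conv f g) \<le> (\<integral>x. cmod (f x) \<partial>lborel) * L2norm g"
    and conv_integrable_AE: "AE x in lborel. integrable lborel (\<lambda>y. f (x - y) * g y)"
proof -
  have [measurable]: "f \<in> borel_measurable borel" "g \<in> borel_measurable borel"
    using f g by auto
  note Y = conv_Young_nn_integral[OF f g]
  have "ennreal (cmod (conv f g x)) \<le> (\<integral>\<^sup>+y. ennreal (cmod (f (x - y) * g y)) \<partial>lborel)" for x
    unfolding conv_def
    by (cases "integrable lborel (\<lambda>y. f (x - y) * g y)")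
      (simp_all add: integral_norm_bound_ennreal not_integrable_integral_eq)
  then have "(ennreal (cmod (conv f g x)))\<^sup>2 \<le> (\<integral>\<^sup>+y. ennreal (cmod (f (x - y) * g y)) \<partial>lborel)\<^sup>2" for x
    by (rule power_mono) simp
  then have "(\<integral>\<^sup>+x. ennreal ((cmod (conv f g x))\<^sup>2) \<partial>lborel) \<le> ennreal (((\<integral>x. cmod (f x) \<partial>lborel) * L2norm g)\<^sup>2)"
    by (intro order_trans[OF nn_integral_mono Y]) (simp add: ennreal_power)
  then show "conv f g \<in> L2" "L2norm (conv f g) \<le> (\<integral>x. cmod (f x) \<partial>lborel) * L2norm g"
    using L2_nn_integral_boundI[of "conv f g" "(\<integral>x. cmod (f x) \<partial>lborel) * L2norm g"] by auto
  have "AE x in lborel. (\<integral>\<^sup>+y. ennreal (cmod (f (x - y) * g y)) \<partial>lborel)\<^sup>2 \<noteq> \<infinity>"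
    by (rule nn_integral_PInf_AE) (use Y in \<open>auto simp: top_unique\<close>)
  then show "AE x in lborel. integrable lborel (\<lambda>y. f (x - y) * g y)"
  proof eventually_elim
    case (elim x)
    then have "(\<integral>\<^sup>+y. ennreal (cmod (f (x - y) * g y)) \<partial>lborel) < \<infinity>"
      by (auto simp: less_top power2_eq_square ennreal_mult_eq_top_iff)
    then show ?case
      by (intro integrableI_bounded) auto
  qed
qed

text \<open>For a truncated \<open>g\<close> this is the convolution theorem for integrable
  functions. Both sides depend continuously on \<open>g\<close> in L2 with the L1 norm of
  \<open>f\<close> as constant: the left by Young's inequality and isometry, the right because
  \<open>fourier f\<close> is bounded by it.\<close>

lemma fourier_L2_conv:
  fixes f g :: "'a::euclidean_space \<Rightarrow> complex"
  assumes f: "integrable lborel f" and g: "g \<in> L2"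
  shows "AE \<xi> in lborel. fourier_L2 (conv f g) \<xi> = fourier f \<xi> * fourier_L2 g \<xi>"
proof (rule L2_limit_unique[of "\<lambda>R. fourier_L2 (conv f (truncate g R))" at_top])
  have [measurable]: "f \<in> borel_measurable borel" "g \<in> borel_measurable borel"
    using f g by auto
  note t = truncate_integrable[OF g] truncate_L2[OF g]
  have [measurable]: "truncate g R \<in> borel_measurable borel" for R
    using t(2)[of R] by auto
  let ?I = "\<integral>x. cmod (f x) \<partial>lborel"
  have mult: "(\<lambda>\<xi>. fourier f \<xi> * h \<xi>) \<in> L2" "L2norm (\<lambda>\<xi>. fourier f \<xi> * h \<xi>) \<le> ?I * L2norm h" if "h \<in> L2" for h
    using L2_mult_bounded[OF that, of "fourier f" ?I] norm_fourier_le[of f] by auto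
  show "\<forall>\<^sub>F R in at_top. fourier_L2 (conv f (truncate g R)) \<in> L2"
    by (intro always_eventually allI fourier_L2_L2 conv_L2 f t)
  show "fourier_L2 (conv f g) \<in> L2" "(\<lambda>\<xi>. fourier f \<xi> * fourier_L2 g \<xi>) \<in> L2"
    by (intro fourier_L2_L2 conv_L2 f g mult)+
  show "((\<lambda>R. L2norm (\<lambda>\<xi>. fourier_L2 (conv f (truncate g R)) \<xi> - fourier_L2 (conv f g) \<xi>)) \<longlongrightarrow> 0) at_top"
  proof (rule Lim_null_comparison[OF always_eventually tendsto_mult_right_zero[OF truncate_tendsto[OF g], of ?I]], rule allI)
    fix R
    have d: "(\<lambda>x. truncate g R x - g x) \<in> L2"
      by (intro L2_diff t g)
    \<comment> \<open>The difference of convolutions may be merged only where both integrals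
      exist.\<close>
    have "AE x in lborel. conv f (truncate g R) x - conv f g x = conv f (\<lambda>x. truncate g R x - g x) x"
      using conv_integrable_AE[OF f t(2)[of R]] conv_integrable_AE[OF f g]
      by eventually_elim (simp add: conv_def right_diff_distrib)
    then have "L2norm (\<lambda>x. conv f (truncate g R) x - conv f g x) = L2norm (conv f (\<lambda>x. truncate g R x - g x))"
      by (intro L2norm_cong_AE) auto
    also have "\<dots> \<le> ?I * L2norm (\<lambda>x. truncate g R x - g x)"
      by (rule L2norm_conv_le[OF f d])
    finally show "norm (L2norm (\<lambda>\<xi>. fourier_L2 (conv f (truncate g R)) \<xi> - fourier_L2 (conv f g) \<xi>))
        \<le> ?I * L2norm (\<lambda>x. truncate g R x - g x)"
      by (simp add: L2norm_fourier_L2_diff conv_L2 f g t)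
  qed
  show "((\<lambda>R. L2norm (\<lambda>\<xi>. fourier_L2 (conv f (truncate g R)) \<xi> - fourier f \<xi> * fourier_L2 g \<xi>)) \<longlongrightarrow> 0) at_top"
  proof (rule Lim_null_comparison[OF always_eventually tendsto_mult_right_zero[OF fourier_L2_tendsto[OF g], of ?I]], rule allI)
    fix R
    have d: "(\<lambda>\<xi>. fourier (truncate g R) \<xi> - fourier_L2 g \<xi>) \<in> L2"
      by (intro L2_diff fourier_truncate_L2 fourier_L2_L2 g)
    have "AE \<xi> in lborel. fourier_L2 (conv f (truncate g R)) \<xi> - fourier f \<xi> * fourier_L2 g \<xi>
        = fourier f \<xi> * (fourier (truncate g R) \<xi> - fourier_L2 g \<xi>)"
      using fourier_L2_eq_fourier[OF conv_integrable[OF f t(1)] conv_L2[OF f t(2)], of R]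
      by eventually_elim (simp add: fourier_conv[OF f t(1)] right_diff_distrib)
    then have "L2norm (\<lambda>\<xi>. fourier_L2 (conv f (truncate g R)) \<xi> - fourier f \<xi> * fourier_L2 g \<xi>)
        = L2norm (\<lambda>\<xi>. fourier f \<xi> * (fourier (truncate g R) \<xi> - fourier_L2 g \<xi>))"
      by (intro L2norm_cong_AE L2_measurable mult d L2_diff fourier_L2_L2 conv_L2 f t g) auto
    also have "\<dots> \<le> ?I * L2norm (\<lambda>\<xi>. fourier (truncate g R) \<xi> - fourier_L2 g \<xi>)"
      by (rule mult(2)[OF d])
    finally show "norm (L2norm (\<lambda>\<xi>. fourier_L2 (conv f (truncate g R)) \<xi> - fourier f \<xi> * fourier_L2 g \<xi>))
        \<le> ?I * L2norm (\<lambda>\<xi>. fourier (truncate g R) \<xi> - fourier_L2 g \<xi>)"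
      by simp
  qed
qed simp

lemma dilate_integrable:
  assumes "integrable lborel \<phi>" "\<beta> > 0"
  shows "integrable lborel (dilate \<beta> \<phi>)"
  unfolding dilate_def[abs_def]
  using lborel_integrable_affine[OF assms(1), of "inverse \<beta>" 0] assms(2) by simp

lemma fourier_dilate:
  fixes \<phi> :: "'a::euclidean_space \<Rightarrow> real"
  assumes [measurable]: "\<phi> \<in> borel_measurable borel" and "\<beta> > 0"
  shows "fourier (\<lambda>x. complex_of_real (dilate \<beta> \<phi> x)) \<xi> = fourier (\<lambda>x. complex_of_real (\<phi> x)) (\<beta> *\<^sub>R \<xi>)"
proof -
  have "fourier (\<lambda>x. complex_of_real (dilate \<beta> \<phi> x)) \<xi>
      = (\<beta> ^ DIM('a)) *\<^sub>R (\<integral>x. complex_of_real (dilate \<beta> \<phi> (\<beta> *\<^sub>R x)) * cis (- 2 * pi * ((\<beta> *\<^sub>R x) \<bullet> \<xi>)) \<partial>lborel)"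
    unfolding fourier_def
    using lborel_integral_affine[of "\<lambda>x. complex_of_real (dilate \<beta> \<phi> x) * cis (- 2 * pi * (x \<bullet> \<xi>))" \<beta> 0] assms(2)
    by (simp add: dilate_def[abs_def])
  also have "\<dots> = fourier (\<lambda>x. complex_of_real (\<phi> x)) (\<beta> *\<^sub>R \<xi>)"
    unfolding fourier_def using assms(2)
    by (subst integral_scaleR_right[symmetric]) (simp add: dilate_def scaleR_conv_of_real)
  finally show ?thesis .
qed

lemma mollify_eq_conv: "mollify \<phi> \<beta> f = conv (\<lambda>x. complex_of_real (dilate \<beta> \<phi> x)) f"
  by (simp add: fun_eq_iff mollify_def conv_def)

lemma
  fixes \<phi> :: "'a::euclidean_space \<Rightarrow> real"
  assumes \<phi>: "integrable lborel \<phi>" and "\<beta> > 0" and u: "u \<in> L2"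
  shows mollify_L2: "mollify \<phi> \<beta> u \<in> L2"
    and fourier_L2_mollify:
      "AE \<xi> in lborel. fourier_L2 (mollify \<phi> \<beta> u) \<xi> = fourier (\<lambda>x. complex_of_real (\<phi> x)) (\<beta> *\<^sub>R \<xi>) * fourier_L2 u \<xi>"
proof -
  have i: "integrable lborel (\<lambda>x. complex_of_real (dilate \<beta> \<phi> x))"
    using dilate_integrable[OF assms(1,2)] by simp
  have "\<phi> \<in> borel_measurable borel"
    using \<phi> by auto
  then show "mollify \<phi> \<beta> u \<in> L2"
    and "AE \<xi> in lborel. fourier_L2 (mollify \<phi> \<beta> u) \<xi> = fourier (\<lambda>x. complex_of_real (\<phi> x)) (\<beta> *\<^sub>R \<xi>) * fourier_L2 u \<xi>"
    using conv_L2[OF i u] fourier_L2_conv[OF i u] \<open>\<beta> > 0\<close> by (simp_all add: mollify_eq_conv fourier_dilate)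
qed

subsection \<open>The kernel\<close>

text \<open>The comparison with \<open>norm \<eta> powr s\<close> is given only near the origin.
  Upwards it extends because 1 - Re F never exceeds 2; downwards, decrease along rays carries a
  positive value from a small sphere outwards. Boundedness of the transform is why the lower bound
  must saturate at 1.\<close>

lemma mollifier_kernel_symbol_bounds:
  fixes \<phi> :: "'a::euclidean_space \<Rightarrow> real"
  assumes "mollifier_kernel s \<phi>" "0 < s"
  defines "F \<equiv> fourier (\<lambda>x. complex_of_real (\<phi> x))"
  shows "\<exists>c1>0. \<exists>c2>0. \<forall>\<eta>. c1 * min 1 (norm \<eta> powr s) \<le> 1 - Re (F \<eta>)
      \<and> 1 - Re (F \<eta>) \<le> c2 * norm \<eta> powr s"
proof -
  have lt: "\<And>\<xi>. \<xi> \<noteq> 0 \<Longrightarrow> cmod (F \<xi>) < 1" and real: "\<And>\<xi>. F \<xi> \<in> \<real>"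
    and anti: "\<And>\<xi>. antimono_on {0..} (\<lambda>r. Re (F (r *\<^sub>R \<xi>)))"
    and theta: "(\<lambda>\<xi>. cmod (1 - F \<xi>)) \<in> \<Theta>[at 0](\<lambda>\<xi>. norm \<xi> powr s)"
    and one: "(\<integral>x. \<phi> x \<partial>lborel) = 1"
    using assms(1) unfolding mollifier_kernel_def F_def by auto
  define m where "m \<eta> = 1 - Re (F \<eta>)" for \<eta>
  have F0: "F 0 = 1"
    using one by (simp add: F_def fourier_def)
  have m0: "m 0 = 0" by (simp add: m_def F0)
  have bnd: "0 \<le> m \<eta>" "m \<eta> \<le> 2" for \<eta>
  proof -
    have "\<bar>Re (F \<eta>)\<bar> \<le> 1"
      using lt[of \<eta>] F0 abs_Re_le_cmod[of "F \<eta>"] by (cases "\<eta> = 0") auto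
    then show "0 \<le> m \<eta>" "m \<eta> \<le> 2" by (auto simp: m_def)
  qed
  have cm: "cmod (1 - F \<eta>) = m \<eta>" for \<eta>
  proof -
    have "1 - F \<eta> = complex_of_real (m \<eta>)"
      using real[of \<eta>] by (simp add: m_def complex_is_Real_iff complex_eq_iff)
    then show ?thesis using bnd(1)[of \<eta>] by simp
  qed
  obtain c where c: "c > 0" "\<forall>\<^sub>F \<eta> in at 0. m \<eta> \<le> c * norm \<eta> powr s"
    using bigthetaD1[OF theta] unfolding cm by (elim landau_o.bigE) (auto simp: bnd)
  obtain d where d: "d > 0" "\<forall>\<^sub>F \<eta> in at 0. d * norm \<eta> powr s \<le> m \<eta>"
    using bigthetaD2[OF theta] unfolding cm by (elim landau_omega.bigE) (auto simp: bnd)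
  have "\<forall>\<^sub>F \<eta> in at 0. m \<eta> \<le> c * norm \<eta> powr s \<and> d * norm \<eta> powr s \<le> m \<eta>"
    using c(2) d(2) by eventually_elim simp
  then obtain r where r: "r > 0"
    and loc: "\<And>\<eta>. \<eta> \<noteq> 0 \<Longrightarrow> norm \<eta> < r \<Longrightarrow> m \<eta> \<le> c * norm \<eta> powr s \<and> d * norm \<eta> powr s \<le> m \<eta>"
    unfolding eventually_at by auto
  have upper: "m \<eta> \<le> max c (2 / r powr s) * norm \<eta> powr s" for \<eta>
  proof (cases "\<eta> = 0 \<or> norm \<eta> < r")
    case True
    then have "m \<eta> \<le> c * norm \<eta> powr s"
      using loc[of \<eta>] m0 by (cases "\<eta> = 0") auto
    also have "\<dots> \<le> max c (2 / r powr s) * norm \<eta> powr s"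
      by (intro mult_right_mono) auto
    finally show ?thesis .
  next
    case False
    \<comment> \<open>The constant \<open>2 / r powr s\<close> is the one for which the right-hand
      side reaches the trivial bound 2 at radius \<open>r\<close>.\<close>
    have "m \<eta> \<le> 2 / r powr s * r powr s"
      using bnd(2)[of \<eta>] r by simp
    also have "\<dots> \<le> max c (2 / r powr s) * norm \<eta> powr s"
      using False r assms(2) by (intro mult_mono powr_mono2) (auto simp: le_max_iff_disj)
    finally show ?thesis .
  qed
  have lower: "min d (d * (r / 2) powr s) * min 1 (norm \<eta> powr s) \<le> m \<eta>" for \<eta>
  proof (cases "\<eta> = 0 \<or> norm \<eta> < r")
    case True
    have "min d (d * (r / 2) powr s) * min 1 (norm \<eta> powr s) \<le> d * norm \<eta> powr s"
      using d(1) by (intro mult_mono) auto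
    also have "\<dots> \<le> m \<eta>"
      using loc[of \<eta>] m0 True by (cases "\<eta> = 0") auto
    finally show ?thesis .
  next
    case False
    \<comment> \<open>The ray through \<open>\<eta>\<close> is compared at radius
      \<open>r / 2\<close>, which lies strictly inside the punctured ball where the local bounds
      hold.\<close>
    define u where "u = \<eta> /\<^sub>R norm \<eta>"
    have u: "norm u = 1" "norm \<eta> *\<^sub>R u = \<eta>"
      using False by (auto simp: u_def)
    have "min d (d * (r / 2) powr s) * min 1 (norm \<eta> powr s) \<le> d * (r / 2) powr s * 1"
      using d(1) by (intro mult_mono) auto
    also have "\<dots> \<le> m ((r / 2) *\<^sub>R u)"
      using loc[of "(r / 2) *\<^sub>R u"] u(1) r by (cases "u = 0") auto
    also have "\<dots> \<le> m (norm \<eta> *\<^sub>R u)"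
    proof -
      have "Re (F (norm \<eta> *\<^sub>R u)) \<le> Re (F ((r / 2) *\<^sub>R u))"
        using monotone_onD[OF anti[of u], of "r / 2" "norm \<eta>"] r False by auto
      then show ?thesis by (simp add: m_def)
    qed
    finally show ?thesis using u by simp
  qed
  show ?thesis
    unfolding m_def[symmetric]
    by (intro exI[of _ "min d (d * (r / 2) powr s)"] exI[of _ "max c (2 / r powr s)"] conjI allI upper lower)
      (use c(1) d(1) r in auto)
qed

subsection \<open>The minimizer\<close>

text \<open>
  Completing the square under the Fourier transform, the functional equals the squared norm of
  \<open>sqrt (\<psi>\<^sup>2 + m\<^sup>2) (\<hat>u - v)\<close> up to a constant, where \<open>v\<close> is the transform asserted here.
\<close>

lemma fourier_L2_Tikhonov_minimizer:
  fixes \<psi> m :: "'a::euclidean_space \<Rightarrow> real" and A S :: "('a \<Rightarrow> complex) \<Rightarrow> 'a \<Rightarrow> complex"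
  assumes [measurable]: "\<psi> \<in> borel_measurable borel" "m \<in> borel_measurable borel"
    and \<psi>: "\<And>\<xi>. \<bar>\<psi> \<xi>\<bar> \<le> B" and m: "\<And>\<xi>. \<bar>m \<xi>\<bar> \<le> B"
    and c: "0 < c" "\<And>\<xi>. c \<le> (\<psi> \<xi>)\<^sup>2 + (m \<xi>)\<^sup>2"
    and A: "\<And>u. u \<in> L2 \<Longrightarrow> A u \<in> L2"
      "\<And>u. u \<in> L2 \<Longrightarrow> AE \<xi> in lborel. fourier_L2 (A u) \<xi> = complex_of_real (\<psi> \<xi>) * fourier_L2 u \<xi>"
    and S: "\<And>u. u \<in> L2 \<Longrightarrow> S u \<in> L2"
      "\<And>u. u \<in> L2 \<Longrightarrow> AE \<xi> in lborel. fourier_L2 (S u) \<xi> = complex_of_real (1 - m \<xi>) * fourier_L2 u \<xi>"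
    and h: "h \<in> L2"
  defines "u \<equiv> arg_min_on (\<lambda>u. (L2norm (\<lambda>x. A u x - h x))\<^sup>2 + (L2norm (\<lambda>x. u x - S u x))\<^sup>2) L2"
  shows "u \<in> L2"
    and "AE \<xi> in lborel. fourier_L2 u \<xi> = complex_of_real (\<psi> \<xi> / ((\<psi> \<xi>)\<^sup>2 + (m \<xi>)\<^sup>2)) * fourier_L2 h \<xi>"
proof -
  define J where "J u = (L2norm (\<lambda>x. A u x - h x))\<^sup>2 + (L2norm (\<lambda>x. u x - S u x))\<^sup>2" for u
  define D where "D \<xi> = (\<psi> \<xi>)\<^sup>2 + (m \<xi>)\<^sup>2" for \<xi>
  have [measurable]: "D \<in> borel_measurable borel"
    unfolding D_def[abs_def] by measurable
  have D: "0 < D \<xi>" "c \<le> D \<xi>" for \<xi>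
    using c(1) c(2)[of \<xi>] by (auto simp: D_def)
  have B: "0 \<le> B" using order_trans[OF abs_ge_zero \<psi>] by blast
  have DB: "D \<xi> \<le> 2 * B\<^sup>2" for \<xi>
    using power_mono[OF \<psi>[of \<xi>], of 2] power_mono[OF m[of \<xi>], of 2] by (simp add: D_def)
  let ?Fh = "fourier_L2 h"
  note Fh = fourier_L2_L2[OF h]
  note [measurable] = L2_measurable[OF Fh]
  define v where "v \<xi> = complex_of_real (\<psi> \<xi> / D \<xi>) * ?Fh \<xi>" for \<xi>
  have v: "v \<in> L2"
    unfolding v_def
  proof (rule L2_mult_bounded(1)[OF Fh, of _ "B / c"])
    fix \<xi>
    have "\<bar>\<psi> \<xi>\<bar> / D \<xi> \<le> B / c"
      using \<psi>[of \<xi>] D[of \<xi>] c(1) B by (intro frac_le) auto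
    then show "cmod (complex_of_real (\<psi> \<xi> / D \<xi>)) \<le> B / c"
      using D(1)[of \<xi>] by (simp add: norm_divide)
  qed measurable
  note [measurable] = L2_measurable[OF v]
  define w where "w u \<xi> = complex_of_real (sqrt (D \<xi>)) * (fourier_L2 u \<xi> - v \<xi>)" for u \<xi>
  have w: "w u \<in> L2" if "u \<in> L2" for u
    unfolding w_def using that
    by (intro L2_mult_bounded(1)[of _ _ "sqrt (2 * B\<^sup>2)"] L2_diff fourier_L2_L2 v)
      (use D(1) DB in \<open>auto simp: less_imp_le\<close>)
  \<comment> \<open>The part of the functional left over by completing the square; it turns out to
    be its minimum.\<close>
  define \<kappa> where "\<kappa> = (\<integral>\<xi>. (cmod (complex_of_real (m \<xi> / sqrt (D \<xi>)) * ?Fh \<xi>))\<^sup>2 \<partial>lborel)"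
  have \<kappa>int: "(\<lambda>\<xi>. complex_of_real (m \<xi> / sqrt (D \<xi>)) * ?Fh \<xi>) \<in> L2"
  proof (rule L2_mult_bounded(1)[OF Fh, of _ 1])
    fix \<xi>
    have "\<bar>m \<xi>\<bar> = sqrt ((m \<xi>)\<^sup>2)" by simp
    also have "\<dots> \<le> sqrt (D \<xi>)" by (intro real_sqrt_le_mono) (simp add: D_def)
    finally show "cmod (complex_of_real (m \<xi> / sqrt (D \<xi>))) \<le> 1"
      using D(1)[of \<xi>] by (simp add: norm_divide less_imp_le)
  qed measurable
  have square: "(cmod (complex_of_real x * a - b))\<^sup>2 + (cmod (complex_of_real y * a))\<^sup>2
      = (cmod (complex_of_real (sqrt z) * (a - complex_of_real (x / z) * b)))\<^sup>2 + (cmod (complex_of_real (y / sqrt z) * b))\<^sup>2"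
    if z: "z = x\<^sup>2 + y\<^sup>2" "0 < z" for x y z :: real and a b :: complex
  proof -
    \<comment> \<open>The coefficients are real, so the identity is proved for real numbers and
      applied to the real and imaginary parts.\<close>
    have "(x * p - q)\<^sup>2 + (y * p)\<^sup>2 = z * (p - x / z * q)\<^sup>2 + y\<^sup>2 / z * q\<^sup>2" for p q
    proof -
      have "z * (p - x / z * q)\<^sup>2 + y\<^sup>2 / z * q\<^sup>2 = z * p\<^sup>2 - 2 * x * p * q + (x\<^sup>2 + y\<^sup>2) / z * q\<^sup>2"
        using z(2) by (simp add: power2_eq_square field_simps)
      also have "(x\<^sup>2 + y\<^sup>2) / z = 1" unfolding z(1)[symmetric] using z(2) by simp
      finally show ?thesis unfolding z(1) by (simp add: power2_eq_square algebra_simps)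
    qed
    from this[of "Re a" "Re b"] this[of "Im a" "Im b"] show ?thesis
      using z(2) by (simp add: norm_mult power_mult_distrib power_divide)
        (simp add: cmod_power2 power_divide algebra_simps)
  qed
  have J: "J u = (L2norm (w u))\<^sup>2 + \<kappa>" if u: "u \<in> L2" for u
  proof -
    let ?Fu = "fourier_L2 u"
    have [measurable]: "?Fu \<in> borel_measurable borel"
      using fourier_L2_L2[OF u] by auto
    have Fm: "fourier_L2 f \<in> borel_measurable borel" if "f \<in> L2" for f
      using fourier_L2_L2[OF that] by auto
    have 1: "L2norm (\<lambda>x. A u x - h x) = L2norm (\<lambda>\<xi>. complex_of_real (\<psi> \<xi>) * ?Fu \<xi> - ?Fh \<xi>)"
      unfolding L2norm_fourier_L2_diff[OF A(1)[OF u] h, symmetric]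
    proof (intro L2norm_cong_AE borel_measurable_diff Fm A u h)
      show "AE \<xi> in lborel. fourier_L2 (A u) \<xi> - ?Fh \<xi> = complex_of_real (\<psi> \<xi>) * ?Fu \<xi> - ?Fh \<xi>"
        using A(2)[OF u] by eventually_elim simp
    qed measurable
    have 2: "L2norm (\<lambda>x. u x - S u x) = L2norm (\<lambda>\<xi>. complex_of_real (m \<xi>) * ?Fu \<xi>)"
      unfolding L2norm_fourier_L2_diff[OF u S(1)[OF u], symmetric]
    proof (intro L2norm_cong_AE borel_measurable_diff Fm S u)
      show "AE \<xi> in lborel. fourier_L2 u \<xi> - fourier_L2 (S u) \<xi> = complex_of_real (m \<xi>) * fourier_L2 u \<xi>"
        using S(2)[OF u] by eventually_elim (simp add: algebra_simps)
    qed measurable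
    have \<psi>L2: "(\<lambda>\<xi>. complex_of_real (\<psi> \<xi>) * ?Fu \<xi> - ?Fh \<xi>) \<in> L2"
      by (intro L2_diff L2_mult_bounded(1)[of _ _ B] fourier_L2_L2 u h) (use \<psi> in auto)
    have mL2: "(\<lambda>\<xi>. complex_of_real (m \<xi>) * ?Fu \<xi>) \<in> L2"
      by (intro L2_mult_bounded(1)[of _ _ B] fourier_L2_L2 u h) (use m in auto)
    have "J u = (\<integral>\<xi>. (cmod (complex_of_real (\<psi> \<xi>) * ?Fu \<xi> - ?Fh \<xi>))\<^sup>2 + (cmod (complex_of_real (m \<xi>) * ?Fu \<xi>))\<^sup>2 \<partial>lborel)"
      unfolding J_def 1 2 L2norm_square
      by (intro Bochner_Integration.integral_add[symmetric] L2_integrable_square \<psi>L2 mL2)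
    also have "\<dots> = (\<integral>\<xi>. (cmod (w u \<xi>))\<^sup>2 + (cmod (complex_of_real (m \<xi> / sqrt (D \<xi>)) * ?Fh \<xi>))\<^sup>2 \<partial>lborel)"
      unfolding w_def v_def by (intro Bochner_Integration.integral_cong refl square D(1)) (simp add: D_def)
    also have "\<dots> = (L2norm (w u))\<^sup>2 + \<kappa>"
      unfolding L2norm_square \<kappa>_def
      by (intro Bochner_Integration.integral_add L2_integrable_square w u \<kappa>int)
    finally show ?thesis .
  qed
  \<comment> \<open>Surjectivity of the transform realizes the pointwise optimum \<open>v\<close>,
    so a minimizer exists.\<close>
  obtain u0 where u0: "u0 \<in> L2" "AE \<xi> in lborel. fourier_L2 u0 \<xi> = v \<xi>"
    using fourier_L2_surj[OF v] by blast
  have Ju0: "J u0 = \<kappa>"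
  proof -
    have "L2norm (w u0) = L2norm (\<lambda>\<xi>::'a. 0)"
    proof (rule L2norm_cong_AE)
      show "AE \<xi> in lborel. w u0 \<xi> = 0"
        using u0(2) by eventually_elim (simp add: w_def)
    qed (use w[OF u0(1)] in auto)
    then show ?thesis using J[OF u0(1)] by simp
  qed
  have min: "is_arg_min J (\<lambda>u. u \<in> L2) u0"
    using J Ju0 u0(1) by (auto simp: is_arg_min_linorder)
  \<comment> \<open>Existence makes the choice in \<open>arg_min_on\<close> meaningful. Whichever
    minimizer it selects must annihilate the square, which fixes its transform almost
    everywhere.\<close>
  have "is_arg_min J (\<lambda>u. u \<in> L2) u"
    unfolding u_def arg_min_on_def arg_min_def J_def[symmetric] by (rule someI[of "is_arg_min J (\<lambda>u. u \<in> L2)", OF min])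
  then have u: "u \<in> L2" and "J u \<le> J u0"
    using u0(1) by (auto simp: is_arg_min_linorder)
  then have "(L2norm (w u))\<^sup>2 \<le> 0"
    using J[OF u] Ju0 by simp
  then have "AE \<xi> in lborel. w u \<xi> = 0"
    by (intro AE_eq_0_if_L2norm_eq_0 w u) simp
  then show "AE \<xi> in lborel. fourier_L2 u \<xi> = complex_of_real (\<psi> \<xi> / ((\<psi> \<xi>)\<^sup>2 + (m \<xi>)\<^sup>2)) * fourier_L2 h \<xi>"
  proof eventually_elim
    case (elim \<xi>)
    then show ?case using D(1)[of \<xi>] by (simp add: w_def v_def D_def[symmetric])
  qed
  show "u \<in> L2" by (rule u)
qed

subsection \<open>The parameter choice\<close>

text \<open>The substitution t = exp (-z) maps the positive half-line onto the unit interval and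
  turns \<open>Theta q\<close> into a product of two decreasing positive factors.\<close>

lemma Theta_exp: "Theta q (exp (- z)) = exp (- z / 2) * z powr (- q)"
proof -
  have "sqrt (exp (- z)) = exp (- z / 2)"
    by (rule real_sqrt_unique) (simp_all flip: exp_double)
  then show ?thesis by (simp add: Theta_def f_log_def)
qed

lemma Theta_exp_strict_antimono:
  assumes "0 < q" "0 < y" "y < z"
  shows "Theta q (exp (- z)) < Theta q (exp (- y))"
  unfolding Theta_exp using assms
  by (intro mult_strict_mono) (auto simp: powr_minus intro!: powr_less_mono2 less_imp_inverse_less)

lemma Theta_exp_surj:
  assumes "0 < q" "0 < x"
  shows "\<exists>z>0. Theta q (exp (- z)) = x"
proof -
  \<comment> \<open>Endpoints for the intermediate value theorem. At \<open>z1\<close> the power is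
    at least \<open>2 * x\<close> and the exponential at least 1/2; at \<open>z2\<close> the
    exponential is at most \<open>x\<close> and the power at most 1.\<close>
  define z1 where "z1 = min 1 ((2 * x) powr (- (1 / q)))"
  define z2 where "z2 = max 1 (2 * (- ln x))"
  have z: "0 < z1" "z1 \<le> z2"
    using assms by (auto simp: z1_def z2_def)
  have "2 * x = ((2 * x) powr (- (1 / q))) powr (- q)"
    using assms by (simp add: powr_powr)
  also have "\<dots> \<le> z1 powr (- q)"
    using assms z by (intro powr_mono2') (auto simp: z1_def)
  finally have 1: "2 * x \<le> z1 powr (- q)" .
  have "1 / 2 \<le> exp (- z1 / 2)"
    using exp_ge_add_one_self[of "- z1 / 2"] by (simp add: z1_def)
  then have hi: "x \<le> exp (- z1 / 2) * z1 powr (- q)"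
    using mult_mono[OF _ 1, of "1 / 2" "exp (- z1 / 2)"] assms by simp
  have "z2 powr (- q) \<le> 1 powr (- q)"
    using assms by (intro powr_mono2') (auto simp: z2_def)
  moreover have "exp (- z2 / 2) \<le> exp (ln x)"
    by (simp only: exp_le_cancel_iff) (simp add: z2_def)
  ultimately have lo: "exp (- z2 / 2) * z2 powr (- q) \<le> x"
    using mult_mono[of "exp (- z2 / 2)" x "z2 powr (- q)" 1] assms by simp
  have "\<exists>z. z1 \<le> z \<and> z \<le> z2 \<and> exp (- z / 2) * z powr (- q) = x"
    using z by (intro IVT2'[where f="\<lambda>z. exp (- z / 2) * z powr (- q)", OF lo hi]) (auto intro!: continuous_intros)
  then show ?thesis
    unfolding Theta_exp using z(1) less_le_trans[of 0 z1] by blast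
qed

lemma Theta_inj: "0 < q \<Longrightarrow> inj_on (Theta q) {0<..<1}"
proof (rule inj_onI)
  fix s t assume q: "0 < q" and "s \<in> {0<..<1::real}" "t \<in> {0<..<1::real}" and eq: "Theta q s = Theta q t"
  then have "s = exp (- (- ln s))" "t = exp (- (- ln t))" "0 < - ln s" "0 < - ln t"
    by auto
  then show "s = t"
    using Theta_exp_strict_antimono[OF q, of "- ln s" "- ln t"] Theta_exp_strict_antimono[OF q, of "- ln t" "- ln s"] eq
    by (metis less_irrefl linorder_neqE_linordered_idom)
qed

lemma Theta_inv_exp:
  assumes "0 < q" "0 < x"
  shows "\<exists>z>0. Theta_inv q x = exp (- z) \<and> exp (- z / 2) * z powr (- q) = x"
proof -
  obtain z where z: "z > 0" "Theta q (exp (- z)) = x"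
    using Theta_exp_surj[OF assms] by blast
  then have "Theta_inv q x = exp (- z)"
    using the_inv_into_f_f[OF Theta_inj[OF assms(1)], of "exp (- z)"] by (simp add: Theta_inv_def)
  then show ?thesis using z by (auto simp: Theta_exp)
qed

lemma Theta_inv_eventually:
  assumes "0 < q" and P: "\<forall>\<^sub>F z in at_top. P z"
  shows "\<forall>\<^sub>F x in at_right 0. \<exists>z. P z \<and> 0 < z \<and> Theta_inv q x = exp (- z) \<and> exp (- z / 2) * z powr (- q) = x"
proof -
  obtain N where N: "\<And>z. z \<ge> N \<Longrightarrow> P z"
    using P by (auto simp: eventually_at_top_linorder)
  define M where "M = max N 1"
  have M: "M > 0" "\<And>z. z \<ge> M \<Longrightarrow> P z"
    using N by (auto simp: M_def)
  \<comment> \<open>Since \<open>Theta q (exp (- z))\<close> decreases in \<open>z\<close>, a value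
    below the one at \<open>M\<close> forces \<open>z\<close> to be at least
    \<open>M\<close>.\<close>
  have "\<forall>\<^sub>F x in at_right 0. 0 < x \<and> x < Theta q (exp (- M))"
    using eventually_at_right_real[of 0 "Theta q (exp (- M))"] M by (simp add: Theta_exp)
  then show ?thesis
  proof eventually_elim
    case (elim x)
    then obtain z where z: "z > 0" "Theta_inv q x = exp (- z)" "exp (- z / 2) * z powr (- q) = x"
      using Theta_inv_exp[OF assms(1)] by blast
    have "M \<le> z"
      using Theta_exp_strict_antimono[OF assms(1) z(1), of M] elim z(3) unfolding Theta_exp by linarith
    then show ?case using M z by blast
  qed
qed

text \<open>With \<open>x = \<delta> / \<rho>\<close> this compares \<open>f_log q\<close> at \<open>Theta_inv q x\<close> with \<open>f_log q\<close> at \<open>x\<^sup>2\<close>.\<close>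

lemma f_log_square_ge:
  assumes "0 < q" "1 \<le> z" "2 * q * ln z \<le> z"
  shows "z powr (- q) \<le> 2 powr q * f_log q ((exp (- z / 2) * z powr (- q))\<^sup>2)"
proof -
  have "ln ((exp (- z / 2) * z powr (- q))\<^sup>2) = - (z + 2 * q * ln z)"
    using assms by (simp add: ln_realpow ln_mult ln_powr)
  then have "f_log q ((exp (- z / 2) * z powr (- q))\<^sup>2) = (z + 2 * q * ln z) powr (- q)"
    by (simp only: f_log_def minus_minus)
  \<comment> \<open>The assumption on \<open>2 * q * ln z\<close> bounds the sum by
    \<open>2 * z\<close>; this is the origin of the factor \<open>2 powr q\<close>.\<close>
  moreover have "(2 * z) powr (- q) \<le> (z + 2 * q * ln z) powr (- q)"
    using assms by (intro powr_mono2') (auto intro!: add_pos_nonneg)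
  moreover have "(2 * z) powr (- q) = 2 powr (- q) * z powr (- q)"
    using assms by (simp add: powr_mult)
  moreover have "2 powr q * 2 powr (- q) = (1::real)"
    by (simp flip: powr_add)
  ultimately show ?thesis
    by (metis (no_types, opaque_lifting) mult.assoc mult_1 mult_left_mono powr_ge_zero)
qed

subsection \<open>The convergence rate\<close>

text \<open>A vanishing integral would make the integrand zero almost everywhere and hence the
  interval a null set.\<close>

lemma set_integral_pos:
  fixes \<gamma> :: "real \<Rightarrow> real"
  assumes "0 < T" "\<And>l. l \<in> {0<..<T} \<Longrightarrow> 0 < \<gamma> l" "set_integrable lborel {0<..<T} \<gamma>"
  shows "0 < (LINT l:{0<..<T}|lborel. \<gamma> l)"
proof -
  let ?f = "\<lambda>l. indicator {0<..<T} l *\<^sub>R \<gamma> l"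
  have int: "integrable lborel ?f"
    using assms(3) by (simp add: set_integrable_def)
  have nn: "AE l in lborel. 0 \<le> ?f l"
    using assms(2) by (intro AE_I2) (auto simp: indicator_def less_imp_le)
  have "(\<integral>l. ?f l \<partial>lborel) \<noteq> 0"
  proof
    assume "(\<integral>l. ?f l \<partial>lborel) = 0"
    then have "AE l in lborel. ?f l = 0"
      using integral_nonneg_eq_0_iff_AE[OF int nn] by simp
    then have "AE l in lborel. l \<notin> {0<..<T}"
      by eventually_elim (use assms(2) in \<open>force simp: indicator_def\<close>)
    then have "emeasure lborel {0<..<T} = 0"
      by (subst (asm) AE_iff_measurable[of "{0<..<T}"]) auto
    then show False using assms(1) by simp
  qed
  then show ?thesis
    unfolding set_lebesgue_integral_def using integral_nonneg_AE[OF nn] by linarith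
qed

lemma borel_measurable_heat_symbol [measurable]: "heat_symbol \<gamma> T \<tau> \<in> borel_measurable borel"
  unfolding heat_symbol_def[abs_def] by measurable

text \<open>The two symbols are needed in different ways: the noise symbol is bounded uniformly, the
  bias symbol only relative to a weight \<open>w\<close> that the exact solution can absorb.\<close>

lemma L2norm_regularization_error:
  fixes \<psi> m w :: "'a::euclidean_space \<Rightarrow> real"
  assumes [measurable]: "\<psi> \<in> borel_measurable borel" "m \<in> borel_measurable borel" "w \<in> borel_measurable borel"
    and D: "\<And>\<xi>. 0 < (\<psi> \<xi>)\<^sup>2 + (m \<xi>)\<^sup>2"
    and N: "\<And>\<xi>. \<bar>\<psi> \<xi>\<bar> / ((\<psi> \<xi>)\<^sup>2 + (m \<xi>)\<^sup>2) \<le> N"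
    and \<kappa>: "0 \<le> \<kappa>" "\<And>\<xi>. (m \<xi>)\<^sup>2 / ((\<psi> \<xi>)\<^sup>2 + (m \<xi>)\<^sup>2) \<le> \<kappa> * w \<xi>"
    and L2: "v \<in> L2" "u \<in> L2" "g \<in> L2" "h \<in> L2" and wL2: "(\<lambda>\<xi>. complex_of_real (w \<xi>) * fourier_L2 v \<xi>) \<in> L2"
    and g: "AE \<xi> in lborel. fourier_L2 g \<xi> = complex_of_real (\<psi> \<xi>) * fourier_L2 v \<xi>"
    and u: "AE \<xi> in lborel. fourier_L2 u \<xi> = complex_of_real (\<psi> \<xi> / ((\<psi> \<xi>)\<^sup>2 + (m \<xi>)\<^sup>2)) * fourier_L2 h \<xi>"
  shows "L2norm (\<lambda>x. v x - u x)
      \<le> \<kappa> * L2norm (\<lambda>\<xi>. complex_of_real (w \<xi>) * fourier_L2 v \<xi>) + N * L2norm (\<lambda>x. g x - h x)"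
proof -
  define D where "D \<xi> = (\<psi> \<xi>)\<^sup>2 + (m \<xi>)\<^sup>2" for \<xi>
  note assms' = D[folded D_def] N[folded D_def] \<kappa>(2)[folded D_def]
  have [measurable]: "D \<in> borel_measurable borel"
    unfolding D_def[abs_def] by measurable
  note F = L2[THEN fourier_L2_L2]
  note [measurable] = F[THEN L2_measurable]
  let ?b = "\<lambda>\<xi>. complex_of_real ((m \<xi>)\<^sup>2 / D \<xi>) * fourier_L2 v \<xi>"
  let ?n = "\<lambda>\<xi>. complex_of_real (\<psi> \<xi> / D \<xi>) * (fourier_L2 g \<xi> - fourier_L2 h \<xi>)"
  have b: "?b \<in> L2" "L2norm ?b \<le> \<kappa> * L2norm (\<lambda>\<xi>. complex_of_real (w \<xi>) * fourier_L2 v \<xi>)"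
  proof -
    have "cmod (?b \<xi>) \<le> \<kappa> * cmod (complex_of_real (w \<xi>) * fourier_L2 v \<xi>)" for \<xi>
    proof -
      have "cmod (?b \<xi>) = (m \<xi>)\<^sup>2 / D \<xi> * cmod (fourier_L2 v \<xi>)"
        using assms'(1)[of \<xi>] by (simp add: norm_mult norm_divide norm_power)
      also have "\<dots> \<le> \<kappa> * \<bar>w \<xi>\<bar> * cmod (fourier_L2 v \<xi>)"
        using assms'(3)[of \<xi>] \<kappa>(1) by (intro mult_right_mono order_trans[OF assms'(3)] mult_left_mono) auto
      finally show ?thesis by (simp add: norm_mult mult_ac)
    qed
    then show "?b \<in> L2" "L2norm ?b \<le> \<kappa> * L2norm (\<lambda>\<xi>. complex_of_real (w \<xi>) * fourier_L2 v \<xi>)"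
      using L2_dominated[OF _ wL2 \<kappa>(1), of ?b] by auto
  qed
  have n: "?n \<in> L2" "L2norm ?n \<le> N * L2norm (\<lambda>\<xi>. fourier_L2 g \<xi> - fourier_L2 h \<xi>)"
  proof -
    have "cmod (complex_of_real (\<psi> \<xi> / D \<xi>)) \<le> N" for \<xi>
      using assms'(1,2)[of \<xi>] by (simp add: norm_divide)
    then show "?n \<in> L2" "L2norm ?n \<le> N * L2norm (\<lambda>\<xi>. fourier_L2 g \<xi> - fourier_L2 h \<xi>)"
      using L2_mult_bounded[OF L2_diff[OF F(3,4)], of "\<lambda>\<xi>. complex_of_real (\<psi> \<xi> / D \<xi>)" N] by auto
  qed
  have "AE \<xi> in lborel. fourier_L2 v \<xi> - fourier_L2 u \<xi> = ?b \<xi> + ?n \<xi>"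
    using g u
  proof eventually_elim
    case (elim \<xi>)
    have "1 - \<psi> \<xi> / D \<xi> * \<psi> \<xi> = (m \<xi>)\<^sup>2 / D \<xi>"
      using assms'(1)[of \<xi>] by (simp add: divide_simps) (simp add: D_def power2_eq_square)
    then have "1 - complex_of_real (\<psi> \<xi> / D \<xi>) * complex_of_real (\<psi> \<xi>) = complex_of_real ((m \<xi>)\<^sup>2 / D \<xi>)"
      by (metis of_real_1 of_real_diff of_real_mult)
    from this[symmetric] have "?b \<xi> + ?n \<xi> = fourier_L2 v \<xi> - complex_of_real (\<psi> \<xi> / D \<xi>) * fourier_L2 h \<xi>"
      unfolding elim(1) by (simp only: left_diff_distrib right_diff_distrib mult_1 mult.assoc) simp
    then show ?case by (simp only: elim(2) D_def)
  qed
  then have "L2norm (\<lambda>\<xi>. fourier_L2 v \<xi> - fourier_L2 u \<xi>) = L2norm (\<lambda>\<xi>. ?b \<xi> + ?n \<xi>)"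
    by (intro L2norm_cong_AE) auto
  also have "\<dots> \<le> L2norm ?b + L2norm ?n"
    by (rule L2norm_triangle[OF b(1) n(1)])
  finally show ?thesis
    using b(2) n(2) by (simp add: L2norm_fourier_L2_diff L2)
qed

section \<open>Pointwise bounds for the symbols\<close>

text \<open>Here \<open>r\<close> is the norm of the frequency, \<open>\<mu>\<close> the value of m
  there, and \<open>exp (- z / 2)\<close> stands for \<open>\<beta> powr s\<close>. The smallness
  premise of the bias bound involves \<open>z\<close> only, so it can be met uniformly in the
  frequency.\<close>

lemma
  fixes r z \<mu> s \<tau> p c1 c2 G :: real
  assumes pos: "0 < c1" "0 < c2" "0 < s" "0 < \<tau>" "0 < p" "0 < G" "0 \<le> r" "0 < z"
  defines "\<psi> \<equiv> exp (- ((2 * pi * r) powr (2 * \<tau>) * G))"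
  assumes \<mu>: "c1 * min 1 (exp (- z / 2) * r powr s) \<le> \<mu>" "\<mu> \<le> c2 * (exp (- z / 2) * r powr s)"
  shows symbol_lower_bound:
      "min ((c1 * exp (- z / 2))\<^sup>2) ((exp (- ((2 * pi) powr (2 * \<tau>) * G)))\<^sup>2) \<le> \<psi>\<^sup>2 + \<mu>\<^sup>2"
    and noise_symbol_bound:
      "\<bar>\<psi>\<bar> / (\<psi>\<^sup>2 + \<mu>\<^sup>2) \<le> (1 / (2 * c1) + exp ((2 * pi) powr (2 * \<tau>) * G)) * exp (z / 2)"
    and bias_symbol_bound:
      "c2\<^sup>2 * ((4 * G) powr (- (s / \<tau>)) * (2 * pi) powr (- (2 * s))) * (exp (- z / 2) * z powr (s / \<tau> + p / (2 * \<tau>))) \<le> 1 \<Longrightarrow>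
        \<mu>\<^sup>2 / (\<psi>\<^sup>2 + \<mu>\<^sup>2)
          \<le> ((4 * G) powr (p / (2 * \<tau>)) * (2 * pi) powr p + 1) * z powr (- (p / (2 * \<tau>))) * (1 + r\<^sup>2) powr (p / 2)"
proof -
  have \<psi>: "0 < \<psi>" by (simp add: \<psi>_def)
  then have D: "0 < \<psi>\<^sup>2 + \<mu>\<^sup>2" by (simp add: add_pos_nonneg)
  have \<mu>0: "0 \<le> \<mu>"
    using order_trans[OF _ \<mu>(1)] pos by simp
  let ?k = "exp (- ((2 * pi) powr (2 * \<tau>) * G))"
  have far: "c1 * exp (- z / 2) \<le> \<mu>" if "1 \<le> r"
  proof -
    have "exp (- z / 2) * 1 \<le> exp (- z / 2) * r powr s"
      using that pos by (intro mult_left_mono ge_one_powr_ge_zero) auto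
    moreover have "exp (- z / 2) \<le> 1" using pos by simp
    ultimately have "c1 * exp (- z / 2) \<le> c1 * min 1 (exp (- z / 2) * r powr s)"
      using pos by (intro mult_left_mono) auto
    with \<mu>(1) show ?thesis by linarith
  qed
  have near: "?k \<le> \<psi>" if "r < 1"
  proof -
    have "(2 * pi * r) powr (2 * \<tau>) \<le> (2 * pi) powr (2 * \<tau>)"
      using that pos by (intro powr_mono2) (auto simp: mult_le_cancel_left1)
    then show ?thesis
      using pos by (simp add: \<psi>_def mult_right_mono)
  qed
  show "min ((c1 * exp (- z / 2))\<^sup>2) (?k\<^sup>2) \<le> \<psi>\<^sup>2 + \<mu>\<^sup>2"
  proof (cases "1 \<le> r")
    case True
    have "(c1 * exp (- z / 2))\<^sup>2 \<le> \<mu>\<^sup>2"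
      using far[OF True] pos by (intro power_mono) auto
    then show ?thesis by (intro min.coboundedI1) (simp add: add_increasing)
  next
    case False
    have "?k\<^sup>2 \<le> \<psi>\<^sup>2"
      using near False by (intro power_mono) auto
    then show ?thesis by (intro min.coboundedI2) (simp add: add_increasing2)
  qed
  have e1: "1 \<le> exp (z / 2)" using pos by simp
  show "\<bar>\<psi>\<bar> / (\<psi>\<^sup>2 + \<mu>\<^sup>2) \<le> (1 / (2 * c1) + exp ((2 * pi) powr (2 * \<tau>) * G)) * exp (z / 2)"
  proof (cases "1 \<le> r")
    case True
    have \<mu>pos: "0 < c1 * exp (- z / 2)" using pos by simp
    \<comment> \<open>The arithmetic-geometric inequality makes the quotient at most 1 / (2 \<mu>),
      whence the constant \<open>1 / (2 * c1)\<close>.\<close>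
    have "\<psi> * (2 * (c1 * exp (- z / 2))) \<le> 2 * \<psi> * \<mu>"
      using far[OF True] \<psi> by simp
    also have "\<dots> \<le> \<psi>\<^sup>2 + \<mu>\<^sup>2" by (rule sum_squares_bound)
    finally have "\<psi> / (\<psi>\<^sup>2 + \<mu>\<^sup>2) \<le> 1 / (2 * (c1 * exp (- z / 2)))"
      using D \<mu>pos by (simp add: divide_simps)
    also have "\<dots> = 1 / (2 * c1) * exp (z / 2)"
      using pos by (simp add: exp_minus divide_simps)
    also have "\<dots> \<le> (1 / (2 * c1) + exp ((2 * pi) powr (2 * \<tau>) * G)) * exp (z / 2)"
      by (intro mult_right_mono) auto
    finally show ?thesis using \<psi> by simp
  next
    case False
    have "\<psi> / (\<psi>\<^sup>2 + \<mu>\<^sup>2) \<le> \<psi> / \<psi>\<^sup>2"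
      using \<psi> D by (intro divide_left_mono) auto
    also have "\<dots> = 1 / \<psi>" using \<psi> by (simp add: power2_eq_square)
    also have "\<dots> \<le> 1 / ?k"
      using near False \<psi> by (intro divide_left_mono) auto
    also have "\<dots> = exp ((2 * pi) powr (2 * \<tau>) * G) * 1"
      by (simp add: exp_minus inverse_eq_divide)
    also have "\<dots> \<le> (1 / (2 * c1) + exp ((2 * pi) powr (2 * \<tau>) * G)) * exp (z / 2)"
      using e1 pos by (intro mult_mono) auto
    finally show ?thesis using \<psi> by simp
  qed
  let ?q = "p / (2 * \<tau>)" and ?W = "(4 * G) powr (- (s / \<tau>)) * (2 * pi) powr (- (2 * s))" and ?R = "2 * pi * r"
  let ?KB = "(4 * G) powr ?q * (2 * pi) powr p"
  assume small: "c2\<^sup>2 * ?W * (exp (- z / 2) * z powr (s / \<tau> + ?q)) \<le> 1"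
  show "\<mu>\<^sup>2 / (\<psi>\<^sup>2 + \<mu>\<^sup>2) \<le> (?KB + 1) * z powr (- ?q) * (1 + r\<^sup>2) powr (p / 2)"
  \<comment> \<open>Equality holds exactly where the square of \<open>\<psi>\<close> equals
    \<open>exp (- z / 2)\<close>. At the higher frequencies the symbol is merely bounded by 1 and
    the Sobolev weight supplies the decay in \<open>z\<close>.\<close>
  proof (cases "z \<le> 4 * G * ?R powr (2 * \<tau>)")
    case True
    have "z powr ?q \<le> (4 * G * ?R powr (2 * \<tau>)) powr ?q"
      using True pos by (intro powr_mono2) auto
    also have "\<dots> = ?KB * r powr p"
      using pos by (simp add: powr_mult powr_powr)
    also have "r powr p \<le> (1 + r\<^sup>2) powr (p / 2)"
    proof -
      have "r powr p = (r\<^sup>2) powr (p / 2)"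
        using pos by (cases "r = 0") (simp_all add: powr_powr flip: powr_numeral)
      also have "\<dots> \<le> (1 + r\<^sup>2) powr (p / 2)"
        using pos by (intro powr_mono2) auto
      finally show ?thesis .
    qed
    finally have "z powr ?q \<le> (?KB + 1) * (1 + r\<^sup>2) powr (p / 2)"
      by (simp add: distrib_right add_increasing2 mult_left_mono)
    then have "z powr (- ?q) * z powr ?q \<le> z powr (- ?q) * ((?KB + 1) * (1 + r\<^sup>2) powr (p / 2))"
      by (intro mult_left_mono) auto
    moreover have "z powr (- ?q) * z powr ?q = 1"
      using pos by (simp flip: powr_add)
    moreover have "\<mu>\<^sup>2 / (\<psi>\<^sup>2 + \<mu>\<^sup>2) \<le> 1"
      using D by (simp add: divide_simps)
    ultimately show ?thesis by (simp add: mult_ac)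
  next
    case False
    then have R: "?R powr (2 * \<tau>) \<le> z / (4 * G)"
      using pos by (simp add: field_simps)
    have "exp (- z / 2) \<le> \<psi>\<^sup>2"
    proof -
      have "\<psi>\<^sup>2 = exp (- (2 * (?R powr (2 * \<tau>) * G)))"
        by (simp add: \<psi>_def flip: exp_double)
      moreover have "2 * (?R powr (2 * \<tau>) * G) \<le> z / 2"
        using False by (simp add: mult_ac)
      ultimately show ?thesis by simp
    qed
    then have \<psi>D: "exp (- z / 2) \<le> \<psi>\<^sup>2 + \<mu>\<^sup>2" by (simp add: add_increasing2)
    have "r powr (2 * s) = (2 * pi) powr (- (2 * s)) * ?R powr (2 * s)"
      using pos by (simp add: powr_mult powr_minus field_simps)
    also have "?R powr (2 * s) = (?R powr (2 * \<tau>)) powr (s / \<tau>)"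
      using pos by (simp add: powr_powr)
    also have "\<dots> \<le> (z / (4 * G)) powr (s / \<tau>)"
      using R pos by (intro powr_mono2) auto
    also have "(z / (4 * G)) powr (s / \<tau>) = (4 * G) powr (- (s / \<tau>)) * z powr (s / \<tau>)"
      using pos by (simp add: powr_divide powr_minus field_simps)
    \<comment> \<open>\<open>?W\<close> gathers the constants incurred by trading the bounded
      frequency for a power of \<open>z\<close>.\<close>
    finally have rs: "r powr (2 * s) \<le> ?W * z powr (s / \<tau>)"
      by (simp add: mult_ac)
    have "\<mu>\<^sup>2 \<le> (c2 * (exp (- z / 2) * r powr s))\<^sup>2"
      using \<mu>(2) \<mu>0 by (intro power_mono)
    \<comment> \<open>One factor \<open>exp (- z / 2)\<close> is spent on the denominator, the other
      is kept to beat the power of \<open>z\<close>.\<close>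
    also have "\<dots> = c2\<^sup>2 * exp (- z / 2) * r powr (2 * s) * exp (- z / 2)"
      by (simp add: power2_eq_square mult_ac flip: powr_add)
    also have "\<dots> \<le> c2\<^sup>2 * exp (- z / 2) * (?W * z powr (s / \<tau>)) * exp (- z / 2)"
      by (intro mult_right_mono mult_left_mono rs) auto
    also have "\<dots> \<le> c2\<^sup>2 * exp (- z / 2) * (?W * z powr (s / \<tau>)) * (\<psi>\<^sup>2 + \<mu>\<^sup>2)"
      by (intro mult_left_mono \<psi>D) auto
    finally have "\<mu>\<^sup>2 / (\<psi>\<^sup>2 + \<mu>\<^sup>2) \<le> c2\<^sup>2 * exp (- z / 2) * (?W * z powr (s / \<tau>))"
      using D by (simp add: divide_le_eq)
    \<comment> \<open>The power of \<open>z\<close> is enlarged by \<open>?q\<close> inside the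
      small factor and compensated outside, which exposes the rate
      \<open>z powr (- ?q)\<close>.\<close>
    also have "\<dots> = c2\<^sup>2 * ?W * (exp (- z / 2) * z powr (s / \<tau> + ?q)) * z powr (- ?q)"
    proof -
      have "z powr (s / \<tau> + ?q) * z powr (- ?q) = z powr (s / \<tau>)"
        by (simp flip: powr_add)
      then show ?thesis by (simp only: mult.assoc) (simp only: mult.left_commute)
    qed
    also have "\<dots> \<le> 1 * z powr (- ?q)"
      by (intro mult_right_mono small) auto
    also have "\<dots> \<le> (?KB + 1) * z powr (- ?q) * 1"
      by (simp add: distrib_right)
    also have "\<dots> \<le> (?KB + 1) * z powr (- ?q) * (1 + r\<^sup>2) powr (p / 2)"
      using pos by (intro mult_left_mono ge_one_powr_ge_zero) (auto intro!: add_nonneg_nonneg mult_nonneg_nonneg)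
    finally show ?thesis .
  qed
qed

lemma Sobolev_weight:
  assumes "v \<in> Sobolev p"
  shows "(\<lambda>\<xi>. complex_of_real ((1 + (norm \<xi>)\<^sup>2) powr (p / 2)) * fourier_L2 v \<xi>) \<in> L2"
    and "L2norm (\<lambda>\<xi>. complex_of_real ((1 + (norm \<xi>)\<^sup>2) powr (p / 2)) * fourier_L2 v \<xi>) = Sobolev_norm p v"
proof -
  have v: "v \<in> L2" and int: "integrable lborel (\<lambda>\<xi>. (1 + (norm \<xi>)\<^sup>2) powr p * (cmod (fourier_L2 v \<xi>))\<^sup>2)"
    using assms by (auto simp: Sobolev_def)
  note [measurable] = L2_measurable[OF fourier_L2_L2[OF v]]
  have *: "(cmod (complex_of_real ((1 + (norm \<xi>)\<^sup>2) powr (p / 2)) * fourier_L2 v \<xi>))\<^sup>2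
      = (1 + (norm \<xi>)\<^sup>2) powr p * (cmod (fourier_L2 v \<xi>))\<^sup>2" for \<xi>
    by (simp add: norm_mult power_mult_distrib power2_eq_square flip: powr_add)
  show "(\<lambda>\<xi>. complex_of_real ((1 + (norm \<xi>)\<^sup>2) powr (p / 2)) * fourier_L2 v \<xi>) \<in> L2"
    using int unfolding L2_def mem_Collect_eq * by (intro conjI) measurable
  show "L2norm (\<lambda>\<xi>. complex_of_real ((1 + (norm \<xi>)\<^sup>2) powr (p / 2)) * fourier_L2 v \<xi>) = Sobolev_norm p v"
    unfolding L2norm_def Sobolev_norm_def * ..
qed

theorem theorem2:
  fixes \<gamma> :: "real \<Rightarrow> real" and \<phi> :: "real ^ 'n \<Rightarrow> real" and T \<tau> s p q C :: real
  assumes "0 < T" and "0 < \<tau>" and "\<tau> \<le> 1"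
    and "\<And>l. l \<in> {0<..<T} \<Longrightarrow> 0 < \<gamma> l"
    and "set_integrable lborel {0<..<T} \<gamma>"
    and "0 < s" and "mollifier_kernel s \<phi>"
    and "0 < p" and "q = p / (2 * \<tau>)"
    and "0 < C"
    and "\<And>E v. 0 < E \<Longrightarrow> v \<in> Sobolev p \<Longrightarrow> Sobolev_norm p v \<le> E \<Longrightarrow>
           \<exists>w \<in> L2. (AE x in lborel. v (x :: real ^ 'n) = source_op \<gamma> T \<tau> q w x) \<and> L2norm w \<le> C * E"
  shows "\<exists>K>0. \<forall>E>0. \<forall>\<rho>. \<rho> = C * E \<longrightarrow>
     (\<exists>\<epsilon> \<in> o[at_right 0](\<lambda>_. 1 :: real). \<forall>\<^sub>F \<delta> in at_right 0.
        \<forall>u0 g g\<delta>. u0 \<in> Sobolev p \<and> Sobolev_norm p u0 \<le> E \<and> g = heat_op \<gamma> T \<tau> u0 \<and>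
          g\<delta> \<in> L2 \<and> L2norm (\<lambda>x. g x - g\<delta> x) \<le> \<delta> \<longrightarrow>
          L2norm (\<lambda>x. u0 x - regularized \<gamma> T \<tau> \<phi> (Theta_inv q (\<delta> / \<rho>) powr (1 / (2 * s))) g\<delta> x)
            \<le> K * \<rho> * f_log q (\<delta>\<^sup>2 / \<rho>\<^sup>2) * (1 + \<epsilon> \<delta>))"
proof -
  define G where "G = (LINT l:{0<..<T}|lborel. \<gamma> l)"
  have G: "0 < G"
    unfolding G_def by (rule set_integral_pos) (use assms in auto)
  have q: "0 < q" using assms(2,8,9) by simp
  let ?F = "fourier (\<lambda>x. complex_of_real (\<phi> x))"
  let ?\<psi> = "heat_symbol \<gamma> T \<tau> :: real ^ 'n \<Rightarrow> real"
  have \<psi>_eq: "?\<psi> \<xi> = exp (- ((2 * pi * norm \<xi>) powr (2 * \<tau>) * G))" for \<xi>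
    by (simp add: heat_symbol_def G_def)
  have \<psi>_le: "\<bar>?\<psi> \<xi>\<bar> \<le> 1" for \<xi>
    using G by (simp add: \<psi>_eq)
  have \<phi>: "integrable lborel \<phi>" and real: "\<And>\<xi>. ?F \<xi> \<in> \<real>"
    using assms(7) by (auto simp: mollifier_kernel_def)
  have [measurable]: "\<phi> \<in> borel_measurable borel"
    using \<phi> by auto
  obtain c1 c2 where c: "c1 > 0" "c2 > 0"
    and bounds: "\<And>\<eta>. c1 * min 1 (norm \<eta> powr s) \<le> 1 - Re (?F \<eta>)" "\<And>\<eta>. 1 - Re (?F \<eta>) \<le> c2 * norm \<eta> powr s"
    using mollifier_kernel_symbol_bounds[OF assms(7,6)] by metis
  define KN where "KN = 1 / (2 * c1) + exp ((2 * pi) powr (2 * \<tau>) * G)"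
  define KB where "KB = (4 * G) powr q * (2 * pi) powr p + 1"
  define W where "W = c2\<^sup>2 * ((4 * G) powr (- (s / \<tau>)) * (2 * pi) powr (- (2 * s)))"
  have K: "0 < KN" "0 < KB"
    using c G by (auto simp: KN_def KB_def intro!: add_nonneg_pos)
  \<comment> \<open>A bound for fixed \<open>z\<close>, uniform in the data: all that is asymptotic
    has been put into the condition on \<open>z\<close>.\<close>
  have error: "L2norm (\<lambda>x. u0 x - regularized \<gamma> T \<tau> \<phi> (exp (- z) powr (1 / (2 * s))) g\<delta> x)
      \<le> KB * z powr (- q) * Sobolev_norm p u0 + KN * exp (z / 2) * L2norm (\<lambda>x. heat_op \<gamma> T \<tau> u0 x - g\<delta> x)"
    if z: "0 < z" "W * (exp (- z / 2) * z powr (s / \<tau> + q)) \<le> 1" and u0: "u0 \<in> Sobolev p" and g\<delta>: "g\<delta> \<in> L2"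
    for z u0 g\<delta>
  proof -
    define \<beta> where "\<beta> = exp (- z) powr (1 / (2 * s))"
    have \<beta>: "\<beta> > 0" by (simp add: \<beta>_def)
    define m where "m \<xi> = 1 - Re (?F (\<beta> *\<^sub>R \<xi>))" for \<xi>
    have [measurable]: "m \<in> borel_measurable borel"
      unfolding m_def[abs_def] by measurable
    have F_eq: "?F (\<beta> *\<^sub>R \<xi>) = complex_of_real (1 - m \<xi>)" for \<xi>
      using real[of "\<beta> *\<^sub>R \<xi>"] by (simp add: m_def of_real_Re)
    \<comment> \<open>The exponent \<open>1 / (2 * s)\<close> of the selection rule is what makes
      \<open>\<beta> powr s\<close> the square root of \<open>exp (- z)\<close>.\<close>
    have norm_powr: "norm (\<beta> *\<^sub>R \<xi>) powr s = exp (- z / 2) * norm \<xi> powr s" for \<xi>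
      using \<beta> assms(6) by (simp add: powr_mult) (simp add: \<beta>_def powr_powr powr_def)
    have m: "c1 * min 1 (exp (- z / 2) * norm \<xi> powr s) \<le> m \<xi>" "m \<xi> \<le> c2 * (exp (- z / 2) * norm \<xi> powr s)" for \<xi>
      using bounds[of "\<beta> *\<^sub>R \<xi>"] unfolding m_def norm_powr by auto
    note pos = \<open>c1 > 0\<close> \<open>c2 > 0\<close> assms(6,2,8) G norm_ge_zero z(1)
    define c where "c = min ((c1 * exp (- z / 2))\<^sup>2) ((exp (- ((2 * pi) powr (2 * \<tau>) * G)))\<^sup>2)"
    have c: "0 < c" "c \<le> (?\<psi> \<xi>)\<^sup>2 + (m \<xi>)\<^sup>2" for \<xi>
      using symbol_lower_bound[OF pos m] \<open>c1 > 0\<close> by (simp_all add: c_def \<psi>_eq)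
    have D: "0 < (?\<psi> \<xi>)\<^sup>2 + (m \<xi>)\<^sup>2" for \<xi>
      using c(1) c(2)[of \<xi>] by linarith
    define B where "B = 1 + (\<integral>x. \<bar>\<phi> x\<bar> \<partial>lborel)"
    have "\<bar>m \<xi>\<bar> \<le> B" for \<xi>
      using norm_fourier_le[of "\<lambda>x. complex_of_real (\<phi> x)" "\<beta> *\<^sub>R \<xi>"] abs_Re_le_cmod[of "?F (\<beta> *\<^sub>R \<xi>)"]
      by (simp add: m_def B_def)
    moreover have "\<bar>?\<psi> \<xi>\<bar> \<le> B" for \<xi>
    proof -
      have "0 \<le> (\<integral>x. \<bar>\<phi> x\<bar> \<partial>lborel)" by simp
      then show ?thesis using \<psi>_le[of \<xi>] unfolding B_def by linarith
    qed
    moreover note fourier_L2_mollify[OF \<phi> \<beta>, unfolded F_eq]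
    moreover note A = fourier_multiplier[OF _ borel_measurable_heat_symbol \<psi>_le, folded heat_op_def]
    ultimately have u: "regularized \<gamma> T \<tau> \<phi> \<beta> g\<delta> \<in> L2"
      "AE \<xi> in lborel. fourier_L2 (regularized \<gamma> T \<tau> \<phi> \<beta> g\<delta>) \<xi>
        = complex_of_real (?\<psi> \<xi> / ((?\<psi> \<xi>)\<^sup>2 + (m \<xi>)\<^sup>2)) * fourier_L2 g\<delta> \<xi>"
      unfolding regularized_def
      using fourier_L2_Tikhonov_minimizer[of ?\<psi> m B c "heat_op \<gamma> T \<tau>" "mollify \<phi> \<beta>" g\<delta>]
        c mollify_L2[OF \<phi> \<beta>] g\<delta> by auto
    have u0L2: "u0 \<in> L2" using u0 by (simp add: Sobolev_def)
    have "L2norm (\<lambda>x. u0 x - regularized \<gamma> T \<tau> \<phi> \<beta> g\<delta> x)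
      \<le> KB * z powr (- q) * L2norm (\<lambda>\<xi>. complex_of_real ((1 + (norm \<xi>)\<^sup>2) powr (p / 2)) * fourier_L2 u0 \<xi>)
        + KN * exp (z / 2) * L2norm (\<lambda>x. heat_op \<gamma> T \<tau> u0 x - g\<delta> x)"
    proof (rule L2norm_regularization_error[OF _ _ _ D _ _ _ u0L2 u(1) A(1)[OF u0L2] g\<delta> Sobolev_weight(1)[OF u0] A(2)[OF u0L2] u(2)])
      show "\<bar>?\<psi> \<xi>\<bar> / ((?\<psi> \<xi>)\<^sup>2 + (m \<xi>)\<^sup>2) \<le> KN * exp (z / 2)" for \<xi>
        using noise_symbol_bound[OF pos m] by (simp add: \<psi>_eq KN_def)
      show "(m \<xi>)\<^sup>2 / ((?\<psi> \<xi>)\<^sup>2 + (m \<xi>)\<^sup>2) \<le> KB * z powr (- q) * (1 + (norm \<xi>)\<^sup>2) powr (p / 2)" for \<xi>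
        using bias_symbol_bound[OF pos m] z(2) unfolding \<psi>_eq KB_def W_def assms(9) by simp
    qed (use K in auto)
    then show ?thesis
      by (simp add: Sobolev_weight(2)[OF u0] \<beta>_def)
  qed
  \<comment> \<open>The second condition serves the comparison of the two logarithmic rates, the
    third the bias bound.\<close>
  have ev: "\<forall>\<^sub>F z in at_top. 1 \<le> z \<and> 2 * q * ln z \<le> z \<and> W * (exp (- z / 2) * z powr (s / \<tau> + q)) \<le> 1"
  proof (intro eventually_conj)
    show "\<forall>\<^sub>F z::real in at_top. 1 \<le> z" by (rule eventually_ge_at_top)
    show "\<forall>\<^sub>F z::real in at_top. 2 * q * ln z \<le> z"
      using q by real_asymp
    have "((\<lambda>z. exp (- z / 2) * z powr (s / \<tau> + q)) \<longlongrightarrow> 0) at_top"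
      by real_asymp
    then have "((\<lambda>z. W * (exp (- z / 2) * z powr (s / \<tau> + q))) \<longlongrightarrow> 0) at_top"
      by (rule tendsto_mult_right_zero)
    then show "\<forall>\<^sub>F z in at_top. W * (exp (- z / 2) * z powr (s / \<tau> + q)) \<le> 1"
      using order_tendstoD(2)[of _ 0 at_top 1] by (fastforce elim: eventually_mono)
  qed
  \<comment> \<open>The bias is measured by E = \<rho> / C, which accounts for
    \<open>KB / C\<close>; \<open>KN\<close> comes from the noise and \<open>2 powr q\<close> from
    passing to \<open>f_log q (\<delta>\<^sup>2 / \<rho>\<^sup>2)\<close>.\<close>
  define K where "K = (KB / C + KN) * 2 powr q"
  have "K > 0" using K assms(10) by (simp add: K_def add_pos_pos)
  show ?thesis
  proof (intro exI[of _ K] conjI allI impI \<open>K > 0\<close>)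
    fix E \<rho> :: real assume E: "0 < E" and \<rho>: "\<rho> = C * E"
    then have \<rho>pos: "\<rho> > 0" using assms(10) by simp
    have lim: "filterlim (\<lambda>\<delta>. \<delta> / \<rho>) (at_right 0) (at_right 0)"
      using \<rho>pos by real_asymp
    have pos: "\<forall>\<^sub>F \<delta> in at_right 0. 0 < (\<delta>::real)"
      by (simp add: eventually_at_right_less)
    show "\<exists>\<epsilon>\<in>o[at_right 0](\<lambda>_. 1 :: real). \<forall>\<^sub>F \<delta> in at_right 0.
        \<forall>u0 g g\<delta>. u0 \<in> Sobolev p \<and> Sobolev_norm p u0 \<le> E \<and> g = heat_op \<gamma> T \<tau> u0 \<and>
          g\<delta> \<in> L2 \<and> L2norm (\<lambda>x. g x - g\<delta> x) \<le> \<delta> \<longrightarrow>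
          L2norm (\<lambda>x. u0 x - regularized \<gamma> T \<tau> \<phi> (Theta_inv q (\<delta> / \<rho>) powr (1 / (2 * s))) g\<delta> x)
            \<le> K * \<rho> * f_log q (\<delta>\<^sup>2 / \<rho>\<^sup>2) * (1 + \<epsilon> \<delta>)"
    proof (intro bexI[of _ "\<lambda>_. 0"])
      show "\<forall>\<^sub>F \<delta> in at_right 0.
        \<forall>u0 g g\<delta>. u0 \<in> Sobolev p \<and> Sobolev_norm p u0 \<le> E \<and> g = heat_op \<gamma> T \<tau> u0 \<and>
          g\<delta> \<in> L2 \<and> L2norm (\<lambda>x. g x - g\<delta> x) \<le> \<delta> \<longrightarrow>
          L2norm (\<lambda>x. u0 x - regularized \<gamma> T \<tau> \<phi> (Theta_inv q (\<delta> / \<rho>) powr (1 / (2 * s))) g\<delta> x)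
            \<le> K * \<rho> * f_log q (\<delta>\<^sup>2 / \<rho>\<^sup>2) * (1 + 0)"
        using eventually_compose_filterlim[OF Theta_inv_eventually[OF q ev] lim] pos
      proof eventually_elim
        case (elim \<delta>)
        then obtain z where z: "1 \<le> z" "2 * q * ln z \<le> z" "W * (exp (- z / 2) * z powr (s / \<tau> + q)) \<le> 1" "0 < z"
          and a: "Theta_inv q (\<delta> / \<rho>) = exp (- z)" and \<delta>: "exp (- z / 2) * z powr (- q) = \<delta> / \<rho>"
          by blast
        \<comment> \<open>The balance built into the selection rule: the amplified noise has exactly
          the rate of the bias.\<close>
        have \<delta>z: "exp (z / 2) * \<delta> = \<rho> * z powr (- q)"
        proof -
          have "\<delta> = \<rho> * (exp (- z / 2) * z powr (- q))"
            using \<delta> \<rho>pos by simp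
          then have "exp (z / 2) * \<delta> = \<rho> * z powr (- q) * (exp (z / 2) * exp (- z / 2))"
            by (simp only: mult_ac)
          also have "exp (z / 2) * exp (- z / 2) = 1"
            by (simp flip: exp_add)
          finally show ?thesis by simp
        qed
        have fq: "z powr (- q) \<le> 2 powr q * f_log q (\<delta>\<^sup>2 / \<rho>\<^sup>2)"
          using f_log_square_ge[OF q z(1,2)] unfolding \<delta> power_divide .
        show ?case
        proof (intro allI impI, elim conjE)
          fix u0 g g\<delta> :: "real ^ 'n \<Rightarrow> complex"
          assume u0: "u0 \<in> Sobolev p" "Sobolev_norm p u0 \<le> E" and g: "g = heat_op \<gamma> T \<tau> u0"
            and g\<delta>: "g\<delta> \<in> L2" "L2norm (\<lambda>x. g x - g\<delta> x) \<le> \<delta>"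
          have "L2norm (\<lambda>x. u0 x - regularized \<gamma> T \<tau> \<phi> (Theta_inv q (\<delta> / \<rho>) powr (1 / (2 * s))) g\<delta> x)
              \<le> KB * z powr (- q) * Sobolev_norm p u0 + KN * exp (z / 2) * L2norm (\<lambda>x. g x - g\<delta> x)"
            unfolding a g by (rule error[OF z(4,3) u0(1) g\<delta>(1)])
          also have "\<dots> \<le> KB * z powr (- q) * E + KN * exp (z / 2) * \<delta>"
            using K by (intro add_mono mult_left_mono u0 g\<delta>) auto
          also have "\<dots> = (KB / C + KN) * \<rho> * z powr (- q)"
            unfolding mult.assoc[of KN] \<delta>z using assms(10) by (simp add: \<rho> field_simps)
          also have "\<dots> \<le> (KB / C + KN) * \<rho> * (2 powr q * f_log q (\<delta>\<^sup>2 / \<rho>\<^sup>2))"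
            using K assms(10) \<rho>pos by (intro mult_left_mono fq) auto
          finally show "L2norm (\<lambda>x. u0 x - regularized \<gamma> T \<tau> \<phi> (Theta_inv q (\<delta> / \<rho>) powr (1 / (2 * s))) g\<delta> x)
              \<le> K * \<rho> * f_log q (\<delta>\<^sup>2 / \<rho>\<^sup>2) * (1 + 0)"
            by (simp add: K_def mult_ac)
        qed
      qed
    qed simp
  qed
qed

end
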